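(* Let $\Gamma$ be a finitely generated group and let $Z\subset\mathrm{Sub}(\Gamma)$ be a sofic uniformly recurrent subgroup. Then there exists a $Z$-proper Bernoulli subshift of $Z$ (over some finite alphabet $K$) that admits a $\Gamma$-invariant Borel probability measure. In particular, for every finitely generated sofic group $\Gamma$ there exists a free Bernoulli subshift of $\Gamma$ (a closed $\Gamma$-invariant subset of $K^\Gamma$ for some finite alphabet $K$, on which $\Gamma$ acts freely) that admits a $\Gamma$-invariant Borel probability measure.
   Context: $\mathrm{Sub}(\Gamma)$ is the compact space of subgroups of $\Gamma$, with $\Gamma$ acting by conjugation. A uniformly recurrent subgroup (URS) is a nonempty closed invariant $Z\subset\mathrm{Sub}(\Gamma)$ on which the action is minimal (every orbit is dense). Schreier graphs: fix a finite generating system $Q=\{\gamma_1,\dots,\gamma_n\}$ of $\Gamma$. For $H\in\mathrm{Sub}(\Gamma)$, the Schreier graph $S^Q_\Gamma(H)$ has vertex set $\Gamma/H$, and the vertices $aH,bH$ are connected by a directed edge labeled $\gamma_i$ if $\gamma_i aH=bH$ (and by one labeled $\gamma_i^{-1}$ if $\gamma_i bH=aH$); loops and multiple labels are allowed; the root is the vertex $H$. $B_r(S,x)$ is the ball of radius $r$ around $x$ in the shortest path metric, as a graph rooted at $x$ with edge labels. Colored Schreier graphs: for a finite alphabet $K$, $\mathrm{Sch}^{K,Q}_\Gamma$ is the compact metrizable space of all rooted Schreier graphs $S^Q_\Gamma(H)$, $H\in\mathrm{Sub}(\Gamma)$, equipped with a vertex coloring $c:\Gamma/H\to K$; two elements are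 at distance $2^{-r}$ if $r$ is the largest integer for which the $r$-balls around the roots are rooted-colored-labeled isomorphic. $\Gamma$ acts by changing the root: $\gamma$ sends the colored graph with root $x$ to the same colored graph with root $\gamma x$. $B^K(Z)\subset\mathrm{Sch}^{K,Q}_\Gamma$ is the set of elements whose underlying Schreier graph is $S^Q_\Gamma(H)$ with $H\in Z$. A Bernoulli subshift of $Z$ is a closed $\Gamma$-invariant subset of $B^K(Z)$ for some finite $K$. A continuous action $\alpha$ of $\Gamma$ on a compact metric space $X$ is $Z$-proper if for each $x\in X$, $\mathrm{Stab}_\alpha(x)\in Z$ and $\mathrm{Stab}_\alpha(x)=\mathrm{Stab}^0_\alpha(x):=\{\gamma: \gamma \text{ fixes some neighborhood of } x \text{ pointwise}\}$. Soficity: let $\kappa:\mathbb{F}_n\to\Gamma$ be the surjection from the free group on $r_1,\dots,r_n$ with $\kappa(r_i)=\gamma_i$. Let $\{G_k\}_{k\ge1}$ be a sequence of finite $\mathbb{F}_n$-Schreier graphs (with respect to $\{r_1,\dots,r_n\}$). A vertex $p\in V(G_k)$ is a $(Z,r)$-vertex if for some $H\in Z$ there is a rooted isomorphism $B_r(G_k,p)\to B_r(S^Q_\Gamma(H),H)$ taking edges labeled $r_i$ to edges labeled $\gamma_i$. The sequence is a sofic approximation of $Z$ if for all $r\ge1$ and $\varepsilon>0$ there is $N_{r,\varepsilon}$ such that for $k\ge N_{r,\varepsilon}$ at least $(1-\varepsilon)|V(G_k)|$ vertices of $G_k$ are $(Z,r)$-vertices. The URS $Z$ is sofic if it admits a sofic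 approximation (this does not depend on $Q$). A finitely generated group $\Gamma$ is sofic if the Cayley graph of $\Gamma$ (the Schreier graph of the trivial subgroup) admits such a sofic approximation, i.e. if the URS consisting of the trivial subgroup is sofic. *)

theory Defs
  imports
    "HOL-Algebra.Group_Action"
    "HOL-Algebra.Left_Coset"
    "HOL-Algebra.Generated_Groups"
    "HOL-Probability.Probability"
begin

section \<open>Rooted edge-labelled graphs\<close>

text \<open>
  The letter \<open>(i, True)\<close> stands for the \<open>i\<close>-th generator and \<open>(i, False)\<close> for its formal inverse;
  generators are numbered from \<open>0\<close>.  Letters label the arcs of Schreier graphs and are also the
  letters of the words in the free group.
\<close>

type_synonym letter = "nat \<times> bool"

definition flip :: "letter \<Rightarrow> letter"
  where "flip x = (fst x, \<not> snd x)"

text \<open>Since an arc carries its label, loops and several labels on the same pair of vertices are allowed.\<close>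

record 'v lgraph =
  verts :: "'v set"
  arcs :: "('v \<times> letter \<times> 'v) set"

definition adj :: "'v lgraph \<Rightarrow> ('v \<times> 'v) set"
  where "adj S = {(u, v). \<exists>l. (u, l, v) \<in> arcs S \<or> (v, l, u) \<in> arcs S}"

definition path_dist :: "'v lgraph \<Rightarrow> 'v \<Rightarrow> 'v \<Rightarrow> enat"
  where "path_dist S u v = (INF k\<in>{k. (u, v) \<in> adj S ^^ k}. enat k)"

definition gball :: "'v lgraph \<Rightarrow> nat \<Rightarrow> 'v \<Rightarrow> 'v lgraph"
  where "gball S r x =
    (let V = {v \<in> verts S. path_dist S x v \<le> enat r}
     in \<lparr>verts = V, arcs = {(u, l, v). (u, l, v) \<in> arcs S \<and> u \<in> V \<and> v \<in> V}\<rparr>)"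

definition is_rooted_iso :: "('v \<Rightarrow> 'w) \<Rightarrow> 'v lgraph \<Rightarrow> 'v \<Rightarrow> 'w lgraph \<Rightarrow> 'w \<Rightarrow> bool"
  where "is_rooted_iso \<phi> A x B y \<longleftrightarrow>
    x \<in> verts A \<and> bij_betw \<phi> (verts A) (verts B) \<and> \<phi> x = y \<and>
    (\<forall>u\<in>verts A. \<forall>v\<in>verts A. \<forall>l. (u, l, v) \<in> arcs A \<longleftrightarrow> (\<phi> u, l, \<phi> v) \<in> arcs B)"

definition rooted_isomorphic :: "'v lgraph \<Rightarrow> 'v \<Rightarrow> 'w lgraph \<Rightarrow> 'w \<Rightarrow> bool"
  where "rooted_isomorphic A x B y \<longleftrightarrow> (\<exists>\<phi>. is_rooted_iso \<phi> A x B y)"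

definition colored_rooted_isomorphic ::
    "'v lgraph \<Rightarrow> ('v \<Rightarrow> 'k) \<Rightarrow> 'v \<Rightarrow> 'w lgraph \<Rightarrow> ('w \<Rightarrow> 'k) \<Rightarrow> 'w \<Rightarrow> bool"
  where "colored_rooted_isomorphic A c x B d y \<longleftrightarrow>
    (\<exists>\<phi>. is_rooted_iso \<phi> A x B y \<and> (\<forall>v\<in>verts A. d (\<phi> v) = c v))"


section \<open>Schreier graphs\<close>

definition generating_system :: "('a, 'b) monoid_scheme \<Rightarrow> 'a list \<Rightarrow> bool"
  where "generating_system G Q \<longleftrightarrow> set Q \<subseteq> carrier G \<and> generate G (set Q) = carrier G"

text \<open>
  The generators are labelled by their position in the list \<open>Q\<close>, so that a label is meaningful
  even if \<open>Q\<close> has repetitions or contains both an element and its inverse.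
\<close>

definition schreier_graph :: "('a, 'b) monoid_scheme \<Rightarrow> 'a list \<Rightarrow> 'a set \<Rightarrow> 'a set lgraph"
  where "schreier_graph G Q H =
    \<lparr>verts = lcosets\<^bsub>G\<^esub> H,
     arcs = {(X, (i, True), Y) | X Y i.
               X \<in> lcosets\<^bsub>G\<^esub> H \<and> Y \<in> lcosets\<^bsub>G\<^esub> H \<and> i < length Q \<and> Q ! i <#\<^bsub>G\<^esub> X = Y} \<union>
            {(X, (i, False), Y) | X Y i.
               X \<in> lcosets\<^bsub>G\<^esub> H \<and> Y \<in> lcosets\<^bsub>G\<^esub> H \<and> i < length Q \<and> Q ! i <#\<^bsub>G\<^esub> Y = X}\<rparr>"


section \<open>Continuous actions, \<open>Z\<close>-proper actions and invariant measures\<close>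

definition continuous_action ::
    "('a, 'b) monoid_scheme \<Rightarrow> 'x topology \<Rightarrow> ('a \<Rightarrow> 'x \<Rightarrow> 'x) \<Rightarrow> bool"
  where "continuous_action G X \<alpha> \<longleftrightarrow>
    group_action G (topspace X) \<alpha> \<and> (\<forall>g\<in>carrier G. continuous_map X X (\<alpha> g))"

definition stabilizer0 ::
    "('a, 'b) monoid_scheme \<Rightarrow> 'x topology \<Rightarrow> ('a \<Rightarrow> 'x \<Rightarrow> 'x) \<Rightarrow> 'x \<Rightarrow> 'a set"
  where "stabilizer0 G X \<alpha> x =
    {g \<in> carrier G. \<exists>U. openin X U \<and> x \<in> U \<and> (\<forall>y\<in>U. \<alpha> g y = y)}"

definition Z_proper ::
    "('a, 'b) monoid_scheme \<Rightarrow> 'a set set \<Rightarrow> 'x topology \<Rightarrow> ('a \<Rightarrow> 'x \<Rightarrow> 'x) \<Rightarrow> bool"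
  where "Z_proper G Z X \<alpha> \<longleftrightarrow>
    compact_space X \<and> metrizable_space X \<and> continuous_action G X \<alpha> \<and>
    (\<forall>x\<in>topspace X. stabilizer G \<alpha> x \<in> Z \<and> stabilizer G \<alpha> x = stabilizer0 G X \<alpha> x)"

definition free_action ::
    "('a, 'b) monoid_scheme \<Rightarrow> 'x set \<Rightarrow> ('a \<Rightarrow> 'x \<Rightarrow> 'x) \<Rightarrow> bool"
  where "free_action G E \<alpha> \<longleftrightarrow>
    group_action G E \<alpha> \<and> (\<forall>x\<in>E. stabilizer G \<alpha> x = {\<one>\<^bsub>G\<^esub>})"

definition invariant_borel_probability ::
    "('a, 'b) monoid_scheme \<Rightarrow> 'x topology \<Rightarrow> ('a \<Rightarrow> 'x \<Rightarrow> 'x) \<Rightarrow> 'x measure \<Rightarrow> bool"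
  where "invariant_borel_probability G X \<alpha> \<mu> \<longleftrightarrow>
    space \<mu> = topspace X \<and> sets \<mu> = sigma_sets (topspace X) {U. openin X U} \<and>
    prob_space \<mu> \<and>
    (\<forall>g\<in>carrier G. \<alpha> g \<in> \<mu> \<rightarrow>\<^sub>M \<mu> \<and> distr \<mu> \<mu> (\<alpha> g) = \<mu>)"


section \<open>Uniformly recurrent subgroups\<close>

text \<open>The space of subgroups carries the topology induced from the product space of all subsets.\<close>

definition Sub_topology :: "('a, 'b) monoid_scheme \<Rightarrow> 'a set topology"
  where "Sub_topology G =
    pullback_topology {H. subgroup H G} (\<lambda>H. \<lambda>g\<in>carrier G. g \<in> H)
      (product_topology (\<lambda>_. discrete_topology (UNIV :: bool set)) (carrier G))"

definition conj_sub :: "('a, 'b) monoid_scheme \<Rightarrow> 'a \<Rightarrow> 'a set \<Rightarrow> 'a set"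
  where "conj_sub G g H = g <#\<^bsub>G\<^esub> H #>\<^bsub>G\<^esub> inv\<^bsub>G\<^esub> g"

definition URS :: "('a, 'b) monoid_scheme \<Rightarrow> 'a set set \<Rightarrow> bool"
  where "URS G Z \<longleftrightarrow>
    Z \<noteq> {} \<and> closedin (Sub_topology G) Z \<and>
    (\<forall>g\<in>carrier G. \<forall>H\<in>Z. conj_sub G g H \<in> Z) \<and>
    (\<forall>H\<in>Z. Abstract_Topology.closure_of (subtopology (Sub_topology G) Z) (orbit G (conj_sub G) H) = Z)"


section \<open>The free group of rank \<open>n\<close>\<close>

definition reduced :: "letter list \<Rightarrow> bool"
  where "reduced w \<longleftrightarrow> successively (\<lambda>x y. y \<noteq> flip x) w"

fun push :: "letter \<Rightarrow> letter list \<Rightarrow> letter list"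
  where
    "push x [] = [x]"
  | "push x (y # ys) = (if y = flip x then ys else x # y # ys)"

definition free_group :: "nat \<Rightarrow> letter list monoid"
  where "free_group n =
    \<lparr>carrier = {w. reduced w \<and> fst ` set w \<subseteq> {..<n}}, monoid.mult = foldr push, one = []\<rparr>"

definition free_generators :: "nat \<Rightarrow> letter list list"
  where "free_generators n = map (\<lambda>i. [(i, True)]) [0..<n]"

lemma flip_flip [simp]: "flip (flip x) = x"
  by (simp add: flip_def)

lemma flip_neq [simp]: "flip x \<noteq> x" "x \<noteq> flip x"
  by (auto simp: flip_def prod_eq_iff)

lemma fst_flip [simp]: "fst (flip x) = fst x"
  by (simp add: flip_def)

lemma reduced_Nil [simp]: "reduced []"
  by (simp add: reduced_def)

lemma reduced_Cons: "reduced (x # w) \<longleftrightarrow> reduced w \<and> (w = [] \<or> hd w \<noteq> flip x)"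
  by (cases w) (auto simp: reduced_def)

lemma reduced_push: "reduced w \<Longrightarrow> reduced (push x w)"
  by (cases w) (auto simp: reduced_Cons)

lemma reduced_foldr_push: "reduced w \<Longrightarrow> reduced (foldr push v w)"
  by (induction v) (auto simp: reduced_push)

lemma push_flip_push: "reduced w \<Longrightarrow> push (flip x) (push x w) = w"
  by (cases w) (auto simp: reduced_Cons split: if_splits, metis flip_flip list.sel(1) neq_Nil_conv push.simps)

lemma foldr_push_push:
  assumes "reduced w"
  shows "foldr push (push x v) w = push x (foldr push v w)"
proof (cases v)
  case (Cons y ys)
  show ?thesis
  proof (cases "y = flip x")
    case True
    then show ?thesis
      using Cons push_flip_push[of "foldr push ys w" "flip x"] reduced_foldr_push[OF assms]
      by simp
  qed (use Cons in simp)
qed simp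

lemma foldr_push_assoc:
  "reduced w \<Longrightarrow> foldr push (foldr push u v) w = foldr push u (foldr push v w)"
  by (induction u) (simp_all add: foldr_push_push)

lemma set_push: "set (push x w) \<subseteq> insert x (set w)"
  by (cases w) auto

lemma set_foldr_push: "set (foldr push v w) \<subseteq> set v \<union> set w"
proof (induction v)
  case (Cons x v)
  then show ?case using set_push[of x "foldr push v w"] by auto
qed simp

lemma foldr_push_Nil: "reduced w \<Longrightarrow> foldr push w [] = w"
proof (induction w)
  case (Cons x w)
  then show ?case by (cases w) (auto simp: reduced_Cons)
qed simp

lemma foldr_push_inverse: "foldr push (rev (map flip w)) w = []"
  by (induction w) simp_all

lemma reduced_rev_flip:
  assumes "reduced w" shows "reduced (rev (map flip w))"
  using assms unfolding reduced_def
  by (auto simp: successively_rev successively_map elim!: successively_mono)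

lemma group_free_group: "group (free_group n)"
proof (rule groupI)
  fix u v w
  assume u: "u \<in> carrier (free_group n)" and v: "v \<in> carrier (free_group n)"
    and w: "w \<in> carrier (free_group n)"
  show "u \<otimes>\<^bsub>free_group n\<^esub> v \<in> carrier (free_group n)"
    using u v set_foldr_push[of u v] by (fastforce simp: free_group_def reduced_foldr_push)
  show "u \<otimes>\<^bsub>free_group n\<^esub> v \<otimes>\<^bsub>free_group n\<^esub> w = u \<otimes>\<^bsub>free_group n\<^esub> (v \<otimes>\<^bsub>free_group n\<^esub> w)"
    using w by (simp add: free_group_def foldr_push_assoc)
next
  fix u assume u: "u \<in> carrier (free_group n)"
  show "\<one>\<^bsub>free_group n\<^esub> \<otimes>\<^bsub>free_group n\<^esub> u = u"
    by (simp add: free_group_def)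
  show "\<exists>v\<in>carrier (free_group n). v \<otimes>\<^bsub>free_group n\<^esub> u = \<one>\<^bsub>free_group n\<^esub>"
    by (rule bexI[of _ "rev (map flip u)"])
       (use u in \<open>auto simp: free_group_def foldr_push_inverse reduced_rev_flip image_image\<close>)
qed (simp add: free_group_def)


section \<open>Soficity\<close>

definition Zr_vertex ::
    "('a, 'b) monoid_scheme \<Rightarrow> 'a list \<Rightarrow> 'a set set \<Rightarrow> nat \<Rightarrow> 'v lgraph \<Rightarrow> 'v \<Rightarrow> bool"
  where "Zr_vertex G Q Z r S p \<longleftrightarrow>
    (\<exists>H\<in>Z. rooted_isomorphic (gball S r p) p (gball (schreier_graph G Q H) r H) H)"

text \<open>
  The \<open>k\<close>-th graph of the sequence is the Schreier graph of the finite index subgroup \<open>L k\<close> of the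
  free group.
\<close>

definition sofic_approximation ::
    "('a, 'b) monoid_scheme \<Rightarrow> 'a list \<Rightarrow> 'a set set \<Rightarrow> (nat \<Rightarrow> letter list set) \<Rightarrow> bool"
  where "sofic_approximation G Q Z L \<longleftrightarrow>
    (let n = length Q; S = (\<lambda>k. schreier_graph (free_group n) (free_generators n) (L k)) in
      (\<forall>k. subgroup (L k) (free_group n) \<and> finite (verts (S k))) \<and>
      (\<forall>r\<ge>1. \<forall>\<epsilon>>0. \<exists>N. \<forall>k\<ge>N.
        real (card {p \<in> verts (S k). Zr_vertex G Q Z r (S k) p}) \<ge> (1 - \<epsilon>) * real (card (verts (S k)))))"

definition sofic_URS :: "('a, 'b) monoid_scheme \<Rightarrow> 'a list \<Rightarrow> 'a set set \<Rightarrow> bool"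
  where "sofic_URS G Q Z \<longleftrightarrow> URS G Z \<and> (\<exists>L. sofic_approximation G Q Z L)"

definition sofic_group :: "('a, 'b) monoid_scheme \<Rightarrow> bool"
  where "sofic_group G \<longleftrightarrow> (\<exists>Q. generating_system G Q \<and> sofic_URS G Q {{\<one>\<^bsub>G\<^esub>}})"


section \<open>Colored Schreier graphs and Bernoulli subshifts of \<open>Z\<close>\<close>

text \<open>
  A rooted Schreier graph determines its subgroup \<open>H\<close> (the stabilizer of the root), so the rooted
  colored Schreier graphs are encoded as pairs \<open>(H, c)\<close>, the root being the vertex \<open>H\<close>.
\<close>

type_synonym 'a colored_schreier = "'a set \<times> ('a set \<Rightarrow> nat)"

definition Sch :: "('a, 'b) monoid_scheme \<Rightarrow> nat set \<Rightarrow> 'a colored_schreier set"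
  where "Sch G K = {(H, c). subgroup H G \<and> c \<in> lcosets\<^bsub>G\<^esub> H \<rightarrow>\<^sub>E K}"

definition sch_agree ::
    "('a, 'b) monoid_scheme \<Rightarrow> 'a list \<Rightarrow> nat \<Rightarrow> 'a colored_schreier \<Rightarrow> 'a colored_schreier \<Rightarrow> bool"
  where "sch_agree G Q r = (\<lambda>(H, c) (H', c').
    colored_rooted_isomorphic
      (gball (schreier_graph G Q H) r H) c H (gball (schreier_graph G Q H') r H') c' H')"

text \<open>
  If already the balls of radius \<open>0\<close> differ, the largest radius of agreement is \<open>-1\<close> (the ball of
  negative radius being empty), which gives distance \<open>2\<close>.
\<close>

definition sch_dist ::
    "('a, 'b) monoid_scheme \<Rightarrow> 'a list \<Rightarrow> 'a colored_schreier \<Rightarrow> 'a colored_schreier \<Rightarrow> real"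
  where "sch_dist G Q x y =
    (if x = y then 0
     else if \<not> sch_agree G Q 0 x y then 2
     else (1 / 2) ^ (GREATEST r. sch_agree G Q r x y))"

definition Sch_topology ::
    "('a, 'b) monoid_scheme \<Rightarrow> 'a list \<Rightarrow> nat set \<Rightarrow> 'a colored_schreier topology"
  where "Sch_topology G Q K = Metric_space.mtopology (Sch G K) (sch_dist G Q)"

text \<open>
  Moving the root of \<open>(H, c)\<close> to the vertex \<open>gH\<close> gives the colored Schreier graph of \<open>gHg\<^sup>-\<^sup>1\<close>: the
  vertex \<open>a(gHg\<^sup>-\<^sup>1)\<close> of the latter corresponds to the vertex \<open>agH\<close> of the former, see
  \<open>change_root_correct\<close> below.
\<close>

definition change_root ::
    "('a, 'b) monoid_scheme \<Rightarrow> 'a \<Rightarrow> 'a colored_schreier \<Rightarrow> 'a colored_schreier"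
  where "change_root G g = (\<lambda>(H, c).
    (conj_sub G g H, \<lambda>X\<in>lcosets\<^bsub>G\<^esub> (conj_sub G g H). c (X #>\<^bsub>G\<^esub> g)))"

definition B_space :: "('a, 'b) monoid_scheme \<Rightarrow> nat set \<Rightarrow> 'a set set \<Rightarrow> 'a colored_schreier set"
  where "B_space G K Z = {(H, c) \<in> Sch G K. H \<in> Z}"

definition bernoulli_subshift_of ::
    "('a, 'b) monoid_scheme \<Rightarrow> 'a list \<Rightarrow> nat set \<Rightarrow> 'a set set \<Rightarrow> 'a colored_schreier set \<Rightarrow> bool"
  where "bernoulli_subshift_of G Q K Z Y \<longleftrightarrow>
    finite K \<and> closedin (subtopology (Sch_topology G Q K) (B_space G K Z)) Y \<and>
    (\<forall>g\<in>carrier G. \<forall>y\<in>Y. change_root G g y \<in> Y)"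


section \<open>Bernoulli subshifts of the group\<close>

definition shift_topology :: "('a, 'b) monoid_scheme \<Rightarrow> nat set \<Rightarrow> ('a \<Rightarrow> nat) topology"
  where "shift_topology G K = product_topology (\<lambda>_. discrete_topology K) (carrier G)"

text \<open>
  The left action \<open>(g \<cdot> x)(a) = x(ag)\<close>, which is \<open>change_root\<close> for \<open>H = {1}\<close>.
\<close>

definition coord_shift :: "('a, 'b) monoid_scheme \<Rightarrow> 'a \<Rightarrow> ('a \<Rightarrow> nat) \<Rightarrow> ('a \<Rightarrow> nat)"
  where "coord_shift G g x = (\<lambda>a\<in>carrier G. x (a \<otimes>\<^bsub>G\<^esub> g))"

definition bernoulli_subshift :: "('a, 'b) monoid_scheme \<Rightarrow> nat set \<Rightarrow> ('a \<Rightarrow> nat) set \<Rightarrow> bool"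
  where "bernoulli_subshift G K Y \<longleftrightarrow>
    finite K \<and> closedin (shift_topology G K) Y \<and> (\<forall>g\<in>carrier G. \<forall>y\<in>Y. coord_shift G g y \<in> Y)"

text \<open>
  An action in the sense of \<^locale>\<open>group_action\<close> consists of maps that are extensional on the
  space acted upon, hence the restriction.
\<close>

definition act_on :: "'x set \<Rightarrow> ('a \<Rightarrow> 'x \<Rightarrow> 'x) \<Rightarrow> 'a \<Rightarrow> 'x \<Rightarrow> 'x"
  where "act_on Y \<alpha> g = restrict (\<alpha> g) Y"


section \<open>Correctness of the change of root\<close>

lemma verts_schreier_graph [simp]: "verts (schreier_graph G Q H) = lcosets\<^bsub>G\<^esub> H"
  by (simp add: schreier_graph_def)

lemma arcs_schreier_graph:
  "(X, (i, b), Y) \<in> arcs (schreier_graph G Q H) \<longleftrightarrow>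
    X \<in> lcosets\<^bsub>G\<^esub> H \<and> Y \<in> lcosets\<^bsub>G\<^esub> H \<and> i < length Q \<and>
    (if b then Q ! i <#\<^bsub>G\<^esub> X = Y else Q ! i <#\<^bsub>G\<^esub> Y = X)"
  by (auto simp: schreier_graph_def)

lemma is_rooted_iso_arc:
  "is_rooted_iso \<phi> A x B y \<Longrightarrow> u \<in> verts A \<Longrightarrow> v \<in> verts A \<Longrightarrow>
    (u, l, v) \<in> arcs A \<longleftrightarrow> (\<phi> u, l, \<phi> v) \<in> arcs B"
  unfolding is_rooted_iso_def by blast

context group
begin

lemma conj_sub_subset: "H \<subseteq> carrier G \<Longrightarrow> g \<in> carrier G \<Longrightarrow> conj_sub G g H \<subseteq> carrier G"
  by (simp add: conj_sub_def l_coset_subset_G r_coset_subset_G)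

lemma lcos_conj_sub:
  assumes "H \<subseteq> carrier G" "a \<in> carrier G" "g \<in> carrier G"
  shows "(a <# conj_sub G g H) #> g = (a \<otimes> g) <# H"
proof -
  have "(a <# conj_sub G g H) #> g = a <# (conj_sub G g H #> g)"
    using assms by (simp add: coset_assoc conj_sub_subset)
  also have "conj_sub G g H #> g = g <# H"
    using assms by (simp add: conj_sub_def coset_mult_assoc l_coset_subset_G)
  finally show ?thesis
    using assms by (simp add: lcos_m_assoc)
qed

lemma lcosetsI: "a \<in> carrier G \<Longrightarrow> a <# H \<in> lcosets H"
  by (auto simp: LCOSETS_def)

lemma lcosetsE:
  assumes "X \<in> lcosets H" obtains a where "a \<in> carrier G" "X = a <# H"
  using assms by (auto simp: LCOSETS_def)

lemma bij_betw_lcosets_conj_sub: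
  assumes H: "H \<subseteq> carrier G" and g: "g \<in> carrier G"
  shows "bij_betw (\<lambda>X. X #> g) (lcosets (conj_sub G g H)) (lcosets H)"
proof (rule bij_betwI')
  fix X Y assume "X \<in> lcosets (conj_sub G g H)" "Y \<in> lcosets (conj_sub G g H)"
  then have X: "X \<subseteq> carrier G" "Y \<subseteq> carrier G"
    using conj_sub_subset[OF H g] by (auto elim!: lcosetsE simp: l_coset_subset_G subset_iff l_coset_def)
  then have "X #> g #> inv g = X" "Y #> g #> inv g = Y"
    using g by (simp_all add: coset_mult_assoc)
  then show "X #> g = Y #> g \<longleftrightarrow> X = Y"
    by metis
next
  fix X assume "X \<in> lcosets (conj_sub G g H)"
  then show "X #> g \<in> lcosets H"
    using H g by (auto elim!: lcosetsE simp: lcos_conj_sub lcosetsI)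
next
  fix Y assume "Y \<in> lcosets H"
  then obtain b where b: "b \<in> carrier G" "Y = b <# H" by (rule lcosetsE)
  then have "Y = ((b \<otimes> inv g) <# conj_sub G g H) #> g"
    using lcos_conj_sub[OF H _ g, of "b \<otimes> inv g"] g by (simp add: m_assoc)
  moreover have "(b \<otimes> inv g) <# conj_sub G g H \<in> lcosets (conj_sub G g H)"
    using b g by (simp add: lcosetsI)
  ultimately show "\<exists>X\<in>lcosets (conj_sub G g H). Y = X #> g"
    by (rule bexI)
qed

lemma change_root_correct:
  assumes H: "subgroup H G" and Q: "set Q \<subseteq> carrier G" and g: "g \<in> carrier G"
    and hc: "change_root G g (H, c) = (H', c')"
  shows "colored_rooted_isomorphic (schreier_graph G Q H') c' H' (schreier_graph G Q H) c (g <# H)"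
proof -
  have Hs: "H \<subseteq> carrier G" by (rule subgroup.subset[OF H])
  have H': "H' = conj_sub G g H" and c': "\<And>X. X \<in> lcosets H' \<Longrightarrow> c' X = c (X #> g)"
    using hc by (auto simp: change_root_def)
  have bij: "bij_betw (\<lambda>X. X #> g) (lcosets H') (lcosets H)"
    unfolding H' by (rule bij_betw_lcosets_conj_sub[OF Hs g])
  have root: "H' #> g = g <# H"
    using lcos_conj_sub[OF Hs one_closed g] g conj_sub_subset[OF Hs g]
    by (simp add: H' lcos_mult_one)
  have H'_mem: "H' \<in> lcosets H'"
    using lcosetsI[OF one_closed, of H'] conj_sub_subset[OF Hs g] by (simp add: H' lcos_mult_one)
  have eq: "q <# X = Y \<longleftrightarrow> q <# (X #> g) = Y #> g"
    if q: "q \<in> carrier G" and X: "X \<in> lcosets H'" and Y: "Y \<in> lcosets H'" for q X Y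
  proof -
    obtain a where a: "a \<in> carrier G" "X = a <# H'" using X by (rule lcosetsE)
    have s: "H' \<subseteq> carrier G" unfolding H' by (rule conj_sub_subset[OF Hs g])
    have "q <# X = (q \<otimes> a) <# H'" using a q s by (simp add: lcos_m_assoc)
    then have "q <# X \<in> lcosets H'" using a q by (simp add: lcosetsI)
    then have "q <# X = Y \<longleftrightarrow> (q <# X) #> g = Y #> g"
      using bij Y by (auto simp: bij_betw_def inj_on_def)
    also have "(q <# X) #> g = q <# (X #> g)"
      using a q g s by (simp add: coset_assoc l_coset_subset_G)
    finally show ?thesis .
  qed
  have mem: "X #> g \<in> lcosets H" if "X \<in> lcosets H'" for X
    using bij that by (auto simp: bij_betw_def)
  have "is_rooted_iso (\<lambda>X. X #> g) (schreier_graph G Q H') H' (schreier_graph G Q H) (g <# H)"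
    unfolding is_rooted_iso_def
  proof (intro conjI ballI allI)
    fix X Y and l :: letter
    assume X: "X \<in> verts (schreier_graph G Q H')" and Y: "Y \<in> verts (schreier_graph G Q H')"
    obtain i b where l: "l = (i, b)" by (rule surj_pair[THEN exE, of l]) blast
    have "Q ! i \<in> carrier G" if "i < length Q" using Q that by auto
    then show "(X, l, Y) \<in> arcs (schreier_graph G Q H') \<longleftrightarrow>
        (X #> g, l, Y #> g) \<in> arcs (schreier_graph G Q H)"
      using X Y mem eq by (simp only: l arcs_schreier_graph verts_schreier_graph) metis
  qed (use bij root H'_mem in simp_all)
  then show ?thesis
    unfolding colored_rooted_isomorphic_def
    by (intro exI[of _ "\<lambda>X. X #> g"]) (use c' in auto)
qed

end


section \<open>The distance is a metric\<close>

lemma path_dist_le_iff: "path_dist S x v \<le> enat r \<longleftrightarrow> (\<exists>k\<le>r. (x, v) \<in> adj S ^^ k)"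
proof
  assume le: "path_dist S x v \<le> enat r"
  let ?K = "enat ` {k. (x, v) \<in> adj S ^^ k}"
  have "?K \<noteq> {}"
  proof
    assume "?K = {}"
    then have "path_dist S x v = \<infinity>" by (simp add: path_dist_def top_enat_def)
    then show False using le by simp
  qed
  then have "Inf ?K \<in> ?K"
    by (metis LeastI Inf_enat_def ex_in_conv)
  then show "\<exists>k\<le>r. (x, v) \<in> adj S ^^ k"
    using le by (auto simp: path_dist_def)
next
  assume "\<exists>k\<le>r. (x, v) \<in> adj S ^^ k"
  then obtain k where "k \<le> r" "(x, v) \<in> adj S ^^ k" by blast
  then have "path_dist S x v \<le> enat k"
    unfolding path_dist_def by (intro INF_lower) simp
  also have "enat k \<le> enat r" using \<open>k \<le> r\<close> by simp
  finally show "path_dist S x v \<le> enat r" .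
qed

lemma verts_gball: "verts (gball S r x) = {v \<in> verts S. \<exists>k\<le>r. (x, v) \<in> adj S ^^ k}"
  by (simp add: gball_def Let_def path_dist_le_iff)

lemma arcs_gball:
  "(u, l, v) \<in> arcs (gball S r x) \<longleftrightarrow>
    (u, l, v) \<in> arcs S \<and> u \<in> verts (gball S r x) \<and> v \<in> verts (gball S r x)"
  by (simp add: gball_def Let_def)

lemma verts_gball_mono: "s \<le> r \<Longrightarrow> verts (gball S s x) \<subseteq> verts (gball S r x)"
  unfolding verts_gball by (auto intro: order_trans)

lemma root_in_gball: "x \<in> verts S \<Longrightarrow> x \<in> verts (gball S r x)"
  by (auto simp: verts_gball intro!: exI[of _ 0])

lemma is_rooted_iso_refl: "x \<in> verts A \<Longrightarrow> is_rooted_iso (\<lambda>v. v) A x A x"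
  by (simp add: is_rooted_iso_def bij_betw_def)

lemma is_rooted_iso_sym:
  assumes "is_rooted_iso \<phi> A x B y"
  shows "is_rooted_iso (inv_into (verts A) \<phi>) B y A x"
proof -
  have b: "bij_betw \<phi> (verts A) (verts B)" using assms by (simp add: is_rooted_iso_def)
  have "inv_into (verts A) \<phi> w \<in> verts A" "\<phi> (inv_into (verts A) \<phi> w) = w" if "w \<in> verts B" for w
    using b that by (auto simp: bij_betw_def inv_into_into f_inv_into_f)
  moreover have "inv_into (verts A) \<phi> y = x"
    using assms b by (auto simp: is_rooted_iso_def bij_betw_def)
  moreover have "y \<in> verts B"
    using assms b by (auto simp: is_rooted_iso_def bij_betw_def)
  ultimately show ?thesis
    using assms b by (auto simp: is_rooted_iso_def bij_betw_inv_into)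
qed

lemma is_rooted_iso_trans:
  assumes "is_rooted_iso \<phi> A x B y" "is_rooted_iso \<psi> B y C z"
  shows "is_rooted_iso (\<psi> \<circ> \<phi>) A x C z"
proof -
  have "\<phi> v \<in> verts B" if "v \<in> verts A" for v
    using assms(1) that by (auto simp: is_rooted_iso_def bij_betw_def)
  then show ?thesis
    using assms by (auto simp: is_rooted_iso_def intro: bij_betw_trans)
qed

lemma is_rooted_iso_path:
  assumes iso: "is_rooted_iso \<phi> (gball A r x) x (gball B r y) y"
    and A: "\<And>u l v. (u, l, v) \<in> arcs A \<Longrightarrow> u \<in> verts A \<and> v \<in> verts A" and x: "x \<in> verts A"
  shows "(x, v) \<in> adj A ^^ k \<Longrightarrow> k \<le> r \<Longrightarrow>
    v \<in> verts (gball A r x) \<and> (y, \<phi> v) \<in> adj B ^^ k"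
proof (induction k arbitrary: v)
  case 0
  then show ?case using iso x by (auto simp: is_rooted_iso_def root_in_gball)
next
  case (Suc k)
  then obtain u where u: "(x, u) \<in> adj A ^^ k" "(u, v) \<in> adj A" by auto
  then have IH: "u \<in> verts (gball A r x)" "(y, \<phi> u) \<in> adj B ^^ k" using Suc by auto
  have v: "v \<in> verts (gball A r x)"
  proof -
    have "v \<in> verts A" using u(2) A by (auto simp: adj_def)
    then show ?thesis unfolding verts_gball using Suc.prems by blast
  qed
  obtain l where "(u, l, v) \<in> arcs A \<or> (v, l, u) \<in> arcs A" using u(2) by (auto simp: adj_def)
  then have "(u, l, v) \<in> arcs (gball A r x) \<or> (v, l, u) \<in> arcs (gball A r x)"
    using IH(1) v by (auto simp: arcs_gball)
  then have "(\<phi> u, l, \<phi> v) \<in> arcs (gball B r y) \<or> (\<phi> v, l, \<phi> u) \<in> arcs (gball B r y)"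
    using is_rooted_iso_arc[OF iso] IH(1) v by blast
  then have "(\<phi> u, \<phi> v) \<in> adj B" unfolding arcs_gball adj_def by blast
  then show ?case using IH(2) v by auto
qed

lemma is_rooted_iso_restrict:
  assumes iso: "is_rooted_iso \<phi> (gball A r x) x (gball B r y) y" and s: "s \<le> r"
    and A: "\<And>u l v. (u, l, v) \<in> arcs A \<Longrightarrow> u \<in> verts A \<and> v \<in> verts A" "x \<in> verts A"
    and B: "\<And>u l v. (u, l, v) \<in> arcs B \<Longrightarrow> u \<in> verts B \<and> v \<in> verts B" "y \<in> verts B"
  shows "is_rooted_iso \<phi> (gball A s x) x (gball B s y) y"
proof -
  let ?A = "gball A r x" and ?B = "gball B r y"
  let ?\<psi> = "inv_into (verts ?A) \<phi>"
  have bij: "bij_betw \<phi> (verts ?A) (verts ?B)" using iso by (simp add: is_rooted_iso_def)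
  have iso': "is_rooted_iso ?\<psi> ?B y ?A x"
    by (rule is_rooted_iso_sym[OF iso])
  have sub: "verts (gball A s x) \<subseteq> verts ?A" "verts (gball B s y) \<subseteq> verts ?B"
    by (rule verts_gball_mono[OF s])+
  have "\<phi> v \<in> verts (gball B s y)" if v: "v \<in> verts (gball A s x)" for v
  proof -
    obtain k where "k \<le> s" "(x, v) \<in> adj A ^^ k" using v by (auto simp: verts_gball)
    then have "(y, \<phi> v) \<in> adj B ^^ k" using is_rooted_iso_path[OF iso A] s by auto
    moreover have "\<phi> v \<in> verts ?B" using bij v sub by (auto simp: bij_betw_def)
    ultimately show ?thesis using \<open>k \<le> s\<close> unfolding verts_gball by blast
  qed
  moreover have "\<exists>v\<in>verts (gball A s x). \<phi> v = w" if w: "w \<in> verts (gball B s y)" for w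
  proof -
    obtain k where "k \<le> s" "(y, w) \<in> adj B ^^ k" using w by (auto simp: verts_gball)
    then have "(x, ?\<psi> w) \<in> adj A ^^ k" using is_rooted_iso_path[OF iso' B] s by auto
    moreover have "w \<in> \<phi> ` verts ?A" using bij w sub by (auto simp: bij_betw_def)
    then have "?\<psi> w \<in> verts ?A" "\<phi> (?\<psi> w) = w" by (auto simp: inv_into_into f_inv_into_f)
    moreover from this have "?\<psi> w \<in> verts A" by (simp add: verts_gball)
    ultimately have "?\<psi> w \<in> verts (gball A s x)" using \<open>k \<le> s\<close> unfolding verts_gball by blast
    then show ?thesis using \<open>\<phi> (?\<psi> w) = w\<close> by blast
  qed
  ultimately have im: "\<phi> ` verts (gball A s x) = verts (gball B s y)" by force
  have "bij_betw \<phi> (verts (gball A s x)) (verts (gball B s y))"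
    unfolding bij_betw_def using im bij sub by (auto simp: bij_betw_def intro: inj_on_subset)
  moreover have "(u, l, v) \<in> arcs (gball A s x) \<longleftrightarrow> (\<phi> u, l, \<phi> v) \<in> arcs (gball B s y)"
    if u: "u \<in> verts (gball A s x)" and v: "v \<in> verts (gball A s x)" for u v l
  proof -
    have uv: "u \<in> verts ?A" "v \<in> verts ?A" "\<phi> u \<in> verts (gball B s y)" "\<phi> v \<in> verts (gball B s y)"
      using u v sub im by auto
    have "(u, l, v) \<in> arcs (gball A s x) \<longleftrightarrow> (u, l, v) \<in> arcs ?A"
      using u v uv by (simp add: arcs_gball)
    also have "\<dots> \<longleftrightarrow> (\<phi> u, l, \<phi> v) \<in> arcs ?B"
      using uv by (intro is_rooted_iso_arc[OF iso])
    also have "\<dots> \<longleftrightarrow> (\<phi> u, l, \<phi> v) \<in> arcs (gball B s y)"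
      using uv sub by (auto simp: arcs_gball)
    finally show ?thesis .
  qed
  ultimately show ?thesis
    using iso root_in_gball[OF A(2)] by (simp add: is_rooted_iso_def)
qed

lemma schreier_graph_wf:
  "(u, l, v) \<in> arcs (schreier_graph G Q H) \<Longrightarrow>
    u \<in> verts (schreier_graph G Q H) \<and> v \<in> verts (schreier_graph G Q H)"
  by (auto simp: schreier_graph_def)

context group
begin

lemma root_in_schreier_graph:
  assumes "subgroup H G" shows "H \<in> verts (schreier_graph G Q H)"
  using lcosetsI[OF one_closed, of H] lcos_mult_one[OF subgroup.subset[OF assms]]
  by simp

lemma sch_agree_refl: "x \<in> Sch G K \<Longrightarrow> sch_agree G Q r x x"
  unfolding sch_agree_def colored_rooted_isomorphic_def
  by (auto simp: case_prod_beta Sch_def intro!: exI[of _ "\<lambda>v. v"] is_rooted_iso_refl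
      root_in_gball root_in_schreier_graph)

lemma sch_agree_sym:
  assumes "sch_agree G Q r x y" shows "sch_agree G Q r y x"
proof -
  obtain H c H' c' where [simp]: "x = (H, c)" "y = (H', c')" by (metis surj_pair)
  let ?A = "gball (schreier_graph G Q H) r H" and ?B = "gball (schreier_graph G Q H') r H'"
  obtain \<phi> where \<phi>: "is_rooted_iso \<phi> ?A H ?B H'" "\<forall>v\<in>verts ?A. c' (\<phi> v) = c v"
    using assms by (auto simp: sch_agree_def colored_rooted_isomorphic_def)
  have "is_rooted_iso (inv_into (verts ?A) \<phi>) ?B H' ?A H" by (rule is_rooted_iso_sym[OF \<phi>(1)])
  moreover have "c (inv_into (verts ?A) \<phi> w) = c' w" if "w \<in> verts ?B" for w
  proof -
    have "w \<in> \<phi> ` verts ?A" using \<phi>(1) that unfolding is_rooted_iso_def bij_betw_def by blast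
    then have "inv_into (verts ?A) \<phi> w \<in> verts ?A" "\<phi> (inv_into (verts ?A) \<phi> w) = w"
      by (auto simp: inv_into_into f_inv_into_f)
    then show ?thesis using \<phi>(2) by force
  qed
  ultimately show ?thesis by (auto simp: sch_agree_def colored_rooted_isomorphic_def)
qed

lemma sch_agree_trans:
  assumes "sch_agree G Q r x y" "sch_agree G Q r y z" shows "sch_agree G Q r x z"
proof -
  obtain H c H' c' H'' c'' where [simp]: "x = (H, c)" "y = (H', c')" "z = (H'', c'')"
    by (metis surj_pair)
  let ?B = "\<lambda>H. gball (schreier_graph G Q H) r H"
  obtain \<phi> \<psi> where \<phi>: "is_rooted_iso \<phi> (?B H) H (?B H') H'" "\<forall>v\<in>verts (?B H). c' (\<phi> v) = c v"
    and \<psi>: "is_rooted_iso \<psi> (?B H') H' (?B H'') H''" "\<forall>v\<in>verts (?B H'). c'' (\<psi> v) = c' v"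
    using assms by (auto simp: sch_agree_def colored_rooted_isomorphic_def)
  have "c'' ((\<psi> \<circ> \<phi>) v) = c v" if "v \<in> verts (?B H)" for v
  proof -
    have "\<phi> v \<in> verts (?B H')" using that \<phi>(1) unfolding is_rooted_iso_def bij_betw_def by blast
    then show ?thesis using that \<phi>(2) \<psi>(2) by simp
  qed
  then show ?thesis
    using is_rooted_iso_trans[OF \<phi>(1) \<psi>(1)]
    by (auto simp: sch_agree_def colored_rooted_isomorphic_def)
qed

lemma sch_agree_mono:
  assumes "x \<in> Sch G K" "y \<in> Sch G K" "sch_agree G Q r x y" "s \<le> r" shows "sch_agree G Q s x y"
proof -
  obtain H c H' c' where [simp]: "x = (H, c)" "y = (H', c')" by (metis surj_pair)
  have sub: "subgroup H G" "subgroup H' G" using assms by (auto simp: Sch_def)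
  obtain \<phi> where \<phi>:
    "is_rooted_iso \<phi> (gball (schreier_graph G Q H) r H) H (gball (schreier_graph G Q H') r H') H'"
    "\<forall>v\<in>verts (gball (schreier_graph G Q H) r H). c' (\<phi> v) = c v"
    using assms by (auto simp: sch_agree_def colored_rooted_isomorphic_def)
  have "is_rooted_iso \<phi> (gball (schreier_graph G Q H) s H) H (gball (schreier_graph G Q H') s H') H'"
    by (rule is_rooted_iso_restrict[OF \<phi>(1) assms(4) schreier_graph_wf _ schreier_graph_wf])
       (use sub root_in_schreier_graph in blast)+
  then show ?thesis
    using \<phi>(2) verts_gball_mono[OF assms(4)]
    by (fastforce simp: sch_agree_def colored_rooted_isomorphic_def)
qed

lemma generating_induct [consumes 2, case_names one gen inv]:
  assumes Q: "generating_system G Q" and g: "g \<in> carrier G"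
    and one: "P \<one>"
    and gen: "\<And>i g. i < length Q \<Longrightarrow> g \<in> carrier G \<Longrightarrow> P g \<Longrightarrow> P (Q ! i \<otimes> g)"
    and inv: "\<And>i g. i < length Q \<Longrightarrow> g \<in> carrier G \<Longrightarrow> P g \<Longrightarrow> P (inv (Q ! i) \<otimes> g)"
  shows "P g"
proof -
  have QG: "set Q \<subseteq> carrier G" using Q by (simp add: generating_system_def)
  have "\<forall>g\<in>carrier G. P g \<longrightarrow> P (h \<otimes> g)" if "h \<in> generate G (set Q)" for h
    using that
  proof (induction h rule: generate.induct)
    case (eng h1 h2)
    then show ?case
      using generate_in_carrier[OF QG] by (simp add: m_assoc)
  qed (auto simp: in_set_conv_nth gen inv)
  then show ?thesis
    using g one Q by (metis generating_system_def one_closed r_one)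
qed

lemma iso_on_cosets:
  assumes Q: "generating_system G Q" and g: "g \<in> carrier G"
    and H: "subgroup H G" and H': "subgroup H' G"
  shows "\<exists>r0. \<forall>r\<ge>r0. g <# H \<in> verts (gball (schreier_graph G Q H) r H) \<and>
    (\<forall>\<phi>. is_rooted_iso \<phi> (gball (schreier_graph G Q H) r H) H (gball (schreier_graph G Q H') r H') H'
      \<longrightarrow> \<phi> (g <# H) = g <# H')"
  using Q g
proof (induction g rule: generating_induct)
  case one
  show ?case
    using H H' by (auto simp: lcos_mult_one subgroup.subset is_rooted_iso_def
        intro!: root_in_gball root_in_schreier_graph)
next
  have step: "\<exists>r0. \<forall>r\<ge>r0. h <# H \<in> verts (gball (schreier_graph G Q H) r H) \<and>
    (\<forall>\<phi>. is_rooted_iso \<phi> (gball (schreier_graph G Q H) r H) H (gball (schreier_graph G Q H') r H') H'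
      \<longrightarrow> \<phi> (h <# H) = h <# H')"
    if IH: "\<exists>r0. \<forall>r\<ge>r0. g <# H \<in> verts (gball (schreier_graph G Q H) r H) \<and>
    (\<forall>\<phi>. is_rooted_iso \<phi> (gball (schreier_graph G Q H) r H) H (gball (schreier_graph G Q H') r H') H'
      \<longrightarrow> \<phi> (g <# H) = g <# H')"
    and arc: "(g <# H, l, h <# H) \<in> arcs (schreier_graph G Q H)"
    and det: "\<And>Y. (g <# H', l, Y) \<in> arcs (schreier_graph G Q H') \<Longrightarrow> Y = h <# H'" for g h l
  proof -
    let ?S = "schreier_graph G Q H" and ?S' = "schreier_graph G Q H'"
    obtain r0 where r0: "\<And>r. r \<ge> r0 \<Longrightarrow> g <# H \<in> verts (gball ?S r H)"
      "\<And>r \<phi>. r \<ge> r0 \<Longrightarrow> is_rooted_iso \<phi> (gball ?S r H) H (gball ?S' r H') H' \<Longrightarrow> \<phi> (g <# H) = g <# H'"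
      using IH by blast
    obtain k where k: "k \<le> r0" "(H, g <# H) \<in> adj ?S ^^ k"
      using r0(1)[of r0] by (auto simp: verts_gball)
    have "(g <# H, h <# H) \<in> adj ?S" using arc unfolding adj_def by blast
    then have "(H, h <# H) \<in> adj ?S ^^ Suc k" using k(2) by auto
    moreover have "h <# H \<in> verts ?S" using schreier_graph_wf[OF arc] by simp
    ultimately have hv: "h <# H \<in> verts (gball ?S r H)" if "r \<ge> Suc r0" for r
      unfolding verts_gball using k(1) that by (auto intro!: exI[of _ "Suc k"])
    moreover have "\<phi> (h <# H) = h <# H'"
      if r: "r \<ge> Suc r0" and \<phi>: "is_rooted_iso \<phi> (gball ?S r H) H (gball ?S' r H') H'" for r \<phi>
    proof -
      have gv: "g <# H \<in> verts (gball ?S r H)" using r0(1) r by simp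
      then have "(g <# H, l, h <# H) \<in> arcs (gball ?S r H)"
        using arc hv[OF r] by (simp add: arcs_gball)
      then have "(\<phi> (g <# H), l, \<phi> (h <# H)) \<in> arcs (gball ?S' r H')"
        using is_rooted_iso_arc[OF \<phi> gv hv[OF r]] by simp
      then show ?thesis
        using r0(2)[OF _ \<phi>] r by (intro det) (simp add: arcs_gball)
    qed
    ultimately show ?thesis by blast
  qed
  have QG: "Q ! i \<in> carrier G" if "i < length Q" for i
    using Q that by (auto simp: generating_system_def)
  note simps = schreier_graph_def lcosetsI lcos_m_assoc subgroup.subset[OF H] subgroup.subset[OF H']
  {
    case (gen i g)
    show ?case
      by (rule step[OF gen.IH, of "(i, True)"]) (use gen QG[of i] in \<open>auto simp: simps\<close>)
  next
    case (inv i g)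
    have "Y = (inv (Q ! i) \<otimes> g) <# H'" if "Y \<in> lcosets H'" "Q ! i <# Y = g <# H'" for Y
    proof -
      obtain b where b: "b \<in> carrier G" "Y = b <# H'" by (rule lcosetsE[OF \<open>Y \<in> lcosets H'\<close>])
      then have Y: "Y \<subseteq> carrier G" by (simp add: l_coset_subset_G subgroup.subset[OF H'])
      have "(inv (Q ! i) \<otimes> g) <# H' = inv (Q ! i) <# (Q ! i <# Y)"
        using inv QG[of i] that(2) by (simp add: simps)
      also have "\<dots> = Y"
        using inv QG[of i] Y by (simp add: lcos_m_assoc lcos_mult_one)
      finally show ?thesis by simp
    qed
    then show ?case
      by (intro step[OF inv.IH, of "(i, False)"])
         (use inv QG[of i] in \<open>auto simp: simps m_assoc[symmetric]\<close>)
  }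
qed

lemma sch_agree_all_imp_eq:
  assumes Q: "generating_system G Q" and x: "x \<in> Sch G K" and y: "y \<in> Sch G K"
    and agree: "\<And>r. sch_agree G Q r x y"
  shows "x = y"
proof -
  obtain H c H' c' where xy [simp]: "x = (H, c)" "y = (H', c')" by (metis surj_pair)
  have H: "subgroup H G" "subgroup H' G" and c: "c \<in> lcosets H \<rightarrow>\<^sub>E K" "c' \<in> lcosets H' \<rightarrow>\<^sub>E K"
    using x y by (auto simp: Sch_def)
  have key: "(g <# H = H \<longleftrightarrow> g <# H' = H') \<and> c (g <# H) = c' (g <# H')" if g: "g \<in> carrier G" for g
  proof -
    let ?B = "\<lambda>r H. gball (schreier_graph G Q H) r H"
    obtain r where r: "g <# H \<in> verts (?B r H)"
      "\<And>\<phi>. is_rooted_iso \<phi> (?B r H) H (?B r H') H' \<Longrightarrow> \<phi> (g <# H) = g <# H'"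
      using iso_on_cosets[OF Q g H] by blast
    obtain \<phi> where \<phi>: "is_rooted_iso \<phi> (?B r H) H (?B r H') H'" "\<forall>v\<in>verts (?B r H). c' (\<phi> v) = c v"
      using agree[of r] by (auto simp: sch_agree_def colored_rooted_isomorphic_def)
    have H_mem: "H \<in> verts (?B r H)" by (intro root_in_gball root_in_schreier_graph H)
    have "inj_on \<phi> (verts (?B r H))" and root: "\<phi> H = H'"
      using \<phi>(1) unfolding is_rooted_iso_def bij_betw_def by blast+
    then have "\<phi> (g <# H) = \<phi> H \<longleftrightarrow> g <# H = H"
      by (intro inj_on_eq_iff[OF _ r(1) H_mem])
    moreover have "c' (\<phi> (g <# H)) = c (g <# H)" using \<phi>(2) r(1) by blast
    ultimately show ?thesis using r(2)[OF \<phi>(1)] root by simp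
  qed
  have coset_eq: "g <# K' = K' \<longleftrightarrow> g \<in> K'" if "subgroup K' G" "g \<in> carrier G" for g K'
    using that by (metis coset_join3 lcos_self)
  have "H = H'"
    using key coset_eq H subgroup.subset by (metis (no_types, opaque_lifting) subset_antisym subset_iff)
  moreover have "c = c'"
  proof (rule PiE_ext[OF c(1)])
    show "c' \<in> lcosets H \<rightarrow>\<^sub>E K" using c(2) \<open>H = H'\<close> by simp
    show "c X = c' X" if "X \<in> lcosets H" for X
      using that key \<open>H = H'\<close> by (auto elim: lcosetsE)
  qed
  ultimately show ?thesis by simp
qed

lemma Metric_space_Sch:
  assumes Q: "generating_system G Q"
  shows "Metric_space (Sch G K) (sch_dist G Q)"
proof -
  let ?A = "\<lambda>x y r. sch_agree G Q r x y"
  have bdd: "\<exists>b. \<forall>r. ?A x y r \<longrightarrow> r \<le> b" if "x \<in> Sch G K" "y \<in> Sch G K" "x \<noteq> y" for x y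
  proof -
    obtain b where b: "\<not> ?A x y b" 
      using sch_agree_all_imp_eq[OF Q \<open>x \<in> Sch G K\<close> \<open>y \<in> Sch G K\<close>] \<open>x \<noteq> y\<close> by blast
    have "r \<le> b" if "?A x y r" for r
      using b sch_agree_mono[OF \<open>x \<in> Sch G K\<close> \<open>y \<in> Sch G K\<close> that, of b] by (meson nat_le_linear)
    then show ?thesis by blast
  qed
  have iff: "?A x y r \<longleftrightarrow> r \<le> (GREATEST r. ?A x y r)"
    if xy: "x \<in> Sch G K" "y \<in> Sch G K" "x \<noteq> y" and A0: "?A x y 0" for x y r
  proof -
    obtain b where b: "\<And>r. ?A x y r \<Longrightarrow> r \<le> b" using bdd[OF xy] by blast
    have "?A x y (GREATEST r. ?A x y r)" by (rule GreatestI_nat[where P = "?A x y", OF A0 b])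
    then show ?thesis
      using Greatest_le_nat[of "?A x y" r b, OF _ b] sch_agree_mono[OF xy(1,2)] by blast
  qed
  have dist_le: "sch_dist G Q x y \<le> (1 / 2) ^ r \<longleftrightarrow> ?A x y r"
    if "x \<in> Sch G K" "y \<in> Sch G K" for x y r
  proof -
    have "(2::real) > (1 / 2) ^ r" using power_le_one[of "1/2::real" r] by linarith
    then show ?thesis
      using iff[OF that, of r] sch_agree_mono[OF that, of Q r 0]
      using that by (auto simp: sch_dist_def sch_agree_refl power_decreasing_iff)
  qed
  have cases: "sch_dist G Q x y = 0 \<or> sch_dist G Q x y = 2 \<or> (\<exists>r. sch_dist G Q x y = (1 / 2) ^ r)"
    for x y by (auto simp: sch_dist_def)
  have le2: "sch_dist G Q x y \<le> 2" for x y
    using power_le_one[of "1/2::real"] by (auto simp: sch_dist_def intro: order_trans[of _ 1])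
  have nonneg: "0 \<le> sch_dist G Q x y" for x y by (simp add: sch_dist_def)
  have comm: "sch_dist G Q x y = sch_dist G Q y x" for x y
  proof -
    have "?A x y = ?A y x" by (intro ext iffI) (erule sch_agree_sym)+
    then show ?thesis by (auto simp: sch_dist_def dest: fun_cong)
  qed
  show ?thesis
  proof
    fix x y z assume M: "x \<in> Sch G K" "y \<in> Sch G K" and z: "z \<in> Sch G K"
    define m where "m = max (sch_dist G Q x y) (sch_dist G Q y z)"
    have "sch_dist G Q x z \<le> m"
    proof (cases "x = y \<or> y = z \<or> m \<ge> 2")
      case True
      then show ?thesis using le2[of x z] by (auto simp: m_def)
    next
      case False
      then have "sch_dist G Q x y \<noteq> 0" "sch_dist G Q y z \<noteq> 0" "m < 2"
        by (auto simp: sch_dist_def)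
      then obtain r where r: "m = (1 / 2) ^ r"
        using cases[of x y] cases[of y z] by (auto simp: m_def max_def split: if_splits)
      then have "?A x y r" "?A y z r"
        using dist_le[OF M, of r] dist_le[OF M(2) z, of r] unfolding r[symmetric] m_def by simp_all
      then have "?A x z r" by (rule sch_agree_trans)
      then show ?thesis using dist_le[OF M(1) z] r by simp
    qed
    then show "sch_dist G Q x z \<le> sch_dist G Q x y + sch_dist G Q y z"
      using nonneg[of x y] nonneg[of y z] by (auto simp: m_def max_def split: if_splits)
  qed (rule nonneg, rule comm, simp add: sch_dist_def)
qed

end

end

theory Submission
  imports Defs
begin

text \<open>
  A coloring of a graph is nonrepetitive if no path without self-intersections carries a color word
  of the form \<open>w w\<close>. Nonrepetitive colorings of the Schreier graphs \<open>\<Gamma>/H\<close> with \<open>H \<in> Z\<close> form a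
  closed invariant set \<open>Y\<close>, since a repetition is visible in a finite ball. If the root of such a
  colored graph is moved by \<open>g \<notin> H\<close> and the result is the same, then right translation by \<open>g\<close> is a
  fixed point free symmetry, and a geodesic from a vertex of minimal displacement to its image,
  followed by its translate, is a repetition. Hence all stabilizers are the groups \<open>H\<close> themselves,
  and \<open>Y\<close> is \<open>Z\<close>-proper.

  By Rosenfeld's counting argument finite graphs of bounded degree have nonrepetitive colorings with
  a number of colors that depends only on the degree. Color the graphs of a sofic approximation in
  this way. By compactness, for each \<open>r\<close> most vertices look up to radius \<open>r\<close> like the root of an
  element of \<open>Y\<close>, so a limit of the uniform measures on the vertex sets defines a finitely additive
  invariant probability on the clopen subsets of \<open>Y\<close>, which extends to a measure.
\<close>

section \<open>Nonrepetitive colorings of finite graphs\<close>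

text \<open>The graphs of the approximation carry an action of the free group only, and their
  vertices and the cosets in \<open>G\<close> have different types. What they share are words: a
  colored ball is recorded up to isomorphism by telling which words lead from the root to the same
  vertex and which colors they meet. All comparisons of graphs, the topology included, are made
  through these records. Distinctness, adjacency and colors along a path can be read off them, so a
  repetition passes from one graph to every graph with the same record. The alphabet must be the
  same for all graphs of the approximation, since only colorings with a fixed finite set of colors
  form a compact space; hence a bound in terms of the degree alone. A coloring copied from a ball of
  a finite graph to a Schreier graph may still have repetitions that leave the ball, and a limit
  over growing radii removes them. The measure needs no action of \<open>G\<close> on the finite
  graphs: each letter permutes their vertices, and invariance under generators suffices.\<close>

definition repetitive :: "('v \<Rightarrow> 'v \<Rightarrow> bool) \<Rightarrow> ('v \<Rightarrow> 'k) \<Rightarrow> 'v list \<Rightarrow> 'v list \<Rightarrow> bool"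
  where "repetitive R c ys zs \<longleftrightarrow>
    ys \<noteq> [] \<and> distinct (ys @ zs) \<and> successively R (ys @ zs) \<and> map c ys = map c zs"

text \<open>A repetition with halves of one vertex each is a monochromatic edge between distinct
  vertices, so such a coloring is in particular proper on \<open>S\<close>.\<close>

definition nonrepetitive_on :: "('v \<Rightarrow> 'v \<Rightarrow> bool) \<Rightarrow> 'v set \<Rightarrow> ('v \<Rightarrow> 'k) \<Rightarrow> bool"
  where "nonrepetitive_on R S c \<longleftrightarrow> (\<forall>ys zs. set (ys @ zs) \<subseteq> S \<longrightarrow> \<not> repetitive R c ys zs)"

lemma repetitive_cong:
  assumes "\<And>v. v \<in> set (ys @ zs) \<Longrightarrow> c v = d v"
  shows "repetitive R c ys zs \<longleftrightarrow> repetitive R d ys zs"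
  using assms by (auto simp: repetitive_def cong: map_cong)

lemma nonrepetitive_on_restrict:
  assumes "nonrepetitive_on R S c" "T \<subseteq> S" shows "nonrepetitive_on R T (restrict c T)"
proof -
  have "repetitive R (restrict c T) ys zs \<longleftrightarrow> repetitive R c ys zs" if "set (ys @ zs) \<subseteq> T" for ys zs
    using that by (intro repetitive_cong) auto
  then show ?thesis using assms unfolding nonrepetitive_on_def by (meson subset_trans)
qed

locale bounded_degree_graph =
  fixes R :: "'v \<Rightarrow> 'v \<Rightarrow> bool" and D :: nat
  assumes sym: "R u v \<Longrightarrow> R v u"
    and finite_nbrs: "finite {v. R u v}"
    and card_nbrs: "card {v. R u v} \<le> D"
    and D_pos: "D > 0"
begin

lemma walks_from:
  "finite {xs. length xs = L \<and> successively R (v # xs)} \<and>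
   card {xs. length xs = L \<and> successively R (v # xs)} \<le> D ^ L"
proof (induction L arbitrary: v)
  case 0
  have "{xs. length xs = 0 \<and> successively R (v # xs)} = {[]}" by auto
  then show ?case by simp
next
  case (Suc L)
  let ?W = "\<lambda>L v. {xs. length xs = L \<and> successively R (v # xs)}"
  have eq: "?W (Suc L) v = (\<Union>y\<in>{y. R v y}. (#) y ` ?W L y)"
  proof (rule Set.set_eqI, rule iffI)
    fix xs assume "xs \<in> ?W (Suc L) v"
    then show "xs \<in> (\<Union>y\<in>{y. R v y}. (#) y ` ?W L y)" by (cases xs) auto
  qed auto
  have "card (?W (Suc L) v) \<le> (\<Sum>y\<in>{y. R v y}. card ((#) y ` ?W L y))"
    unfolding eq by (rule card_UN_le[OF finite_nbrs])
  also have "\<dots> \<le> (\<Sum>y\<in>{y. R v y}. D ^ L)"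
    using Suc card_image_le le_trans by (intro sum_mono) blast
  also have "\<dots> \<le> D ^ Suc L" using card_nbrs[of v] by simp
  finally show ?case using eq Suc finite_nbrs by auto
qed

text \<open>Cutting a walk at position \<open>j\<close> and reversing its first part leaves two
  walks that start at \<open>v\<close>, with at most D^j and D^(L-j) choices.\<close>

lemma walks_through:
  assumes "j \<le> L"
  shows "finite {xs. length xs = Suc L \<and> successively R xs \<and> xs ! j = v}"
    and "card {xs. length xs = Suc L \<and> successively R xs \<and> xs ! j = v} \<le> D ^ L"
proof -
  let ?X = "{xs. length xs = Suc L \<and> successively R xs \<and> xs ! j = v}"
  let ?W = "\<lambda>L. {xs. length xs = L \<and> successively R (v # xs)}"
  let ?f = "\<lambda>xs. (rev (take j xs), drop (Suc j) xs)"
  have split: "xs = take j xs @ v # drop (Suc j) xs" if "xs \<in> ?X" for xs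
    using that assms id_take_nth_drop[of j xs] by auto
  have inj: "inj_on ?f ?X"
    by (rule inj_onI) (metis split prod.inject rev_rev_ident)
  have sub: "?f ` ?X \<subseteq> ?W j \<times> ?W (L - j)"
  proof
    fix z assume "z \<in> ?f ` ?X"
    then obtain xs where xs: "xs \<in> ?X" "z = ?f xs" by blast
    have "successively R (take j xs @ v # drop (Suc j) xs)" using xs(1) split[OF xs(1)] by auto
    then have "successively R (take j xs @ [v])" "successively R (v # drop (Suc j) xs)"
      by (auto simp: successively_append_iff)
    moreover have "successively R (rev (take j xs @ [v]))"
      using calculation(1) sym by (subst successively_rev) (auto elim: successively_mono)
    ultimately show "z \<in> ?W j \<times> ?W (L - j)" using xs assms by auto
  qed
  have fin: "finite (?W j \<times> ?W (L - j))" using walks_from by blast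
  show "finite ?X" using inj sub fin by (meson finite_imageD finite_subset)
  have "card ?X \<le> card (?W j \<times> ?W (L - j))"
    using card_mono[OF fin sub] card_image[OF inj] by simp
  also have "\<dots> \<le> D ^ j * D ^ (L - j)"
    using walks_from by (simp add: card_cartesian_product mult_mono)
  also have "\<dots> = D ^ L" using assms by (simp flip: power_add)
  finally show "card ?X \<le> D ^ L" .
qed

text \<open>Nonempty halves of m + 1 vertices each form a walk of 2m + 1 steps, on which
  \<open>v\<close> has 2m + 2 possible positions.\<close>

lemma walk_halves_through:
  fixes v m defines "P \<equiv> {(ys, zs). length ys = Suc m \<and> length zs = Suc m \<and>
    successively R (ys @ zs) \<and> v \<in> set (ys @ zs)}"
  shows "finite P" and "card P \<le> 2 * Suc m * D ^ Suc (2 * m)"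
proof -
  let ?L = "Suc (2 * m)"
  let ?X = "\<lambda>j. {xs. length xs = Suc ?L \<and> successively R xs \<and> xs ! j = v}"
  have inj: "inj_on (\<lambda>(ys, zs). ys @ zs) P" by (auto simp: inj_on_def P_def)
  have sub: "(\<lambda>(ys, zs). ys @ zs) ` P \<subseteq> (\<Union>j\<le>?L. ?X j)"
  proof clarsimp
    fix ys zs assume "(ys, zs) \<in> P"
    moreover from this have "v \<in> set (ys @ zs)" by (simp add: P_def)
    then obtain j where "j < length (ys @ zs)" "(ys @ zs) ! j = v" by (metis in_set_conv_nth)
    ultimately show "length ys + length zs = Suc ?L \<and> successively R (ys @ zs) \<and>
      (\<exists>x\<in>{..?L}. (ys @ zs) ! x = v)"
      by (auto simp: P_def intro!: bexI[of _ j])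
  qed
  have fin: "finite (\<Union>j\<le>?L. ?X j)" using walks_through(1) by blast
  show "finite P" using inj sub fin by (meson finite_imageD finite_subset)
  have "card P \<le> card (\<Union>j\<le>?L. ?X j)"
    using card_mono[OF fin sub] card_image[OF inj] by simp
  also have "\<dots> \<le> (\<Sum>j\<le>?L. card (?X j))" by (rule card_UN_le) simp
  also have "\<dots> \<le> (\<Sum>j\<le>?L. D ^ ?L)" by (intro sum_mono walks_through(2)) simp
  finally show "card P \<le> 2 * Suc m * D ^ Suc (2 * m)" by simp
qed

definition colorings :: "nat \<Rightarrow> 'v set \<Rightarrow> ('v \<Rightarrow> nat) set"
  where "colorings K S = {c \<in> S \<rightarrow>\<^sub>E {..<K}. nonrepetitive_on R S c}"

lemma finite_colorings: "finite S \<Longrightarrow> finite (colorings K S)"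
  by (simp add: colorings_def finite_PiE)

lemma restrict_coloring: "c \<in> colorings K S \<Longrightarrow> T \<subseteq> S \<Longrightarrow> restrict c T \<in> colorings K T"
  using nonrepetitive_on_restrict by (auto simp: colorings_def PiE_iff)

text \<open>Rosenfeld's induction: a coloring that is spoiled by a repetition through \<open>v\<close> is determined by
  its values off the half of the repetition that contains \<open>v\<close>, and by induction there are few of
  those.\<close>

lemma card_colorings_insert:
  assumes K: "K \<ge> 4 * D\<^sup>2 + 4 * D" and "finite S" "v \<notin> S"
  shows "4 * real D ^ 2 * card (colorings K S) \<le> card (colorings K (insert v S))"
  using assms(2,3)
proof (induction "card S" arbitrary: S v rule: less_induct)
  case less
  let ?C = "\<lambda>S. real (card (colorings K S))" and ?b = "4 * real D ^ 2"
  have b_pos: "?b > 0" using D_pos by simp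
  \<comment> \<open>The vertices of \<open>U\<close> are added to \<open>T\<close> one at a time,
    each time to a proper subset of \<open>S\<close>, where the induction hypothesis applies. Read
    backwards: erasing \<open>card U\<close> vertices divides the count by at least
    \<open>?b ^ card U\<close>.\<close>
  have chain: "?b ^ card U * ?C T \<le> ?C (T \<union> U)" if "finite U" "T \<inter> U = {}" "T \<union> U \<subseteq> S" for T U
    using that
  proof (induction U)
    case (insert u U)
    have "T \<union> U \<subset> S" using insert by auto
    then have "?b * ?C (T \<union> U) \<le> ?C (insert u (T \<union> U))"
      using insert less.prems by (intro less.hyps psubset_card_mono) (auto intro: finite_subset)
    moreover have "?b * (?b ^ card U * ?C T) \<le> ?b * ?C (T \<union> U)"
      using insert by (intro mult_left_mono) auto
    ultimately show ?case using insert by (simp add: mult.assoc)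
  qed simp
  \<comment> \<open>All extensions of good colorings of \<open>S\<close> by an arbitrary color at
    \<open>v\<close>; whatever spoils one of them is a repetition through \<open>v\<close>.\<close>
  define N where "N = {c \<in> insert v S \<rightarrow>\<^sub>E {..<K}. restrict c S \<in> colorings K S}"
  define P where "P m = {(ys, zs). length ys = Suc m \<and> length zs = Suc m \<and>
    successively R (ys @ zs) \<and> v \<in> set (ys @ zs) \<and> distinct (ys @ zs) \<and>
    set (ys @ zs) \<subseteq> insert v S}" for m
  define B where "B p = {c \<in> N. repetitive R c (fst p) (snd p)}" for p
  have fin_N: "finite N" unfolding N_def using less.prems by (simp add: finite_PiE)
  have P: "finite (P m)" "card (P m) \<le> 2 * Suc m * D ^ Suc (2 * m)" for m
  proof -
    let ?P = "{(ys, zs). length ys = Suc m \<and> length zs = Suc m \<and>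
      successively R (ys @ zs) \<and> v \<in> set (ys @ zs)}"
    have sub: "P m \<subseteq> ?P" by (auto simp: P_def)
    show "finite (P m)" using sub walk_halves_through(1) finite_subset by blast
    show "card (P m) \<le> 2 * Suc m * D ^ Suc (2 * m)"
      using card_mono[OF walk_halves_through(1) sub] walk_halves_through(2) le_trans by blast
  qed
  have card_N: "card N = K * card (colorings K S)"
  proof -
    have upd: "restrict (c(v := k)) S = c" if "c \<in> colorings K S" for c k
      using that less.prems by (auto simp: colorings_def PiE_iff extensional_def fun_eq_iff)
    have "bij_betw (\<lambda>(c, k). c(v := k)) (colorings K S \<times> {..<K}) N"
      unfolding bij_betw_def
    proof
      show "inj_on (\<lambda>(c, k). c(v := k)) (colorings K S \<times> {..<K})"
        by (auto intro!: inj_onI) (metis upd, metis fun_upd_same)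
      show "(\<lambda>(c, k). c(v := k)) ` (colorings K S \<times> {..<K}) = N"
      proof safe
        fix c k assume "c \<in> colorings K S" "k < K"
        then show "c(v := k) \<in> N"
          using upd[of c k] by (auto simp: N_def colorings_def PiE_iff extensional_def)
      next
        fix c assume c: "c \<in> N"
        then have "c = (restrict c S)(v := c v)"
          by (auto simp: N_def PiE_iff extensional_def fun_eq_iff)
        then show "c \<in> (\<lambda>(c, k). c(v := k)) ` (colorings K S \<times> {..<K})"
          using c by (intro image_eqI[of _ _ "(restrict c S, c v)"]) (auto simp: N_def)
      qed
    qed
    then show ?thesis by (metis bij_betw_same_card card_cartesian_product card_lessThan mult.commute)
  qed
  have card_B: "?b ^ m * real (card (B p)) \<le> ?C S" if p: "p \<in> P m" for m p
  proof -
    obtain ys zs where yz: "p = (ys, zs)" by (cases p)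
    obtain h h' where h: "{h, h'} = {ys, zs}" "v \<in> set h"
      using p yz by (auto simp: P_def)
    have hh': "length h = Suc m" "distinct h" "set h \<inter> set h' = {}" "set h \<subseteq> insert v S"
      "set h' \<subseteq> S - set h" "length h' = Suc m"
      using h p yz by (auto simp: P_def doubleton_eq_iff)
    \<comment> \<open>The half \<open>h\<close> has m + 1 vertices, but \<open>v\<close> lies
      outside \<open>S\<close>, so only m vertices of \<open>S\<close> are erased. The other half
      \<open>h'\<close> stays in \<open>?T\<close> and dictates the colors on
      \<open>h\<close>.\<close>
    let ?T = "S - set h" and ?U = "S \<inter> set h"
    have "set h = insert v ?U" using hh' h by auto
    then have "card (insert v ?U) = Suc m" using hh' distinct_card by metis
    then have "card ?U = m" using less.prems by simp
    have "inj_on (\<lambda>c. restrict c ?T) (B p)"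
    proof (rule inj_onI)
      fix c d assume c: "c \<in> B p" and d: "d \<in> B p" and eq: "restrict c ?T = restrict d ?T"
      have eqT: "c w = d w" if "w \<in> ?T" for w using eq that by (metis restrict_apply')
      have "map c h = map c h'" "map d h = map d h'"
        using c d h unfolding B_def repetitive_def yz by (auto simp: doubleton_eq_iff)
      moreover have "map c h' = map d h'" using eqT hh' by (intro map_cong) auto
      ultimately have "map c h = map d h" by simp
      then have "c w = d w" if "w \<in> insert v S" for w
        using eqT that h(2) by (cases "w \<in> set h") auto
      then show "c = d" using c d by (auto simp: B_def N_def intro: PiE_ext)
    qed
    moreover have "(\<lambda>c. restrict c ?T) ` B p \<subseteq> colorings K ?T"
    proof clarify
      fix c assume "c \<in> B p"
      then have "restrict c S \<in> colorings K S" by (simp add: B_def N_def)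
      then have "restrict (restrict c S) ?T \<in> colorings K ?T" by (rule restrict_coloring) auto
      moreover have "restrict (restrict c S) ?T = restrict c ?T" by (simp add: Int_absorb1 Diff_subset)
      ultimately show "restrict c ?T \<in> colorings K ?T" by simp
    qed
    ultimately have "card (B p) \<le> card (colorings K ?T)"
      using finite_colorings less.prems by (intro card_inj_on_le) auto
    then have "?b ^ m * real (card (B p)) \<le> ?b ^ m * ?C ?T"
      using b_pos by (intro mult_left_mono) auto
    also have "\<dots> \<le> ?C (?T \<union> ?U)"
      using chain[of ?U ?T] less.prems \<open>card ?U = m\<close> by auto
    also have "?T \<union> ?U = S" by auto
    finally show ?thesis .
  qed
  let ?M = "card (insert v S)"
  have cover: "N - colorings K (insert v S) \<subseteq> (\<Union>m<?M. \<Union>p\<in>P m. B p)"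
  proof
    fix c assume c: "c \<in> N - colorings K (insert v S)"
    then obtain ys zs where yz: "set (ys @ zs) \<subseteq> insert v S" "repetitive R c ys zs"
      by (auto simp: N_def colorings_def nonrepetitive_on_def)
    have v: "v \<in> set (ys @ zs)"
    proof (rule ccontr)
      assume "v \<notin> set (ys @ zs)"
      then have "set (ys @ zs) \<subseteq> S" using yz by auto
      moreover have "repetitive R (restrict c S) ys zs"
        using yz(2) calculation by (subst repetitive_cong[where d = c]) auto
      ultimately show False using c by (auto simp: N_def colorings_def nonrepetitive_on_def)
    qed
    obtain m where m: "length ys = Suc m" using yz by (cases ys) (auto simp: repetitive_def)
    have "length zs = Suc m" using m yz(2) by (metis length_map repetitive_def)
    then have P: "(ys, zs) \<in> P m" using m v yz by (auto simp: P_def repetitive_def)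
    have "card (set ys) \<le> ?M" using yz less.prems by (intro card_mono) auto
    then have "m < ?M" using m yz(2) distinct_card[of ys] by (auto simp: repetitive_def)
    then show "c \<in> (\<Union>m<?M. \<Union>p\<in>P m. B p)" using P c yz
      by (auto simp: B_def intro!: bexI[of _ m] bexI[of _ "(ys, zs)"])
  qed
  \<comment> \<open>The 2(m+1)D^(2m+1) candidate paths against the divisor (4D^2)^m leave
    2D(m+1)/4^m, and m + 1 \<le> 2^m turns this into a geometric series with total at most
    4D.\<close>
  have level: "real (card (\<Union>p\<in>P m. B p)) \<le> 2 * D * (1/2) ^ m * ?C S" for m
  proof -
    have "real (card (\<Union>p\<in>P m. B p)) \<le> (\<Sum>p\<in>P m. real (card (B p)))"
      using card_UN_le[OF P(1)] by (metis of_nat_le_iff of_nat_sum)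
    also have "\<dots> \<le> (\<Sum>p\<in>P m. ?C S / ?b ^ m)"
      using card_B b_pos by (intro sum_mono) (simp add: field_simps)
    also have "\<dots> = real (card (P m)) * (?C S / ?b ^ m)" by simp
    also have "\<dots> \<le> real (2 * Suc m * D ^ Suc (2 * m)) * (?C S / ?b ^ m)"
      using P(2) b_pos by (intro mult_right_mono) (simp_all only: of_nat_le_iff, simp)
    also have "\<dots> = 2 * D * ?C S * (real (Suc m) / 4 ^ m)"
    proof -
      have "real D ^ (2 * m) = (real D ^ 2) ^ m" by (rule power_mult)
      then show ?thesis using D_pos by (simp add: power_mult_distrib field_simps)
    qed
    also have "\<dots> \<le> 2 * D * ?C S * (1/2) ^ m"
    proof (rule mult_left_mono)
      have "real (Suc m) \<le> 2 ^ m"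
        by (metis Suc_leI less_exp of_nat_le_iff of_nat_numeral of_nat_power)
      then have "real (Suc m) / 4 ^ m \<le> 2 ^ m / 4 ^ m" by (intro divide_right_mono) auto
      also have "\<dots> = (1/2) ^ m" by (simp flip: power_divide)
      finally show "real (Suc m) / 4 ^ m \<le> (1/2) ^ m" .
    qed simp
    finally show ?thesis by (simp add: mult_ac)
  qed
  have "real (card (N - colorings K (insert v S))) \<le> real (card (\<Union>m<?M. \<Union>p\<in>P m. B p))"
    using cover fin_N P(1) by (intro of_nat_mono card_mono) (auto simp: B_def)
  also have "\<dots> \<le> (\<Sum>m<?M. real (card (\<Union>p\<in>P m. B p)))"
    using card_UN_le[of "{..<?M}"] by (metis finite_lessThan of_nat_le_iff of_nat_sum)
  also have "\<dots> \<le> (\<Sum>m<?M. 2 * D * (1/2) ^ m * ?C S)" by (intro sum_mono level)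
  also have "\<dots> = 2 * D * ?C S * (\<Sum>m<?M. (1/2) ^ m)"
    by (simp add: sum_distrib_left mult_ac)
  also have "\<dots> \<le> 2 * D * ?C S * 2"
    by (intro mult_left_mono) (simp_all add: sum_gp_strict)
  finally have bad: "real (card (N - colorings K (insert v S))) \<le> 4 * D * ?C S" by simp
  have "card N \<le> card (colorings K (insert v S)) + card (N - colorings K (insert v S))"
    using fin_N less.prems
    by (metis Diff_subset card_Un_le card_mono finite_Diff finite_UnI finite_colorings finite_insert le_trans Un_Diff_cancel Un_upper2)
  then have "real K * ?C S \<le> ?C (insert v S) + 4 * D * ?C S"
    using bad card_N by (metis (no_types, lifting) add_left_mono of_nat_add of_nat_le_iff of_nat_mult order_trans)
  \<comment> \<open>Repetitions cost at most 4D of the \<open>K\<close> colors on average, and the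
    4D^2 left over are the ratio to be proved; this fixes the size of the alphabet.\<close>
  moreover have "(?b + 4 * D) * ?C S \<le> real K * ?C S"
  proof (rule mult_right_mono)
    have "real (4 * D\<^sup>2 + 4 * D) \<le> real K" using K by (rule of_nat_mono)
    then show "?b + 4 * D \<le> real K" by simp
  qed simp
  ultimately show ?case by (simp add: algebra_simps)
qed

lemma ex_nonrepetitive_coloring:
  assumes "finite S" "K \<ge> 4 * D\<^sup>2 + 4 * D"
  shows "\<exists>c \<in> S \<rightarrow>\<^sub>E {..<K}. nonrepetitive_on R S c"
proof -
  have "0 < card (colorings K S)"
    using assms(1)
  proof (induction S)
    case empty
    have "colorings K {} = {\<lambda>_. undefined}"
      by (auto simp: colorings_def nonrepetitive_on_def repetitive_def)
    then show ?case by simp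
  next
    case (insert v S)
    have "0 < 4 * real D ^ 2 * card (colorings K S)" using insert D_pos by simp
    also have "\<dots> \<le> card (colorings K (insert v S))"
      using insert assms(2) by (intro card_colorings_insert)
    finally show ?case by simp
  qed
  then have "colorings K S \<noteq> {}" by force
  then show ?thesis by (auto simp: colorings_def)
qed

end

section \<open>Limits of uniform measures on finite sets\<close>

locale finitely_additive_mean =
  fixes m :: "'p set \<Rightarrow> real"
  assumes nonneg: "m C \<ge> 0"
    and total: "m UNIV = 1"
    and additive: "C \<inter> C' = {} \<Longrightarrow> m (C \<union> C') = m C + m C'"
begin

lemma mono: "C \<subseteq> C' \<Longrightarrow> m C \<le> m C'"
  using additive[of C "C' - C"] nonneg[of "C' - C"] by (simp add: Un_absorb1)

text \<open>The complement of \<open>F\<close> is null by additivity, and with it the part of each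
  set outside \<open>F\<close>. Serves to ignore the vertices of the approximation that do not look
  like points of the subshift.\<close>

lemma eq_if_agree_on_full:
  assumes "m F = 1" "C \<inter> F = C' \<inter> F" shows "m C = m C'"
proof -
  have null: "m (- F) = 0" using additive[of F "- F"] assms(1) total by simp
  have "m C = m (C \<inter> F)" for C
  proof -
    have "m C = m (C \<inter> F) + m (C - F)"
      using additive[of "C \<inter> F" "C - F"] by (simp add: Int_Diff_disjoint Int_Diff_Un)
    moreover have "m (C - F) \<le> 0" using mono[of "C - F" "- F"] null by auto
    ultimately show ?thesis using nonneg[of "C - F"] by simp
  qed
  then show ?thesis by (metis assms(2))
qed

end

text \<open>A set of pairs selects a subset of each \<open>V k\<close> at once, so the uniform
  measures for different \<open>k\<close> become functions on one common domain and can have a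
  limit.\<close>

definition frequency :: "(nat \<Rightarrow> 'v set) \<Rightarrow> nat \<Rightarrow> (nat \<times> 'v) set \<Rightarrow> real"
  where "frequency V k C = card {p \<in> V k. (k, p) \<in> C} / card (V k)"

text \<open>The frequencies lie in a power of [0,1] that is compact by Tychonoff, and
  \<open>m\<close> is a cluster point of them. The cube has uncountably many factors, so the limit
  is taken along a filter and not along a subsequence.\<close>

lemma ex_limit_mean:
  fixes V :: "nat \<Rightarrow> 'v set"
  assumes V: "\<And>k. finite (V k)" "\<And>k. V k \<noteq> {}"
  obtains m where "finitely_additive_mean m"
    and "\<And>C. (\<lambda>k. frequency V k C) \<longlonglongrightarrow> 1 \<Longrightarrow> m C = 1"
    and "\<And>C C'. (\<And>k. frequency V k C = frequency V k C') \<Longrightarrow> m C = m C'"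
proof -
  let ?f = "\<lambda>k. frequency V k"
  let ?K = "Pi\<^sub>E UNIV (\<lambda>_::(nat \<times> 'v) set. {0..1::real})"
  have "compactin (product_topology (\<lambda>_. euclidean) UNIV) ?K"
    by (simp add: compactin_PiE)
  then have "compact ?K" by (simp only: euclidean_product_topology compactin_euclidean_iff)
  moreover have range: "0 \<le> ?f k C" "?f k C \<le> 1" for k C
    using V by (auto simp: frequency_def divide_le_eq_1 card_gt_0_iff intro!: card_mono)
  then have "?f k \<in> ?K" for k by auto
  then have "eventually (\<lambda>g. g \<in> ?K) (filtermap ?f sequentially)"
    by (simp add: eventually_filtermap)
  ultimately obtain m where m: "inf (nhds m) (filtermap ?f sequentially) \<noteq> bot"
    unfolding compact_filter by (meson filtermap_bot_iff sequentially_bot)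
  \<comment> \<open>\<open>F\<close> refines \<open>sequentially\<close> just so far that the
    frequencies converge to \<open>m\<close> along it; it is nontrivial because \<open>m\<close> is
    a cluster point. Ordinary limits persist along \<open>F\<close>.\<close>
  define F where "F = inf sequentially (filtercomap ?f (nhds m))"
  have "F \<noteq> bot"
  proof
    assume "F = bot"
    then obtain P S where PS: "eventually P sequentially" "eventually S (nhds m)"
      "\<And>k. P k \<Longrightarrow> \<not> S (?f k)"
      unfolding F_def trivial_limit_def eventually_inf eventually_filtercomap by metis
    then have "eventually (\<lambda>g. \<not> S g) (filtermap ?f sequentially)"
      unfolding eventually_filtermap by (auto elim: eventually_mono)
    then have "inf (nhds m) (filtermap ?f sequentially) = bot"
      unfolding trivial_limit_def eventually_inf using PS(2) by blast
    then show False using m by simp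
  qed
  have "filterlim ?f (nhds m) F"
    unfolding F_def by (rule filterlim_mono[OF filterlim_filtercomap order_refl inf_le2])
  then have lim: "((\<lambda>k. ?f k C) \<longlongrightarrow> m C) F" for C
    by (rule continuous_on_tendsto_compose[OF continuous_on_product_coordinates]) simp_all
  have "finitely_additive_mean m"
  proof
    show "m C \<ge> 0" for C
      using tendsto_lowerbound[OF lim _ \<open>F \<noteq> bot\<close>] range by simp
    have "?f k UNIV = 1" for k using V by (simp add: frequency_def)
    then show "m UNIV = 1"
      using tendsto_unique[OF \<open>F \<noteq> bot\<close> lim[of UNIV]] by simp
    fix C C' :: "(nat \<times> 'v) set" assume "C \<inter> C' = {}"
    then have "{p \<in> V k. (k, p) \<in> C \<union> C'} = {p \<in> V k. (k, p) \<in> C} \<union> {p \<in> V k. (k, p) \<in> C'}"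
      "{p \<in> V k. (k, p) \<in> C} \<inter> {p \<in> V k. (k, p) \<in> C'} = {}" for k by auto
    then have "?f k (C \<union> C') = ?f k C + ?f k C'" for k
      using V by (simp add: frequency_def card_Un_disjoint add_divide_distrib)
    then have "((\<lambda>k. ?f k (C \<union> C')) \<longlongrightarrow> m C + m C') F" by (simp add: lim tendsto_add)
    then show "m (C \<union> C') = m C + m C'" by (rule tendsto_unique[OF \<open>F \<noteq> bot\<close> lim])
  qed
  moreover have "m C = 1" if "(\<lambda>k. ?f k C) \<longlonglongrightarrow> 1" for C
    using tendsto_unique[OF \<open>F \<noteq> bot\<close> lim tendsto_mono[OF _ that]] by (simp add: F_def)
  moreover have "m C = m C'" if "\<And>k. ?f k C = ?f k C'" for C C'
    using tendsto_unique[OF \<open>F \<noteq> bot\<close> lim[of C]] lim[of C'] that by simp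
  ultimately show thesis by (rule that)
qed

section \<open>Extending finitely additive set functions on compact spaces\<close>

text \<open>By compactness a decreasing sequence of closed sets with empty intersection is empty
  from some index on. So continuity at the empty set, the hypothesis of Caratheodory's extension,
  comes for free.\<close>

lemma clopen_mean_extends_to_measure:
  assumes X: "compact_space X" and M: "algebra (topspace X) M"
    and closed: "\<And>U. U \<in> M \<Longrightarrow> closedin X U"
    and nonneg: "\<And>U. U \<in> M \<Longrightarrow> \<nu> U \<ge> (0::real)"
    and additive: "\<And>U U'. U \<in> M \<Longrightarrow> U' \<in> M \<Longrightarrow> U \<inter> U' = {} \<Longrightarrow> \<nu> (U \<union> U') = \<nu> U + \<nu> U'"
  obtains \<mu> where "space \<mu> = topspace X" "sets \<mu> = sigma_sets (topspace X) M"
    "\<forall>U\<in>M. emeasure \<mu> U = ennreal (\<nu> U)"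
proof -
  interpret algebra "topspace X" M by (rule M)
  let ?f = "\<lambda>U. ennreal (\<nu> U)"
  have empty: "\<nu> {} = 0" using additive[of "{}" "{}"] by simp
  have cont: "(\<lambda>i. ?f (A i)) \<longlonglongrightarrow> 0"
    if A: "range A \<subseteq> M" "decseq A" "(\<Inter>i. A i) = {}" for A
  proof -
    have "\<exists>i. A i = {}"
    proof (rule ccontr)
      assume "\<nexists>i. A i = {}"
      then have "(\<Inter>i. A i) \<noteq> {}"
        using A(1,2) closed by (intro compact_space_imp_nest[OF X]) auto
      then show False using A(3) by simp
    qed
    then obtain i where "A i = {}" by blast
    have "A j = {}" if "j \<ge> i" for j using A(2) that \<open>A i = {}\<close> by (auto simp: decseq_def)
    then have "eventually (\<lambda>j. ?f (A j) = 0) sequentially"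
      unfolding eventually_sequentially by (intro exI[of _ i]) (simp add: empty)
    then show ?thesis by (rule tendsto_eventually)
  qed
  have "\<exists>\<mu> :: 'a set \<Rightarrow> ennreal. (\<forall>s\<in>M. \<mu> s = ?f s) \<and>
      measure_space (topspace X) (sigma_sets (topspace X) M) \<mu>"
    using cont by (intro caratheodory_empty_continuous)
      (auto simp: positive_def Measure_Space.additive_def empty additive nonneg)
  then obtain \<mu> where \<mu>: "\<forall>s\<in>M. \<mu> s = ?f s" "measure_space (topspace X) (sigma_sets (topspace X) M) \<mu>"
    by blast
  let ?\<mu> = "measure_of (topspace X) M \<mu>"
  have sub: "M \<subseteq> Pow (topspace X)" by (rule space_closed)
  have "emeasure ?\<mu> U = ennreal (\<nu> U)" if "U \<in> M" for U
    using emeasure_measure_of[of ?\<mu> "topspace X" M \<mu> U] \<mu> that sub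
    by (auto simp: measure_space_def)
  then show thesis
    using that[of ?\<mu>] sub by simp
qed

section \<open>Walks in deterministic graphs\<close>

definition letters :: "nat \<Rightarrow> letter set"
  where "letters n = {..<n} \<times> UNIV"

definition words :: "nat \<Rightarrow> nat \<Rightarrow> letter list set"
  where "words n r = {w. set w \<subseteq> letters n \<and> length w \<le> r}"

text \<open>The record of a colored graph seen from \<open>x\<close>, independent of the vertex
  type: which words lead to the same vertex, and the color found at the end. As \<open>foldr\<close>
  applies the last letter first, words act like products of group elements from the left.\<close>

definition trace :: "(letter \<Rightarrow> 'v \<Rightarrow> 'v) \<Rightarrow> ('v \<Rightarrow> 'k) \<Rightarrow> 'v \<Rightarrow> letter list \<Rightarrow> letter list \<Rightarrow> bool \<times> 'k"
  where "trace a c x w w' = (foldr a w x = foldr a w' x, c (foldr a w x))"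

definition agree ::
    "nat \<Rightarrow> nat \<Rightarrow> (letter list \<Rightarrow> letter list \<Rightarrow> 't) \<Rightarrow> (letter list \<Rightarrow> letter list \<Rightarrow> 't) \<Rightarrow> bool"
  where "agree n r t t' \<longleftrightarrow> (\<forall>w\<in>words n r. \<forall>w'\<in>words n r. t w w' = t' w w')"

lemma finite_letters [simp]: "finite (letters n)"
  by (simp add: letters_def)

lemma flip_in_letters [simp]: "flip l \<in> letters n \<longleftrightarrow> l \<in> letters n"
  by (simp add: letters_def flip_def mem_Times_iff)

lemma finite_words: "finite (words n r)"
  unfolding words_def by (rule finite_lists_length_le) simp

lemma words_mono: "r \<le> s \<Longrightarrow> words n r \<subseteq> words n s"
  by (auto simp: words_def)

lemma Nil_in_words [simp]: "[] \<in> words n r"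
  by (simp add: words_def)

lemma Cons_in_words: "l # w \<in> words n (Suc r) \<longleftrightarrow> l \<in> letters n \<and> w \<in> words n r"
  by (auto simp: words_def)

lemma snoc_in_words: "w \<in> words n r \<Longrightarrow> l \<in> letters n \<Longrightarrow> w @ [l] \<in> words n (Suc r)"
  by (auto simp: words_def)

lemma agree_refl [simp]: "agree n r t t"
  by (simp add: agree_def)

lemma agree_sym: "agree n r t t' \<Longrightarrow> agree n r t' t"
  by (simp add: agree_def)

lemma agree_trans: "agree n r t t' \<Longrightarrow> agree n r t' t'' \<Longrightarrow> agree n r t t''"
  by (simp add: agree_def)

lemma agree_mono: "agree n s t t' \<Longrightarrow> r \<le> s \<Longrightarrow> agree n r t t'"
  using words_mono unfolding agree_def by blast

lemma agree_vertexD: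
  "agree n r (trace a c x) (trace b d y) \<Longrightarrow> w \<in> words n r \<Longrightarrow> w' \<in> words n r \<Longrightarrow>
    foldr a w x = foldr a w' x \<longleftrightarrow> foldr b w y = foldr b w' y"
  and agree_colorD:
  "agree n r (trace a c x) (trace b d y) \<Longrightarrow> w \<in> words n r \<Longrightarrow>
    c (foldr a w x) = d (foldr b w y)"
  by (simp_all add: agree_def trace_def)

text \<open>The walk \<open>w\<close> from \<open>a l x\<close> is the walk \<open>w @ [l]\<close>
  from \<open>x\<close>. Moving the root by a letter therefore costs one unit of radius.\<close>

lemma agree_trace_step:
  assumes "agree n (Suc r) (trace a c x) (trace b d y)" "l \<in> letters n"
  shows "agree n r (trace a c (a l x)) (trace b d (b l y))"
proof -
  have "trace a c (a l x) w w' = trace b d (b l y) w w'" if "w \<in> words n r" "w' \<in> words n r" for w w'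
    using agree_vertexD[OF assms(1), of "w @ [l]" "w' @ [l]"]
      agree_colorD[OF assms(1), of "w @ [l]"] that assms(2)
    by (simp add: trace_def snoc_in_words)
  then show ?thesis by (simp add: agree_def)
qed

text \<open>Each letter permutes the vertices, with the flipped letter as its inverse. Schreier
  graphs of \<open>G\<close> and of the free group are both instances, so that they can be compared
  without a common group.\<close>

locale letter_graph =
  fixes n :: nat and S :: "'v lgraph" and a :: "letter \<Rightarrow> 'v \<Rightarrow> 'v"
  assumes arcs_iff: "(u, l, v) \<in> arcs S \<longleftrightarrow> u \<in> verts S \<and> l \<in> letters n \<and> v = a l u"
    and act_closed: "u \<in> verts S \<Longrightarrow> l \<in> letters n \<Longrightarrow> a l u \<in> verts S"
    and act_flip: "u \<in> verts S \<Longrightarrow> l \<in> letters n \<Longrightarrow> a (flip l) (a l u) = u"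
begin

lemma adj_iff: "(u, v) \<in> adj S \<longleftrightarrow> u \<in> verts S \<and> (\<exists>l\<in>letters n. v = a l u)"
proof
  assume "(u, v) \<in> adj S"
  then consider l where "(u, l, v) \<in> arcs S" | l where "(v, l, u) \<in> arcs S"
    by (auto simp: adj_def)
  then show "u \<in> verts S \<and> (\<exists>l\<in>letters n. v = a l u)"
  proof cases
    case 2
    then have "v \<in> verts S" "l \<in> letters n" "u = a l v" by (auto simp: arcs_iff)
    then have "v = a (flip l) u" "u \<in> verts S" by (auto simp: act_flip act_closed)
    then show ?thesis using \<open>l \<in> letters n\<close> by (metis flip_in_letters)
  qed (auto simp: arcs_iff)
qed (auto simp: adj_def arcs_iff)

lemma adj_sym: "(u, v) \<in> adj S \<Longrightarrow> (v, u) \<in> adj S"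
  by (auto simp: adj_def)

text \<open>Two letters per generator bound the degree by 2n; the extra 1 keeps the bound positive
  when there are no generators.\<close>

lemma bounded_degree: "bounded_degree_graph (\<lambda>u v. (u, v) \<in> adj S) (2 * n + 1)"
proof
  fix u
  have sub: "{v. (u, v) \<in> adj S} \<subseteq> (\<lambda>l. a l u) ` letters n" by (auto simp: adj_iff)
  then show "finite {v. (u, v) \<in> adj S}" by (rule finite_subset) simp
  have "card {v. (u, v) \<in> adj S} \<le> card ((\<lambda>l. a l u) ` letters n)" using sub by (intro card_mono) auto
  also have "\<dots> \<le> card (letters n)" by (rule card_image_le) simp
  also have "\<dots> = 2 * n" by (simp add: letters_def card_cartesian_product)
  finally show "card {v. (u, v) \<in> adj S} \<le> 2 * n + 1" by simp
qed (auto intro: adj_sym)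

lemma walk_closed: "x \<in> verts S \<Longrightarrow> set w \<subseteq> letters n \<Longrightarrow> foldr a w x \<in> verts S"
  by (induction w) (auto simp: act_closed)

lemma relpow_adj_iff:
  assumes "x \<in> verts S"
  shows "(x, v) \<in> adj S ^^ k \<longleftrightarrow> (\<exists>w. set w \<subseteq> letters n \<and> length w = k \<and> v = foldr a w x)"
proof (induction k arbitrary: v)
  case (Suc k)
  have "(x, v) \<in> adj S ^^ Suc k \<longleftrightarrow>
    (\<exists>w. set w \<subseteq> letters n \<and> length w = k \<and> (\<exists>l\<in>letters n. v = a l (foldr a w x)))"
    using Suc walk_closed[OF assms] by (auto simp: relcomp_unfold adj_iff)
  also have "\<dots> \<longleftrightarrow> (\<exists>w. set w \<subseteq> letters n \<and> length w = Suc k \<and> v = foldr a w x)"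
  proof
    assume "\<exists>w. set w \<subseteq> letters n \<and> length w = k \<and> (\<exists>l\<in>letters n. v = a l (foldr a w x))"
    then obtain w l where "set w \<subseteq> letters n" "length w = k" "l \<in> letters n" "v = a l (foldr a w x)"
      by blast
    then show "\<exists>w. set w \<subseteq> letters n \<and> length w = Suc k \<and> v = foldr a w x"
      by (intro exI[of _ "l # w"]) simp
  next
    assume "\<exists>w. set w \<subseteq> letters n \<and> length w = Suc k \<and> v = foldr a w x"
    then obtain w l where "set (l # w) \<subseteq> letters n" "length w = k" "v = foldr a (l # w) x"
      by (metis length_Suc_conv)
    then show "\<exists>w. set w \<subseteq> letters n \<and> length w = k \<and> (\<exists>l\<in>letters n. v = a l (foldr a w x))"
      by auto
  qed
  finally show ?case .
qed auto

lemma verts_gball_walk: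
  assumes "x \<in> verts S"
  shows "verts (gball S r x) = (\<lambda>w. foldr a w x) ` words n r"
  using walk_closed[OF assms] by (auto simp: verts_gball relpow_adj_iff[OF assms] words_def)

end

text \<open>A vertex has a single outgoing arc for each letter, so an isomorphism is forced letter
  by letter. Every suffix of \<open>w\<close> is again in \<open>words n r\<close>, which keeps the
  walk inside the ball.\<close>

lemma is_rooted_iso_walk:
  assumes "letter_graph n S a" "letter_graph n S' a'" and x: "x \<in> verts S" "x' \<in> verts S'"
    and iso: "is_rooted_iso \<phi> (gball S r x) x (gball S' r x') x'" and w: "w \<in> words n r"
  shows "\<phi> (foldr a w x) = foldr a' w x'"
proof -
  interpret S: letter_graph n S a by fact
  interpret S': letter_graph n S' a' by fact
  show ?thesis
    using w
  proof (induction w)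
    case Nil
    then show ?case using iso by (simp add: is_rooted_iso_def)
  next
    case (Cons l w)
    then have w: "w \<in> words n r" "l \<in> letters n" by (auto simp: words_def)
    have v: "foldr a w x \<in> verts (gball S r x)" "foldr a (l # w) x \<in> verts (gball S r x)"
      using w Cons.prems unfolding S.verts_gball_walk[OF x(1)] by blast+
    then have "(foldr a w x, l, foldr a (l # w) x) \<in> arcs (gball S r x)"
      using w by (simp add: arcs_gball S.arcs_iff verts_gball)
    then have "(\<phi> (foldr a w x), l, \<phi> (foldr a (l # w) x)) \<in> arcs (gball S' r x')"
      using is_rooted_iso_arc[OF iso v] by simp
    then show ?case using Cons.IH[OF w(1)] by (simp add: arcs_gball S'.arcs_iff)
  qed
qed

lemma agree_if_rooted_iso:
  assumes S: "letter_graph n S a" "letter_graph n S' a'" and x: "x \<in> verts S" "x' \<in> verts S'"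
    and iso: "is_rooted_iso \<phi> (gball S r x) x (gball S' r x') x'"
    and c: "\<And>v. v \<in> verts (gball S r x) \<Longrightarrow> c' (\<phi> v) = c v"
  shows "agree n r (trace a c x) (trace a' c' x')"
  unfolding agree_def trace_def
proof (intro ballI, rule prod_eqI)
  fix w w' assume w: "w \<in> words n r" "w' \<in> words n r"
  note \<phi> = is_rooted_iso_walk[OF S x iso]
  have v: "foldr a w x \<in> verts (gball S r x)" "foldr a w' x \<in> verts (gball S r x)"
    using w letter_graph.verts_gball_walk[OF S(1) x(1)] by blast+
  have "inj_on \<phi> (verts (gball S r x))" using iso by (simp add: is_rooted_iso_def bij_betw_def)
  then have "foldr a w x = foldr a w' x \<longleftrightarrow> \<phi> (foldr a w x) = \<phi> (foldr a w' x)"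
    using v by (simp add: inj_on_eq_iff)
  then show "fst (foldr a w x = foldr a w' x, c (foldr a w x)) =
    fst (foldr a' w x' = foldr a' w' x', c' (foldr a' w x'))"
    using \<phi> w by simp
  show "snd (foldr a w x = foldr a w' x, c (foldr a w x)) =
    snd (foldr a' w x' = foldr a' w' x', c' (foldr a' w x'))"
    using c[OF v(1)] \<phi>[OF w(1)] by simp
qed

text \<open>An arc \<open>(w x, l, w' x)\<close> of the \<open>r\<close>-ball is the coincidence of the end points of
  \<open>w'\<close> and of the word \<open>l # w\<close>, which may have length \<open>r + 1\<close>.\<close>

lemma colored_rooted_isomorphic_if_agree:
  assumes S: "letter_graph n S a" "letter_graph n S' a'" and x: "x \<in> verts S" "x' \<in> verts S'"
    and agr: "agree n (Suc r) (trace a c x) (trace a' c' x')"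
  shows "colored_rooted_isomorphic (gball S r x) c x (gball S' r x') c' x'"
proof -
  interpret S: letter_graph n S a by fact
  interpret S': letter_graph n S' a' by fact
  let ?B = "gball S r x" and ?B' = "gball S' r x'"
  note B = S.verts_gball_walk[OF x(1), of r] S'.verts_gball_walk[OF x(2), of r]
  have mono: "w \<in> words n (Suc r)" if "w \<in> words n r" for w using that words_mono[of r "Suc r"] by auto
  note eq = agree_vertexD[OF agr] and col = agree_colorD[OF agr]
  \<comment> \<open>The choice of the word is immaterial: two words of length at most
    \<open>r\<close> with the same end in \<open>S\<close> have the same end in
    \<open>S'\<close>.\<close>
  define \<phi> where "\<phi> v = foldr a' (SOME w. w \<in> words n r \<and> foldr a w x = v) x'" for v
  have \<phi>: "\<phi> (foldr a w x) = foldr a' w x'" if w: "w \<in> words n r" for w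
  proof -
    let ?P = "\<lambda>u. u \<in> words n r \<and> foldr a u x = foldr a w x"
    have "?P (SOME u. ?P u)" by (rule someI[of ?P w]) (simp add: w)
    then show ?thesis using eq w mono unfolding \<phi>_def by blast
  qed
  have "inj_on \<phi> (verts ?B)"
    unfolding B using eq mono by (auto simp: inj_on_def \<phi>)
  moreover have "\<phi> ` verts ?B = verts ?B'"
    unfolding B by (auto simp: \<phi> image_iff)
  moreover have "\<phi> x = x'" using \<phi>[of "[]"] by simp
  moreover have "(u, l, v) \<in> arcs ?B \<longleftrightarrow> (\<phi> u, l, \<phi> v) \<in> arcs ?B'"
    if uv: "u \<in> verts ?B" "v \<in> verts ?B" for u v l
  proof -
    obtain w w' where w: "w \<in> words n r" "w' \<in> words n r" "u = foldr a w x" "v = foldr a w' x"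
      using uv unfolding B by blast
    have "\<phi> u \<in> verts ?B'" "\<phi> v \<in> verts ?B'" unfolding B using w \<phi> by auto
    moreover have "l \<in> letters n \<Longrightarrow> foldr a w' x = foldr a (l # w) x \<longleftrightarrow> foldr a' w' x' = foldr a' (l # w) x'"
      using w mono by (intro eq) (auto simp: Cons_in_words)
    ultimately show ?thesis
      using uv w \<phi> by (auto simp: arcs_gball S.arcs_iff S'.arcs_iff verts_gball)
  qed
  moreover have "c' (\<phi> v) = c v" if "v \<in> verts ?B" for v
    using that col mono \<phi> unfolding B by auto
  moreover have "x \<in> verts ?B" by (rule root_in_gball[OF x(1)])
  ultimately show ?thesis
    unfolding colored_rooted_isomorphic_def is_rooted_iso_def bij_betw_def by blast
qed

text \<open>Coincidence of ends and colors are part of the trace. A step to a neighbor is a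
  coincidence with a word that has one more letter, hence agreement at radius \<open>Suc r\<close>
  for vertices reached within \<open>r\<close>.\<close>

lemma repetitive_transfer:
  assumes S: "letter_graph n S a" "letter_graph n S' a'" and x: "x \<in> verts S" "x' \<in> verts S'"
    and agr: "agree n (Suc r) (trace a c x) (trace a' c' x')"
    and uv: "set us \<subseteq> words n r" "set vs \<subseteq> words n r"
    and rep: "repetitive (\<lambda>u v. (u, v) \<in> adj S) c
      (map (\<lambda>w. foldr a w x) us) (map (\<lambda>w. foldr a w x) vs)"
  shows "repetitive (\<lambda>u v. (u, v) \<in> adj S') c'
    (map (\<lambda>w. foldr a' w x') us) (map (\<lambda>w. foldr a' w x') vs)"
proof -
  interpret S: letter_graph n S a by fact
  interpret S': letter_graph n S' a' by fact
  let ?ws = "us @ vs"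
  have mono: "w \<in> words n (Suc r)" if "w \<in> set ?ws" for w
    using that uv words_mono[of r "Suc r" n] by auto
  note eq = agree_vertexD[OF agr] and col = agree_colorD[OF agr]
  have "distinct (map (\<lambda>w. foldr a w x) ?ws)" "us \<noteq> []"
    using rep by (auto simp: repetitive_def)
  then have "distinct (map (\<lambda>w. foldr a' w x') ?ws)"
    unfolding distinct_map inj_on_def using eq mono by metis
  moreover have "successively (\<lambda>w w'. (foldr a w x, foldr a w' x) \<in> adj S) ?ws"
    using rep by (auto simp: repetitive_def successively_map simp flip: map_append)
  then have "successively (\<lambda>w w'. (foldr a' w x', foldr a' w' x') \<in> adj S') ?ws"
  proof (rule successively_mono)
    fix w w' assume w: "w \<in> set ?ws" "w' \<in> set ?ws" "(foldr a w x, foldr a w' x) \<in> adj S"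
    then obtain l where l: "l \<in> letters n" "foldr a w' x = foldr a (l # w) x"
      by (auto simp: S.adj_iff)
    moreover have wr: "w \<in> words n r" using w uv by auto
    ultimately have "foldr a' w' x' = foldr a' (l # w) x'"
      using eq[of w' "l # w"] w mono by (auto simp: Cons_in_words)
    then show "(foldr a' w x', foldr a' w' x') \<in> adj S'"
      using l wr S'.walk_closed[OF x(2), of w] by (auto simp: S'.adj_iff words_def)
  qed
  then have "successively (\<lambda>u v. (u, v) \<in> adj S') (map (\<lambda>w. foldr a' w x') ?ws)"
    by (simp only: successively_map)
  moreover have "map (\<lambda>w. c' (foldr a' w x')) us = map (\<lambda>w. c (foldr a w x)) us"
    "map (\<lambda>w. c' (foldr a' w x')) vs = map (\<lambda>w. c (foldr a w x)) vs"
    using col mono by auto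
  moreover have "map (\<lambda>w. c (foldr a w x)) us = map (\<lambda>w. c (foldr a w x)) vs"
    using rep by (simp add: repetitive_def comp_def)
  ultimately show ?thesis
    using \<open>us \<noteq> []\<close> unfolding repetitive_def by (simp del: map_eq_conv add: comp_def)
qed

section \<open>Schreier graphs as deterministic graphs\<close>

definition letter_act :: "('a, 'b) monoid_scheme \<Rightarrow> 'a list \<Rightarrow> letter \<Rightarrow> 'a set \<Rightarrow> 'a set"
  where "letter_act G Q l X = (if snd l then Q ! fst l else inv\<^bsub>G\<^esub> (Q ! fst l)) <#\<^bsub>G\<^esub> X"

context group
begin

lemma lcosets_subset: "H \<subseteq> carrier G \<Longrightarrow> X \<in> lcosets H \<Longrightarrow> X \<subseteq> carrier G"
  by (auto elim!: lcosetsE simp: l_coset_subset_G subset_iff l_coset_def)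

lemma letter_graph_schreier_graph:
  assumes Q: "set Q \<subseteq> carrier G" and H: "subgroup H G"
  shows "letter_graph (length Q) (schreier_graph G Q H) (letter_act G Q)"
proof
  have Hs: "H \<subseteq> carrier G" by (rule subgroup.subset[OF H])
  note sub = lcosets_subset[OF Hs]
  have q: "Q ! i \<in> carrier G" if "i < length Q" for i using Q that by auto
  have lmult: "g <# X \<in> lcosets H" if gX: "g \<in> carrier G" "X \<in> lcosets H" for g X
  proof -
    obtain b where "b \<in> carrier G" "X = b <# H" using gX(2) by (rule lcosetsE)
    then show ?thesis using gX(1) Hs by (simp add: lcos_m_assoc lcosetsI)
  qed
  have shift: "g <# Y = X \<longleftrightarrow> Y = inv g <# X"
    if "g \<in> carrier G" "X \<in> lcosets H" "Y \<in> lcosets H" for g X Y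
    using that sub by (auto simp: lcos_m_assoc lcos_mult_one)
  show act_closed: "letter_act G Q l X \<in> verts (schreier_graph G Q H)"
    if "X \<in> verts (schreier_graph G Q H)" "l \<in> letters (length Q)" for X l
    using that q lmult by (auto simp: letter_act_def letters_def)
  show "letter_act G Q (flip l) (letter_act G Q l X) = X"
    if "X \<in> verts (schreier_graph G Q H)" "l \<in> letters (length Q)" for X l
    using that q sub by (auto simp: letter_act_def letters_def flip_def lcos_m_assoc lcos_mult_one)
  show "(X, l, Y) \<in> arcs (schreier_graph G Q H) \<longleftrightarrow>
    X \<in> verts (schreier_graph G Q H) \<and> l \<in> letters (length Q) \<and> Y = letter_act G Q l X" for X l Y
  proof (cases l)
    case (Pair i b)
    show ?thesis
      using act_closed[of X l] q[of i] shift[of "Q ! i" X Y]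
      unfolding Pair arcs_schreier_graph by (auto simp: letter_act_def letters_def)
  qed
qed

end

section \<open>The topology of the space of colored Schreier graphs\<close>

locale generated_group = group G for G :: "('a, 'b) monoid_scheme" (structure) +
  fixes Q :: "'a list"
  assumes Q: "generating_system G Q"
begin

abbreviation act :: "letter \<Rightarrow> 'a set \<Rightarrow> 'a set"
  where "act \<equiv> letter_act G Q"

text \<open>Agreement of traces interleaves with isomorphism of balls: radius \<open>Suc r\<close>
  here gives radius \<open>r\<close> there, and radius \<open>r\<close> there gives radius
  \<open>r\<close> here. It defines the same topology, with explicit equivalence classes as
  neighborhoods and no isomorphisms to carry along.\<close>

definition agr :: "nat \<Rightarrow> 'a colored_schreier \<Rightarrow> 'a colored_schreier \<Rightarrow> bool"
  where "agr r x y \<longleftrightarrow>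
    agree (length Q) r (trace act (snd x) (fst x)) (trace act (snd y) (fst y))"

definition lval :: "letter \<Rightarrow> 'a"
  where "lval l = (if snd l then Q ! fst l else inv (Q ! fst l))"

definition wval :: "letter list \<Rightarrow> 'a"
  where "wval w = foldr (\<lambda>l g. lval l \<otimes> g) w \<one>"

lemma Q_carrier: "set Q \<subseteq> carrier G"
  using Q by (simp add: generating_system_def)

lemma lval_closed: "l \<in> letters (length Q) \<Longrightarrow> lval l \<in> carrier G"
  using Q_carrier nth_mem[of "fst l" Q] by (auto simp: lval_def letters_def subset_iff)

lemma wval_closed: "set w \<subseteq> letters (length Q) \<Longrightarrow> wval w \<in> carrier G"
  by (induction w) (auto simp: wval_def lval_closed)

lemma act_eq: "act l X = lval l <# X"
  by (simp add: letter_act_def lval_def)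

lemma walk_eq:
  "set w \<subseteq> letters (length Q) \<Longrightarrow> X \<subseteq> carrier G \<Longrightarrow> foldr act w X = wval w <# X"
proof (induction w)
  case (Cons l w)
  then show ?case
    using wval_closed[of w] lval_closed[of l] by (simp add: act_eq wval_def lcos_m_assoc)
qed (simp add: wval_def lcos_mult_one)

lemma ex_word:
  assumes "g \<in> carrier G" shows "\<exists>w. set w \<subseteq> letters (length Q) \<and> wval w = g"
  using Q assms
proof (induction g rule: generating_induct)
  case one
  then show ?case by (intro exI[of _ "[]"]) (simp add: wval_def)
next
  case (gen i g)
  then obtain w where "set w \<subseteq> letters (length Q)" "wval w = g" by blast
  then show ?case using gen(1)
    by (intro exI[of _ "(i, True) # w"]) (auto simp: wval_def lval_def letters_def)
next
  case (inv i g)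
  then obtain w where "set w \<subseteq> letters (length Q)" "wval w = g" by blast
  then show ?case using inv(1)
    by (intro exI[of _ "(i, False) # w"]) (auto simp: wval_def lval_def letters_def)
qed

lemma letter_graph: "subgroup H G \<Longrightarrow> letter_graph (length Q) (schreier_graph G Q H) act"
  by (rule letter_graph_schreier_graph[OF Q_carrier])

lemma agr_refl [simp]: "agr r x x"
  by (simp add: agr_def)

lemma agr_sym: "agr r x y \<Longrightarrow> agr r y x"
  by (simp add: agr_def agree_sym)

lemma agr_trans: "agr r x y \<Longrightarrow> agr r y z \<Longrightarrow> agr r x z"
  unfolding agr_def by (rule agree_trans)

lemma agr_mono: "agr s x y \<Longrightarrow> r \<le> s \<Longrightarrow> agr r x y"
  unfolding agr_def by (rule agree_mono)

lemma SchD: "x \<in> Sch G K \<Longrightarrow> subgroup (fst x) G" "x \<in> Sch G K \<Longrightarrow> snd x \<in> lcosets (fst x) \<rightarrow>\<^sub>E K"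
  by (auto simp: Sch_def)

section \<open>Agreement of traces describes the metric topology\<close>

lemma sch_agree_if_agr:
  assumes "x \<in> Sch G K" "y \<in> Sch G K" "agr (Suc r) x y" shows "sch_agree G Q r x y"
  using colored_rooted_isomorphic_if_agree[OF letter_graph letter_graph _ _ assms(3)[unfolded agr_def]]
    SchD[OF assms(1)] SchD[OF assms(2)] root_in_schreier_graph
  by (simp add: sch_agree_def case_prod_beta)

lemma agr_if_sch_agree:
  assumes "x \<in> Sch G K" "y \<in> Sch G K" "sch_agree G Q r x y" shows "agr r x y"
proof -
  obtain \<phi> where "is_rooted_iso \<phi> (gball (schreier_graph G Q (fst x)) r (fst x)) (fst x)
      (gball (schreier_graph G Q (fst y)) r (fst y)) (fst y)"
    "\<And>v. v \<in> verts (gball (schreier_graph G Q (fst x)) r (fst x)) \<Longrightarrow> snd y (\<phi> v) = snd x v"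
    using assms(3) by (auto simp: sch_agree_def case_prod_beta colored_rooted_isomorphic_def)
  then show ?thesis
    unfolding agr_def using SchD(1)[OF assms(1)] SchD(1)[OF assms(2)]
    by (intro agree_if_rooted_iso[OF letter_graph letter_graph root_in_schreier_graph root_in_schreier_graph])
qed

lemma ex_agr_imp_dist_less:
  assumes "\<epsilon> > 0"
  obtains r where "\<And>x y. x \<in> Sch G K \<Longrightarrow> y \<in> Sch G K \<Longrightarrow> agr r x y \<Longrightarrow> sch_dist G Q x y < \<epsilon>"
proof -
  obtain s :: nat where s: "(1/2) ^ s < \<epsilon>" using real_arch_pow_inv[OF assms, of "1/2"] by auto
  have "sch_dist G Q x y < \<epsilon>" if x: "x \<in> Sch G K" and y: "y \<in> Sch G K" and "agr (Suc s) x y" for x y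
  proof (cases "x = y")
    case False
    let ?A = "\<lambda>r. sch_agree G Q r x y"
    have "?A s" using sch_agree_if_agr[OF that] .
    \<comment> \<open>\<open>GREATEST\<close> needs a bound: distinct points disagree at some radius
      \<open>b\<close>, and then at all larger ones.\<close>
    obtain b where "\<not> ?A b" using sch_agree_all_imp_eq[OF Q x y] False by blast
    then have b: "r \<le> b" if "?A r" for r using sch_agree_mono[OF x y that, of b] by (meson nat_le_linear)
    have "s \<le> (GREATEST r. ?A r)" using Greatest_le_nat[of ?A, OF \<open>?A s\<close> b] .
    then have "(1/2::real) ^ (GREATEST r. ?A r) \<le> (1/2) ^ s" by (intro power_decreasing) auto
    then have "(1/2::real) ^ (GREATEST r. ?A r) < \<epsilon>" using s by (rule order.strict_trans1)
    then show ?thesis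
      using False sch_agree_mono[OF x y \<open>?A s\<close>, of 0] by (simp add: sch_dist_def)
  qed (use assms in \<open>simp add: sch_dist_def\<close>)
  then show thesis by (rule that)
qed

lemma agr_if_dist_less:
  assumes x: "x \<in> Sch G K" and y: "y \<in> Sch G K" and d: "sch_dist G Q x y < (1/2) ^ r"
  shows "agr r x y"
proof (cases "x = y")
  case False
  let ?A = "\<lambda>r. sch_agree G Q r x y"
  \<comment> \<open>This excludes the default distance 2, so the balls of radius 0 agree and the
    distance is a genuine power of 1/2.\<close>
  have "(1/2::real) ^ r \<le> 1" by (intro power_le_one) auto
  then have A0: "?A 0" using d False by (auto simp: sch_dist_def split: if_splits)
  then have less: "(1/2::real) ^ (GREATEST r. ?A r) < (1/2) ^ r"
    using d False by (simp add: sch_dist_def)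
  obtain b where "\<not> ?A b" using sch_agree_all_imp_eq[OF Q x y] False by blast
  then have b: "r \<le> b" if "?A r" for r using sch_agree_mono[OF x y that, of b] by (meson nat_le_linear)
  have "r \<le> (GREATEST r. ?A r)" using less by (simp add: power_strict_decreasing_iff)
  then have "?A r" using sch_agree_mono[OF x y GreatestI_nat[of ?A, OF A0 b]] by blast
  then show ?thesis by (rule agr_if_sch_agree[OF x y])
qed simp

lemma topspace_Sch [simp]: "topspace (Sch_topology G Q K) = Sch G K"
  by (simp add: Sch_topology_def Metric_space.topspace_mtopology[OF Metric_space_Sch[OF Q]])

lemma metrizable_Sch: "metrizable_space (Sch_topology G Q K)"
  by (simp add: Sch_topology_def Metric_space.metrizable_space_mtopology[OF Metric_space_Sch[OF Q]])

lemma openin_Sch_iff: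
  "openin (Sch_topology G Q K) U \<longleftrightarrow>
    U \<subseteq> Sch G K \<and> (\<forall>x\<in>U. \<exists>r. \<forall>y\<in>Sch G K. agr r x y \<longrightarrow> y \<in> U)"
proof -
  interpret M: Metric_space "Sch G K" "sch_dist G Q" by (rule Metric_space_Sch[OF Q])
  have "(\<exists>\<epsilon>>0. M.mball x \<epsilon> \<subseteq> U) \<longleftrightarrow> (\<exists>r. \<forall>y\<in>Sch G K. agr r x y \<longrightarrow> y \<in> U)"
    if "U \<subseteq> Sch G K" "x \<in> U" for x
  proof
    assume "\<exists>\<epsilon>>0. M.mball x \<epsilon> \<subseteq> U"
    then obtain \<epsilon> where \<epsilon>: "\<epsilon> > 0" "M.mball x \<epsilon> \<subseteq> U" by blast
    obtain r where "\<And>x y. x \<in> Sch G K \<Longrightarrow> y \<in> Sch G K \<Longrightarrow> agr r x y \<Longrightarrow> sch_dist G Q x y < \<epsilon>"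
      using ex_agr_imp_dist_less[OF \<epsilon>(1)] by blast
    then have "y \<in> M.mball x \<epsilon>" if "y \<in> Sch G K" "agr r x y" for y
      using \<open>U \<subseteq> Sch G K\<close> \<open>x \<in> U\<close> that by (subst M.in_mball) blast
    then show "\<exists>r. \<forall>y\<in>Sch G K. agr r x y \<longrightarrow> y \<in> U" using \<epsilon>(2) by blast
  next
    assume "\<exists>r. \<forall>y\<in>Sch G K. agr r x y \<longrightarrow> y \<in> U"
    then obtain r where r: "\<And>y. y \<in> Sch G K \<Longrightarrow> agr r x y \<Longrightarrow> y \<in> U" by blast
    have "y \<in> Sch G K \<and> agr r x y" if "y \<in> M.mball x ((1/2) ^ r)" for y
      using that agr_if_dist_less[of x K y r] by simp
    then have "M.mball x ((1/2) ^ r) \<subseteq> U" using r by (intro subsetI) simp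
    then show "\<exists>\<epsilon>>0. M.mball x \<epsilon> \<subseteq> U"
      by (intro exI[of _ "(1/2) ^ r"]) simp
  qed
  then show ?thesis by (auto simp: Sch_topology_def M.openin_mtopology subset_iff)
qed

lemma openin_agr_class:
  assumes "x \<in> Sch G K" shows "openin (Sch_topology G Q K) {y \<in> Sch G K. agr r x y}"
  unfolding openin_Sch_iff using agr_trans by blast

lemma limitin_Sch_iff:
  assumes "\<And>j. \<sigma> j \<in> Sch G K"
  shows "limitin (Sch_topology G Q K) \<sigma> x sequentially \<longleftrightarrow>
    x \<in> Sch G K \<and> (\<forall>r. \<forall>\<^sub>F j in sequentially. agr r x (\<sigma> j))"
proof
  assume L: "limitin (Sch_topology G Q K) \<sigma> x sequentially"
  then have x: "x \<in> Sch G K" using limitin_topspace by fastforce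
  then have "\<forall>\<^sub>F j in sequentially. \<sigma> j \<in> {y \<in> Sch G K. agr r x y}" for r
    using x by (intro limitinD[OF L openin_agr_class[OF x]]) simp
  then show "x \<in> Sch G K \<and> (\<forall>r. \<forall>\<^sub>F j in sequentially. agr r x (\<sigma> j))"
    using x assms by simp
next
  assume R: "x \<in> Sch G K \<and> (\<forall>r. \<forall>\<^sub>F j in sequentially. agr r x (\<sigma> j))"
  have "\<forall>\<^sub>F j in sequentially. \<sigma> j \<in> U" if U: "openin (Sch_topology G Q K) U" "x \<in> U" for U
  proof -
    obtain r where r: "\<And>y. y \<in> Sch G K \<Longrightarrow> agr r x y \<Longrightarrow> y \<in> U"
      using U unfolding openin_Sch_iff by blast
    have "\<forall>\<^sub>F j in sequentially. agr r x (\<sigma> j)" using R by blast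
    then show ?thesis by (rule eventually_mono) (rule r[OF assms])
  qed
  then show "limitin (Sch_topology G Q K) \<sigma> x sequentially"
    using R by (simp add: limitin_def)
qed

section \<open>Pointwise description of convergence, and compactness\<close>

lemma lcos_eq_self_iff: "subgroup H G \<Longrightarrow> g \<in> carrier G \<Longrightarrow> g <# H = H \<longleftrightarrow> g \<in> H"
  by (metis coset_join3 lcos_self)

lemma lcos_eq_iff:
  assumes "subgroup H G" "g \<in> carrier G" "h \<in> carrier G"
  shows "g <# H = h <# H \<longleftrightarrow> inv g \<otimes> h \<in> H"
proof -
  have Hs: "H \<subseteq> carrier G" by (rule subgroup.subset[OF assms(1)])
  have "inv g \<otimes> h \<in> H \<longleftrightarrow> inv g <# (h <# H) = H"
    using assms Hs by (simp add: lcos_m_assoc flip: lcos_eq_self_iff)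
  also have "\<dots> \<longleftrightarrow> g <# (inv g <# (h <# H)) = g <# H"
    using assms Hs by (metis (no_types, lifting) inv_closed l_coset_subset_G l_inv lcos_m_assoc lcos_mult_one)
  also have "g <# (inv g <# (h <# H)) = h <# H"
    using assms Hs by (simp add: lcos_m_assoc l_coset_subset_G lcos_mult_one flip: m_assoc)
  finally show ?thesis by auto
qed

text \<open>Write \<open>g\<close> as a word: \<open>g\<close> lies in the subgroup iff the walk
  along that word returns to the root. The length of the word is a sufficient radius.\<close>

lemma agr_determines_coset:
  assumes g: "g \<in> carrier G"
  obtains r where "\<And>x y. x \<in> Sch G K \<Longrightarrow> y \<in> Sch G L \<Longrightarrow> agr r x y \<Longrightarrow>
    (g \<in> fst x \<longleftrightarrow> g \<in> fst y) \<and> snd x (g <# fst x) = snd y (g <# fst y)"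
proof -
  obtain w where w: "set w \<subseteq> letters (length Q)" "wval w = g" using ex_word[OF g] by blast
  have ww: "w \<in> words (length Q) (length w)" using w by (simp add: words_def)
  have "(g \<in> fst x \<longleftrightarrow> g \<in> fst y) \<and> snd x (g <# fst x) = snd y (g <# fst y)"
    if x: "x \<in> Sch G K" and y: "y \<in> Sch G L" and a: "agr (length w) x y" for x y
    using agree_vertexD[OF a[unfolded agr_def] ww, of "[]"] agree_colorD[OF a[unfolded agr_def] ww]
      walk_eq[OF w(1)] w(2) SchD(1)[OF x] SchD(1)[OF y] g
      subgroup.subset[OF SchD(1)[OF x]] subgroup.subset[OF SchD(1)[OF y]]
    by (simp add: lcos_eq_self_iff)
  then show thesis by (rule that)
qed

text \<open>Two words end at the same coset iff the quotient of their values lies in the subgroup,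
  so finitely many memberships and colors decide a trace up to radius \<open>r\<close>. Convergence
  thus amounts to pointwise stabilization of the subgroup and of the color at each gH.\<close>

lemma cosets_determine_agr:
  obtains F where "finite F" "F \<subseteq> carrier G"
    "\<And>x y K L. x \<in> Sch G K \<Longrightarrow> y \<in> Sch G L \<Longrightarrow>
      (\<And>g. g \<in> F \<Longrightarrow> (g \<in> fst x \<longleftrightarrow> g \<in> fst y) \<and> snd x (g <# fst x) = snd y (g <# fst y)) \<Longrightarrow> agr r x y"
proof -
  let ?W = "words (length Q) r"
  define F where "F = wval ` ?W \<union> (\<lambda>(w, w'). inv (wval w) \<otimes> wval w') ` (?W \<times> ?W)"
  have v: "wval w \<in> carrier G" if "w \<in> ?W" for w using that by (intro wval_closed) (simp add: words_def)
  have "finite F" unfolding F_def using finite_words by blast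
  moreover have "F \<subseteq> carrier G" using v by (auto simp: F_def)
  moreover have "agr r x y" if x: "x \<in> Sch G K" and y: "y \<in> Sch G L"
    and F: "\<And>g. g \<in> F \<Longrightarrow> (g \<in> fst x \<longleftrightarrow> g \<in> fst y) \<and> snd x (g <# fst x) = snd y (g <# fst y)"
    for x y K L
    unfolding agr_def agree_def trace_def
  proof (intro ballI)
    fix w w' assume w: "w \<in> ?W" "w' \<in> ?W"
    have e: "foldr act u (fst z) = wval u <# fst z" if "u \<in> ?W" "z = x \<or> z = y" for u z
      using that SchD(1)[OF x] SchD(1)[OF y] subgroup.subset by (intro walk_eq) (auto simp: words_def)
    have "inv (wval w) \<otimes> wval w' \<in> F" "wval w \<in> F" using w by (auto simp: F_def)
    then show "(foldr act w (fst x) = foldr act w' (fst x), snd x (foldr act w (fst x))) =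
        (foldr act w (fst y) = foldr act w' (fst y), snd y (foldr act w (fst y)))"
      using F e w v SchD(1)[OF x] SchD(1)[OF y] by (simp add: lcos_eq_iff)
  qed
  ultimately show thesis by (rule that)
qed

text \<open>Restricted to words of length at most \<open>r\<close>, a trace is a function between
  finite sets; \<open>R\<close> takes one point for each restricted trace that occurs.\<close>

lemma finitely_many_agr_classes:
  assumes "finite K"
  obtains R where "finite R" "R \<subseteq> Sch G K" "\<And>x. x \<in> Sch G K \<Longrightarrow> \<exists>y\<in>R. agr r x y"
proof -
  let ?W = "words (length Q) r \<times> words (length Q) r"
  let ?f = "\<lambda>x. restrict (\<lambda>(w, w'). trace act (snd x) (fst x) w w') ?W"
  have col: "snd x (foldr act w (fst x)) \<in> K" if "x \<in> Sch G K" "w \<in> words (length Q) r" for x w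
  proof -
    have "foldr act w (fst x) \<in> lcosets (fst x)"
      using letter_graph.walk_closed[OF letter_graph[OF SchD(1)[OF that(1)]] root_in_schreier_graph[OF SchD(1)[OF that(1)]]]
        that(2) by (simp add: words_def)
    then show ?thesis using SchD(2)[OF that(1)] by auto
  qed
  have "?f x \<in> ?W \<rightarrow>\<^sub>E UNIV \<times> K" if x: "x \<in> Sch G K" for x
    using col[OF x] by (simp add: restrict_PiE_iff trace_def split_beta mem_Times_iff)
  then have "?f ` Sch G K \<subseteq> ?W \<rightarrow>\<^sub>E UNIV \<times> K" by (rule image_subsetI)
  moreover have "finite (?W \<rightarrow>\<^sub>E (UNIV :: bool set) \<times> K)"
    using assms finite_words by (intro finite_PiE) auto
  ultimately have "finite (?f ` Sch G K)" by (rule finite_subset)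
  then obtain R where R: "R \<subseteq> Sch G K" "finite R" "?f ` Sch G K = ?f ` R"
    using finite_subset_image[of "?f ` Sch G K" ?f "Sch G K"] by blast
  have "\<exists>y\<in>R. agr r x y" if "x \<in> Sch G K" for x
  proof -
    obtain y where y: "y \<in> R" "?f x = ?f y" using R(3) \<open>x \<in> Sch G K\<close> by blast
    have "trace act (snd x) (fst x) w w' = trace act (snd y) (fst y) w w'"
      if "w \<in> words (length Q) r" "w' \<in> words (length Q) r" for w w'
      using that fun_cong[OF y(2), of "(w, w')"] by simp
    then show ?thesis using y(1) by (auto simp: agr_def agree_def)
  qed
  then show thesis using R that by blast
qed

text \<open>For each \<open>g\<close>, its membership in the subgroup and the color of its coset are
  eventually constant, and the eventual values make up the limit. The subgroup laws and membership
  of colors in \<open>K\<close> involve finitely many elements at a time, so they survive.\<close>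

lemma agr_Cauchy_convergent:
  assumes \<sigma>: "\<And>j. \<sigma> j \<in> Sch G K" and C: "\<And>r. \<exists>N. \<forall>j\<ge>N. agr r (\<sigma> N) (\<sigma> j)"
  obtains x where "x \<in> Sch G K" "\<forall>r. \<forall>\<^sub>F j in sequentially. agr r x (\<sigma> j)"
proof -
  let ?H = "\<lambda>j. fst (\<sigma> j)" and ?c = "\<lambda>j. snd (\<sigma> j)"
  note sub = SchD(1)[OF \<sigma>]
  have stable: "\<exists>b k. \<forall>\<^sub>F j in sequentially. (g \<in> ?H j \<longleftrightarrow> b) \<and> ?c j (g <# ?H j) = k"
    if g: "g \<in> carrier G" for g
  proof -
    obtain r where r: "\<And>x y. x \<in> Sch G K \<Longrightarrow> y \<in> Sch G K \<Longrightarrow> agr r x y \<Longrightarrow>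
      (g \<in> fst x \<longleftrightarrow> g \<in> fst y) \<and> snd x (g <# fst x) = snd y (g <# fst y)"
      using agr_determines_coset[OF g] by metis
    obtain N where "\<forall>j\<ge>N. agr r (\<sigma> N) (\<sigma> j)" using C by blast
    then have "\<forall>j\<ge>N. (g \<in> ?H j \<longleftrightarrow> g \<in> ?H N) \<and> ?c j (g <# ?H j) = ?c N (g <# ?H N)"
      using r[OF \<sigma> \<sigma>] by metis
    then show ?thesis unfolding eventually_sequentially by blast
  qed
  define H where "H = {g \<in> carrier G. \<forall>\<^sub>F j in sequentially. g \<in> ?H j}"
  define d where "d g = (SOME k. \<forall>\<^sub>F j in sequentially. ?c j (g <# ?H j) = k)" for g
  define c where "c = (\<lambda>X\<in>lcosets H. d (SOME g. g \<in> carrier G \<and> X = g <# H))"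
  have mem: "\<forall>\<^sub>F j in sequentially. g \<in> ?H j \<longleftrightarrow> g \<in> H" if g: "g \<in> carrier G" for g
  proof -
    obtain b k where "\<forall>\<^sub>F j in sequentially. (g \<in> ?H j \<longleftrightarrow> b) \<and> ?c j (g <# ?H j) = k"
      using stable[OF g] by blast
    then have b: "\<forall>\<^sub>F j in sequentially. g \<in> ?H j \<longleftrightarrow> b" by (rule eventually_mono) simp
    show ?thesis
    proof (cases b)
      case True
      then show ?thesis using b g by (auto simp: H_def)
    next
      case False
      then have n: "\<forall>\<^sub>F j in sequentially. g \<notin> ?H j" using b by simp
      have "g \<notin> H"
      proof
        assume "g \<in> H"
        then have "\<forall>\<^sub>F j in sequentially. g \<in> ?H j" by (simp add: H_def)
        then have "\<forall>\<^sub>F j in sequentially. False"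
          using n by (rule eventually_elim2) simp
        then show False by simp
      qed
      then show ?thesis using n by simp
    qed
  qed
  have d: "\<forall>\<^sub>F j in sequentially. ?c j (g <# ?H j) = d g" if g: "g \<in> carrier G" for g
  proof -
    obtain b k where "\<forall>\<^sub>F j in sequentially. (g \<in> ?H j \<longleftrightarrow> b) \<and> ?c j (g <# ?H j) = k"
      using stable[OF g] by blast
    then have "\<forall>\<^sub>F j in sequentially. ?c j (g <# ?H j) = k" by (rule eventually_mono) simp
    then show ?thesis unfolding d_def by (rule someI)
  qed
  have H: "subgroup H G"
  proof
    show "H \<subseteq> carrier G" by (auto simp: H_def)
    show "\<one> \<in> H" using subgroup.one_closed[OF sub] by (simp add: H_def)
    show "x \<otimes> y \<in> H" if xy: "x \<in> H" "y \<in> H" for x y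
    proof -
      have "\<forall>\<^sub>F j in sequentially. x \<in> ?H j" "\<forall>\<^sub>F j in sequentially. y \<in> ?H j"
        using xy by (simp_all add: H_def)
      then have "\<forall>\<^sub>F j in sequentially. x \<otimes> y \<in> ?H j"
        by (rule eventually_elim2) (rule subgroup.m_closed[OF sub])
      then show ?thesis using xy by (simp add: H_def)
    qed
    show "inv x \<in> H" if "x \<in> H" for x
    proof -
      have "\<forall>\<^sub>F j in sequentially. x \<in> ?H j" using that by (simp add: H_def)
      then have "\<forall>\<^sub>F j in sequentially. inv x \<in> ?H j"
        by (rule eventually_mono) (rule subgroup.m_inv_closed[OF sub])
      then show ?thesis using that by (simp add: H_def)
    qed
  qed
  \<comment> \<open>The color of a coset of \<open>H\<close> was defined through a chosen
    representative \<open>h\<close>. For any other \<open>g\<close> in the coset,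
    \<open>inv g \<otimes> h\<close> eventually lies in the subgroups of the sequence, where the
    cosets of \<open>g\<close> and \<open>h\<close> then coincide.\<close>
  have c: "\<forall>\<^sub>F j in sequentially. ?c j (g <# ?H j) = c (g <# H)" if g: "g \<in> carrier G" for g
  proof -
    let ?P = "\<lambda>h. h \<in> carrier G \<and> g <# H = h <# H"
    define h where "h = (SOME h. ?P h)"
    have "?P h" unfolding h_def by (rule someI[of ?P g]) (simp add: g)
    then have h: "h \<in> carrier G" "inv g \<otimes> h \<in> H" using lcos_eq_iff[OF H] g by auto
    then have "\<forall>\<^sub>F j in sequentially. inv g \<otimes> h \<in> ?H j" by (simp add: H_def)
    then have "\<forall>\<^sub>F j in sequentially. g <# ?H j = h <# ?H j"
      by (rule eventually_mono) (use lcos_eq_iff[OF sub] g h in auto)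
    then show ?thesis
      using d[OF h(1)] by (rule eventually_elim2) (use g in \<open>simp add: c_def lcosetsI h_def\<close>)
  qed
  have "c X \<in> K" if X: "X \<in> lcosets H" for X
  proof -
    obtain g where g: "g \<in> carrier G" "X = g <# H" using X by (rule lcosetsE)
    obtain j where "?c j (g <# ?H j) = c X"
      using c[OF g(1)] g(2) by (auto simp: eventually_sequentially)
    moreover have "?c j (g <# ?H j) \<in> K" using SchD(2)[OF \<sigma>, of j] lcosetsI[OF g(1)] by auto
    ultimately show ?thesis by simp
  qed
  then have x: "(H, c) \<in> Sch G K" using H by (auto simp: Sch_def c_def)
  have "\<forall>\<^sub>F j in sequentially. agr r (H, c) (\<sigma> j)" for r
  proof -
    obtain F where F: "finite F" "F \<subseteq> carrier G"
      "\<And>x y. x \<in> Sch G K \<Longrightarrow> y \<in> Sch G K \<Longrightarrow>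
      (\<And>g. g \<in> F \<Longrightarrow> (g \<in> fst x \<longleftrightarrow> g \<in> fst y) \<and> snd x (g <# fst x) = snd y (g <# fst y)) \<Longrightarrow> agr r x y"
      using cosets_determine_agr[of r] by metis
    have "\<forall>\<^sub>F j in sequentially. \<forall>g\<in>F. (g \<in> ?H j \<longleftrightarrow> g \<in> H) \<and> ?c j (g <# ?H j) = c (g <# H)"
      using F(2) mem c by (intro eventually_ball_finite[OF F(1)]) (simp add: eventually_conj_iff subset_iff)
    then show ?thesis
      by (rule eventually_mono) (use F(3)[OF x \<sigma>] in auto)
  qed
  then show thesis using that x by blast
qed

lemma compact_Sch:
  assumes "finite K" shows "compact_space (Sch_topology G Q K)"
proof -
  interpret M: Metric_space "Sch G K" "sch_dist G Q" by (rule Metric_space_Sch[OF Q])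
  have "M.mcomplete"
    unfolding M.mcomplete_def
  proof (intro allI impI)
    fix \<sigma> assume \<sigma>: "M.MCauchy \<sigma>"
    then have S: "\<sigma> j \<in> Sch G K" for j by (auto simp: M.MCauchy_def)
    have C: "\<exists>N. \<forall>j\<ge>N. agr r (\<sigma> N) (\<sigma> j)" for r
    proof -
      obtain N where "\<forall>i j. N \<le> i \<longrightarrow> N \<le> j \<longrightarrow> sch_dist G Q (\<sigma> i) (\<sigma> j) < (1/2) ^ r"
        using \<sigma> by (auto simp: M.MCauchy_def dest!: spec[of _ "(1/2) ^ r"])
      then show ?thesis using agr_if_dist_less[OF S S] by blast
    qed
    obtain x where "x \<in> Sch G K" "\<forall>r. \<forall>\<^sub>F j in sequentially. agr r x (\<sigma> j)"
      by (rule agr_Cauchy_convergent[of \<sigma> K, OF S C])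
    then have "limitin (Sch_topology G Q K) \<sigma> x sequentially" using limitin_Sch_iff[of \<sigma> K x] S by simp
    then show "\<exists>x. limitin M.mtopology \<sigma> x sequentially"
      unfolding Sch_topology_def by blast
  qed
  moreover have "M.mtotally_bounded (Sch G K)"
    unfolding M.mtotally_bounded_def
  proof (intro allI impI)
    fix \<epsilon> :: real assume "\<epsilon> > 0"
    then obtain r where r: "\<And>x y. x \<in> Sch G K \<Longrightarrow> y \<in> Sch G K \<Longrightarrow> agr r x y \<Longrightarrow> sch_dist G Q x y < \<epsilon>"
      using ex_agr_imp_dist_less[OF \<open>\<epsilon> > 0\<close>] by blast
    obtain R where R: "finite R" "R \<subseteq> Sch G K" "\<And>x. x \<in> Sch G K \<Longrightarrow> \<exists>y\<in>R. agr r x y"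
      using finitely_many_agr_classes[OF assms] by metis
    have "Sch G K \<subseteq> (\<Union>x\<in>R. M.mball x \<epsilon>)"
    proof
      fix x assume x: "x \<in> Sch G K"
      then obtain y where "y \<in> R" "agr r x y" using R(3) by blast
      then show "x \<in> (\<Union>x\<in>R. M.mball x \<epsilon>)"
        using r[of y x] agr_sym x R(2) by (intro UN_I[of y]) auto
    qed
    then show "\<exists>R. finite R \<and> R \<subseteq> Sch G K \<and> Sch G K \<subseteq> (\<Union>x\<in>R. M.mball x \<epsilon>)"
      using R by blast
  qed
  ultimately show ?thesis
    by (simp add: Sch_topology_def M.compact_space_eq_mcomplete_mtotally_bounded)
qed

text \<open>Membership of a fixed \<open>g\<close> in the subgroup is locally constant, so
  \<open>fst\<close> is continuous and \<open>B_space G K Z\<close> is the preimage of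
  \<open>Z\<close>.\<close>

lemma closedin_B_space:
  assumes Z: "closedin (Sub_topology G) Z"
  shows "closedin (Sch_topology G Q K) (B_space G K Z)"
proof -
  let ?T = "product_topology (\<lambda>_. discrete_topology (UNIV :: bool set)) (carrier G)"
  have "continuous_map (Sch_topology G Q K) ?T ((\<lambda>H. \<lambda>g\<in>carrier G. g \<in> H) \<circ> fst)"
    unfolding continuous_map_componentwise
  proof (intro conjI ballI)
    fix g assume g: "g \<in> carrier G"
    obtain r where r: "\<And>x y. x \<in> Sch G K \<Longrightarrow> y \<in> Sch G K \<Longrightarrow> agr r x y \<Longrightarrow>
      (g \<in> fst x \<longleftrightarrow> g \<in> fst y) \<and> snd x (g <# fst x) = snd y (g <# fst y)"
      using agr_determines_coset[OF g] by metis
    have "openin (Sch_topology G Q K) {x \<in> Sch G K. (g \<in> fst x) \<in> U}" for U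
      unfolding openin_Sch_iff
    proof (intro conjI ballI exI[of _ r] impI)
      fix x y assume "x \<in> {x \<in> Sch G K. (g \<in> fst x) \<in> U}" "y \<in> Sch G K" "agr r x y"
      then show "y \<in> {x \<in> Sch G K. (g \<in> fst x) \<in> U}" using r[of x y] by simp
    qed simp
    then show "continuous_map (Sch_topology G Q K) (discrete_topology UNIV)
        (\<lambda>x. ((\<lambda>H. \<lambda>g\<in>carrier G. g \<in> H) \<circ> fst) x g)"
      using g by (simp add: continuous_map_def)
  qed auto
  then have "continuous_map (Sch_topology G Q K) (Sub_topology G) fst"
    unfolding Sub_topology_def by (rule continuous_map_pullback') (auto simp: Sch_def)
  moreover have "B_space G K Z = {x \<in> topspace (Sch_topology G Q K). fst x \<in> Z}"
    by (auto simp: B_space_def)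
  ultimately show ?thesis by (simp only:) (rule closedin_continuous_map_preimage[OF _ Z])
qed

end

section \<open>Nonrepetitive colorings are local and have no symmetries\<close>

lemma relpow_sym:
  assumes "\<And>u v. (u, v) \<in> R \<Longrightarrow> (v, u) \<in> R" shows "(u, v) \<in> R ^^ n \<Longrightarrow> (v, u) \<in> R ^^ n"
proof (induction n arbitrary: v)
  case (Suc n)
  then obtain w where "(u, w) \<in> R ^^ n" "(w, v) \<in> R" by auto
  then show ?case using Suc.IH assms relpow_Suc_I2 by metis
qed simp

lemma relpow_segment:
  assumes "\<And>i. Suc i < N \<Longrightarrow> (v i, v (Suc i)) \<in> R" "i \<le> j" "j < N"
  shows "(v i, v j) \<in> R ^^ (j - i)"
  unfolding relpow_fun_conv
  using assms by (intro exI[of _ "\<lambda>k. v (i + k)"]) auto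

abbreviation nonrep :: "'v lgraph \<Rightarrow> ('v \<Rightarrow> 'k) \<Rightarrow> bool"
  where "nonrep S c \<equiv> nonrepetitive_on (\<lambda>u v. (u, v) \<in> adj S) (verts S) c"

text \<open>Walking from a point of minimal displacement to its image and on to the image of the image
  gives a path without self-intersections along which the colors repeat.\<close>

lemma (in letter_graph) symmetry_imp_repetitive:
  assumes closed: "\<And>u. u \<in> verts S \<Longrightarrow> \<phi> u \<in> verts S"
    and equiv: "\<And>u l. u \<in> verts S \<Longrightarrow> l \<in> letters n \<Longrightarrow> \<phi> (a l u) = a l (\<phi> u)"
    and color: "\<And>u. u \<in> verts S \<Longrightarrow> c (\<phi> u) = c u"
    and free: "\<And>u. u \<in> verts S \<Longrightarrow> \<phi> u \<noteq> u"
    and x: "x \<in> verts S" "(x, \<phi> x) \<in> adj S ^^ k0"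
  shows "\<not> nonrep S c"
proof -
  define P where "P k \<longleftrightarrow> (\<exists>u\<in>verts S. (u, \<phi> u) \<in> adj S ^^ k)" for k
  define k where "k = (LEAST k. P k)"
  have "P k0" using x by (auto simp: P_def)
  then have "P k" unfolding k_def by (rule LeastI)
  have minimal: "\<not> P j" if "j < k" for j using that not_less_Least unfolding k_def by blast
  obtain u where u: "u \<in> verts S" "(u, \<phi> u) \<in> adj S ^^ k" using \<open>P k\<close> by (auto simp: P_def)
  have "k > 0" using u free[OF u(1)] by (cases k) auto
  obtain f where f: "f 0 = u" "f k = \<phi> u" "\<And>i. i < k \<Longrightarrow> (f i, f (Suc i)) \<in> adj S"
    using u(2) unfolding relpow_fun_conv by blast
  have fv: "f i \<in> verts S" if "i < k" for i using f(3)[OF that] by (simp add: adj_iff)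
  have adj_\<phi>: "(\<phi> v, \<phi> w) \<in> adj S" if "(v, w) \<in> adj S" for v w
    using that closed equiv by (auto simp: adj_iff)
  \<comment> \<open>The walk from \<open>u\<close> to \<open>\<phi> u\<close> followed by its image,
    2k vertices in all; the end point \<open>\<phi> (\<phi> u)\<close> is left out, so both halves
    have k vertices.\<close>
  define v where "v i = (if i < k then f i else \<phi> (f (i - k)))" for i
  have vv: "v i \<in> verts S" if "i < 2 * k" for i
    using that fv closed by (simp add: v_def)
  have v\<phi>: "v (i + k) = \<phi> (v i)" if "i < k" for i using that by (simp add: v_def)
  have step: "(v i, v (Suc i)) \<in> adj S" if i: "Suc i < 2 * k" for i
  proof (cases "Suc i < k")
    case True
    then show ?thesis using f(3) by (simp add: v_def)
  next
    case False
    show ?thesis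
    proof (cases "Suc i = k")
      case True
      then have "f (Suc i) = \<phi> (f 0)" using f by simp
      then show ?thesis using f(3)[of i] True by (simp add: v_def)
    next
      case neq: False
      then have "(f (i - k), f (Suc (i - k))) \<in> adj S" using f(3) i False by simp
      then have "(\<phi> (f (i - k)), \<phi> (f (Suc (i - k)))) \<in> adj S" by (rule adj_\<phi>)
      then show ?thesis using False neq by (simp add: v_def Suc_diff_le)
    qed
  qed
  have seg: "(v i, v j) \<in> adj S ^^ (j - i)" if "i \<le> j" "j < 2 * k" for i j
    using step that by (rule relpow_segment)
  have ne: "v i \<noteq> v j" if ij: "i < j" "j < 2 * k" for i j
  proof
    assume eq: "v i = v j"
    \<comment> \<open>A coincidence brings some vertex closer than k to its image:
      \<open>v i\<close> in the first case, \<open>v (j - k)\<close> in the other two. The number of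
      steps is i + k - j in the first and third case and j - k - i in the second.\<close>
    consider "i < k" "j \<le> i + k" | "i < k" "j > i + k" | "i \<ge> k" by linarith
    then have "\<exists>t<k. P t"
    proof cases
      case 1
      then have "(v j, v (i + k)) \<in> adj S ^^ (i + k - j)" by (intro seg) auto
      then have "P (i + k - j)" unfolding P_def using eq v\<phi>[OF 1(1)] vv[of i] ij by auto
      then show ?thesis using ij 1 by (intro exI[of _ "i + k - j"]) auto
    next
      case 2
      then have "(v i, v (j - k)) \<in> adj S ^^ (j - k - i)" using ij by (intro seg) auto
      then have "(v (j - k), v i) \<in> adj S ^^ (j - k - i)" using adj_sym by (rule relpow_sym[rotated])
      moreover have "v i = \<phi> (v (j - k))" using eq v\<phi>[of "j - k"] 2 ij by simp
      ultimately have "P (j - k - i)" unfolding P_def using vv[of "j - k"] ij by auto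
      then show ?thesis using ij 2 by (intro exI[of _ "j - k - i"]) auto
    next
      case 3
      define i' j' where "i' = i - k" and "j' = j - k"
      have i': "i = i' + k" "j = j' + k" "i' < j'" "j' < k" using 3 ij by (auto simp: i'_def j'_def)
      have "\<phi> (v j') = v (i' + k)" using eq v\<phi>[of j'] i' by simp
      moreover have "(v j', v (i' + k)) \<in> adj S ^^ (i' + k - j')" using i' by (intro seg) auto
      ultimately have "P (i' + k - j')" unfolding P_def using vv[of j'] i'
        by (intro bexI[of _ "v j'"]) simp_all
      then show ?thesis using i' by (intro exI[of _ "i' + k - j'"]) auto
    qed
    then show False using minimal by blast
  qed
  let ?ys = "map v [0..<k]" and ?zs = "map v [k..<2 * k]"
  have app: "?ys @ ?zs = map v [0..<2 * k]"
    by (metis le_add1 map_append mult_2 upt_add_eq_append zero_le)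
  have "inj_on v {..<2 * k}"
    by (rule linorder_inj_onI) (use ne in auto)
  then have "distinct (?ys @ ?zs)" unfolding app by (simp add: distinct_map lessThan_atLeast0)
  moreover have "successively (\<lambda>u v. (u, v) \<in> adj S) (?ys @ ?zs)"
    unfolding app successively_conv_nth using step by simp
  moreover have "map c ?ys = map c ?zs"
  proof (rule nth_equalityI)
    fix i assume i: "i < length (map c ?ys)"
    then have "c (v (i + k)) = c (v i)" using v\<phi>[of i] color[OF vv[of i]] by simp
    then show "map c ?ys ! i = map c ?zs ! i" using i by (simp add: add.commute)
  qed simp
  ultimately have "repetitive (\<lambda>u v. (u, v) \<in> adj S) c ?ys ?zs"
    using \<open>k > 0\<close> by (simp add: repetitive_def)
  moreover have "set (?ys @ ?zs) \<subseteq> verts S" unfolding app using vv by auto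
  ultimately show ?thesis unfolding nonrepetitive_on_def by blast
qed

text \<open>A repetition has finitely many vertices, each the end of a word; the longest of these
  words, plus one letter for adjacency, gives the radius. The type of \<open>S'\<close> is free:
  with coset graphs the lemma shows that repetitive colorings form an open set, with other graphs it
  controls limits of their colorings.\<close>

lemma (in letter_graph) repetition_is_local:
  assumes x: "x \<in> verts S" and conn: "\<And>v. v \<in> verts S \<Longrightarrow> \<exists>w. set w \<subseteq> letters n \<and> foldr a w x = v"
    and rep: "\<not> nonrep S c"
  shows "\<exists>r. \<forall>S' a' x' c'. letter_graph n S' a' \<longrightarrow> x' \<in> verts (S' :: 'w lgraph) \<longrightarrow>
    agree n r (trace a c x) (trace a' c' x') \<longrightarrow> \<not> nonrep S' c'"
proof -
  obtain ys zs where yz: "set (ys @ zs) \<subseteq> verts S" "repetitive (\<lambda>u v. (u, v) \<in> adj S) c ys zs"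
    using rep by (auto simp: nonrepetitive_on_def)
  obtain W where W: "\<And>v. v \<in> verts S \<Longrightarrow> set (W v) \<subseteq> letters n \<and> foldr a (W v) x = v"
    using conn by metis
  define r where "r = Max (insert 0 ((\<lambda>v. length (W v)) ` set (ys @ zs)))"
  have Wr: "W v \<in> words n r" if "v \<in> set (ys @ zs)" for v
    using W[of v] that yz(1) unfolding r_def words_def by (auto intro!: Max_ge)
  have map_W: "map (\<lambda>w. foldr a w x) (map W us) = us" if "set us \<subseteq> set (ys @ zs)" for us
  proof -
    have "foldr a (W v) x = v" if "v \<in> set us" for v
      using W[of v] that \<open>set us \<subseteq> set (ys @ zs)\<close> yz(1) by blast
    then show ?thesis by (simp add: map_idI)
  qed
  have "\<not> nonrep S' c'"
    if S': "letter_graph n S' a'" "x' \<in> verts S'" "agree n (Suc r) (trace a c x) (trace a' c' x')"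
    for S' :: "'w lgraph" and a' x' c'
  proof -
    have "repetitive (\<lambda>u v. (u, v) \<in> adj S') c'
      (map (\<lambda>w. foldr a' w x') (map W ys)) (map (\<lambda>w. foldr a' w x') (map W zs))"
      by (rule repetitive_transfer[OF letter_graph_axioms S'(1) x S'(2,3)])
         (use Wr map_W yz(2) in auto)
    moreover have "foldr a' (W v) x' \<in> verts S'" if "v \<in> set (ys @ zs)" for v
      using Wr[OF that] letter_graph.walk_closed[OF S'(1,2)] by (simp add: words_def)
    then have "set (map (\<lambda>w. foldr a' w x') (map W ys) @ map (\<lambda>w. foldr a' w x') (map W zs)) \<subseteq> verts S'"
      by auto
    ultimately show ?thesis unfolding nonrepetitive_on_def by blast
  qed
  then show ?thesis by blast
qed

section \<open>The nonrepetitive subshift\<close>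

lemma (in group) group_action_act_on:
  assumes closed: "\<And>g y. g \<in> carrier G \<Longrightarrow> y \<in> Y \<Longrightarrow> \<alpha> g y \<in> Y"
    and one: "\<And>y. y \<in> Y \<Longrightarrow> \<alpha> \<one> y = y"
    and mult: "\<And>g h y. g \<in> carrier G \<Longrightarrow> h \<in> carrier G \<Longrightarrow> y \<in> Y \<Longrightarrow> \<alpha> (g \<otimes> h) y = \<alpha> g (\<alpha> h y)"
  shows "group_action G Y (act_on Y \<alpha>)"
proof -
  have bij: "act_on Y \<alpha> g \<in> Bij Y" if g: "g \<in> carrier G" for g
  proof -
    have "\<alpha> (inv g) (\<alpha> g y) = y" "\<alpha> g (\<alpha> (inv g) y) = y" if "y \<in> Y" for y
      using mult[of "inv g" g y] mult[of g "inv g" y] one that g by auto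
    then have "bij_betw (\<alpha> g) Y Y"
      using closed g by (intro bij_betwI[of _ _ _ "\<alpha> (inv g)"]) auto
    then show ?thesis by (simp add: Bij_def act_on_def cong: bij_betw_cong)
  qed
  have "act_on Y \<alpha> \<in> hom G (BijGroup Y)"
  proof (rule homI)
    show "act_on Y \<alpha> g \<in> carrier (BijGroup Y)" if "g \<in> carrier G" for g
      using bij[OF that] by (simp add: BijGroup_def)
    fix g h assume gh: "g \<in> carrier G" "h \<in> carrier G"
    have "act_on Y \<alpha> (g \<otimes> h) = compose Y (act_on Y \<alpha> g) (act_on Y \<alpha> h)"
      using gh mult closed by (auto simp: act_on_def compose_def fun_eq_iff)
    then show "act_on Y \<alpha> (g \<otimes> h) = act_on Y \<alpha> g \<otimes>\<^bsub>BijGroup Y\<^esub> act_on Y \<alpha> h"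
      using bij gh by (simp add: BijGroup_def)
  qed
  then show ?thesis
    by (intro group_action.intro group_hom.intro group_hom_axioms.intro group_axioms group_BijGroup)
qed

context generated_group
begin

definition nonrepetitive_subshift :: "nat set \<Rightarrow> 'a set set \<Rightarrow> 'a colored_schreier set"
  where "nonrepetitive_subshift K Z =
    {y \<in> B_space G K Z. nonrep (schreier_graph G Q (fst y)) (snd y)}"

lemma connected:
  assumes H: "subgroup H G" and v: "v \<in> verts (schreier_graph G Q H)"
  shows "\<exists>w. set w \<subseteq> letters (length Q) \<and> foldr act w H = v"
proof -
  obtain g where g: "g \<in> carrier G" "v = g <# H" using v by (auto elim: lcosetsE)
  then show ?thesis using ex_word[OF g(1)] walk_eq[OF _ subgroup.subset[OF H]] by auto
qed

lemma schreier_repetition_is_local: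
  assumes H: "subgroup H G" and "\<not> nonrep (schreier_graph G Q H) c"
  shows "\<exists>r. \<forall>S' a' x' c'. letter_graph (length Q) S' a' \<longrightarrow> x' \<in> verts (S' :: 'w lgraph) \<longrightarrow>
    agree (length Q) r (trace act c H) (trace a' c' x') \<longrightarrow> \<not> nonrep S' c'"
  by (rule letter_graph.repetition_is_local[OF letter_graph[OF H] root_in_schreier_graph[OF H]
      connected[OF H] assms(2)])

lemma subshift_subset_Sch: "nonrepetitive_subshift K Z \<subseteq> Sch G K"
  by (auto simp: nonrepetitive_subshift_def B_space_def)

lemma closedin_nonrepetitive_subshift:
  assumes Z: "closedin (Sub_topology G) Z"
  shows "closedin (Sch_topology G Q K) (nonrepetitive_subshift K Z)"
proof -
  let ?R = "{y \<in> Sch G K. \<not> nonrep (schreier_graph G Q (fst y)) (snd y)}"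
  have "openin (Sch_topology G Q K) ?R"
    unfolding openin_Sch_iff
  proof (intro conjI ballI)
    fix y assume "y \<in> ?R"
    then have y: "y \<in> Sch G K" "\<not> nonrep (schreier_graph G Q (fst y)) (snd y)" by auto
    obtain r where r: "\<forall>S' a' x' c'. letter_graph (length Q) S' a' \<longrightarrow> x' \<in> verts (S' :: 'a set lgraph) \<longrightarrow>
      agree (length Q) r (trace act (snd y) (fst y)) (trace a' c' x') \<longrightarrow> \<not> nonrep S' c'"
      using schreier_repetition_is_local[where 'w = "'a set", OF SchD(1)[OF y(1)] y(2)]
      by blast
    have "z \<in> ?R" if z: "z \<in> Sch G K" and "agr r y z" for z
      using r[rule_format, OF letter_graph[OF SchD(1)[OF z]] root_in_schreier_graph[OF SchD(1)[OF z]]] that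
      unfolding agr_def by blast
    then show "\<exists>r. \<forall>z\<in>Sch G K. agr r y z \<longrightarrow> z \<in> ?R" by blast
  qed auto
  then have "closedin (Sch_topology G Q K) (B_space G K Z - ?R)"
    using closedin_B_space[OF Z] by (intro closedin_diff)
  also have "B_space G K Z - ?R = nonrepetitive_subshift K Z"
    by (auto simp: nonrepetitive_subshift_def B_space_def)
  finally show ?thesis .
qed

text \<open>Letters act on cosets from the left and so commute with right translation by
  \<open>g\<close>, which carries the cosets of the conjugate subgroup to those of
  \<open>H\<close>.\<close>

lemma walk_change_root:
  assumes H: "H \<subseteq> carrier G" and g: "g \<in> carrier G" and w: "set w \<subseteq> letters (length Q)"
  shows "foldr act w (conj_sub G g H) #> g = foldr act w (g <# H)"
  using assms wval_closed[OF w]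
  by (simp add: walk_eq conj_sub_subset l_coset_subset_G lcos_conj_sub lcos_m_assoc)

text \<open>Re-rooting only moves the base point of the trace to gH. This is how facts pass between
  \<open>change_root\<close> and walks in the unchanged graph.\<close>

lemma agree_change_root:
  assumes H: "subgroup H G" and g: "g \<in> carrier G"
  shows "agree (length Q) r (trace act (snd (change_root G g (H, c))) (fst (change_root G g (H, c))))
    (trace act c (g <# H))"
  unfolding agree_def
proof (intro ballI)
  fix w w' assume "w \<in> words (length Q) r" "w' \<in> words (length Q) r"
  then have w: "set w \<subseteq> letters (length Q)" "set w' \<subseteq> letters (length Q)" by (auto simp: words_def)
  let ?H = "conj_sub G g H"
  have Hs: "H \<subseteq> carrier G" by (rule subgroup.subset[OF H])
  have mem: "foldr act u ?H \<in> lcosets ?H" if "set u \<subseteq> letters (length Q)" for u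
    using that Hs g by (simp add: walk_eq conj_sub_subset lcosetsI wval_closed)
  have "inj_on (\<lambda>X. X #> g) (lcosets ?H)"
    using bij_betw_lcosets_conj_sub[OF Hs g] by (rule bij_betw_imp_inj_on)
  then have "foldr act w ?H = foldr act w' ?H \<longleftrightarrow> foldr act w ?H #> g = foldr act w' ?H #> g"
    using inj_on_eq_iff[of "\<lambda>X. X #> g" "lcosets ?H", OF _ mem[OF w(1)] mem[OF w(2)]] by simp
  then show "trace act (snd (change_root G g (H, c))) (fst (change_root G g (H, c))) w w' =
    trace act c (g <# H) w w'"
    using mem w walk_change_root[OF Hs g] by (simp add: change_root_def trace_def)
qed

text \<open>For \<open>g\<close> in \<open>H\<close> right translation fixes every coset: (aH)g =
  agH = aH. The stabilizer thus contains \<open>H\<close> for every coloring, and only the converse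
  calls for nonrepetitivity.\<close>

lemma change_root_fixes: "(H, c) \<in> Sch G K \<Longrightarrow> g \<in> H \<Longrightarrow> change_root G g (H, c) = (H, c)"
proof -
  assume y: "(H, c) \<in> Sch G K" and g: "g \<in> H"
  have H: "subgroup H G" "H \<subseteq> carrier G" and c: "c \<in> lcosets H \<rightarrow>\<^sub>E K"
    using y subgroup.subset by (auto simp: Sch_def)
  have gc: "g \<in> carrier G" using g H by auto
  have "g <# H = H" using lcos_eq_self_iff[OF H(1) gc] g by simp
  moreover have "H #> inv g = H" using H g by (intro coset_join2) (auto simp: subgroup.m_inv_closed)
  ultimately have conj: "conj_sub G g H = H" by (simp add: conj_sub_def)
  have "X #> g = X" if X: "X \<in> lcosets H" for X
  proof -
    obtain a where a: "a \<in> carrier G" "X = a <# H" using X by (rule lcosetsE)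
    then have "X #> g = (a \<otimes> g) <# H" using lcos_conj_sub[OF H(2) a(1) gc] conj by simp
    also have "\<dots> = X" using a gc H \<open>g <# H = H\<close> by (simp flip: lcos_m_assoc)
    finally show ?thesis .
  qed
  then show ?thesis using c by (auto simp: change_root_def conj PiE_iff extensional_def fun_eq_iff)
qed

lemma change_root_mult:
  assumes y: "(H, c) \<in> Sch G K" and g: "g \<in> carrier G" and h: "h \<in> carrier G"
  shows "change_root G (g \<otimes> h) (H, c) = change_root G g (change_root G h (H, c))"
proof -
  have Hs: "H \<subseteq> carrier G" using y subgroup.subset by (auto simp: Sch_def)
  have conj: "conj_sub G (g \<otimes> h) H = conj_sub G g (conj_sub G h H)"
    using Hs g h
    by (simp add: conj_sub_def inv_mult_group lcos_m_assoc coset_mult_assoc coset_assoc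
        l_coset_subset_G r_coset_subset_G flip: lcos_m_assoc coset_mult_assoc)
  let ?H = "conj_sub G h H"
  have hs: "?H \<subseteq> carrier G" by (rule conj_sub_subset[OF Hs h])
  have "X #> g \<in> lcosets ?H" "X #> g #> h = X #> (g \<otimes> h)" if "X \<in> lcosets (conj_sub G g ?H)" for X
    using that bij_betwE[OF bij_betw_lcosets_conj_sub[OF hs g]] g h
      lcosets_subset[OF conj_sub_subset[OF hs g] that] by (auto simp: coset_mult_assoc)
  then show ?thesis by (auto simp: change_root_def conj fun_eq_iff)
qed

section \<open>Invariance of the subshift, stabilizers and properness\<close>

lemma subgroup_if_in_closed: "closedin (Sub_topology G) Z \<Longrightarrow> H \<in> Z \<Longrightarrow> subgroup H G"
  using closedin_subset by (fastforce simp: Sub_topology_def topspace_pullback_topology)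

text \<open>The trace of the re-rooted graph is the trace of the original graph at gH, so by
  locality a repetition in the former would force one in the latter.\<close>

lemma change_root_in_subshift:
  assumes Z: "closedin (Sub_topology G) Z" "\<And>g H. g \<in> carrier G \<Longrightarrow> H \<in> Z \<Longrightarrow> conj_sub G g H \<in> Z"
    and g: "g \<in> carrier G" and y: "y \<in> nonrepetitive_subshift K Z"
  shows "change_root G g y \<in> nonrepetitive_subshift K Z"
proof -
  obtain H c where yH: "y = (H, c)" by (cases y)
  have H: "H \<in> Z" "subgroup H G" "H \<subseteq> carrier G" and c: "c \<in> lcosets H \<rightarrow>\<^sub>E K"
    and nr: "nonrep (schreier_graph G Q H) c"
    using y subgroup.subset by (auto simp: yH nonrepetitive_subshift_def B_space_def Sch_def)
  obtain H' c' where y': "change_root G g y = (H', c')" by (cases "change_root G g y")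
  have H': "H' = conj_sub G g H" "c' = (\<lambda>X\<in>lcosets H'. c (X #> g))"
    using y' by (auto simp: yH change_root_def)
  have "H' \<in> Z" using Z(2) g H by (simp add: H')
  then have sub: "subgroup H' G" using subgroup_if_in_closed Z(1) by blast
  have "c' \<in> lcosets H' \<rightarrow>\<^sub>E K"
    using c bij_betwE[OF bij_betw_lcosets_conj_sub[OF H(3) g]] by (auto simp: H')
  moreover have "nonrep (schreier_graph G Q H') c'"
  proof (rule ccontr)
    assume rep: "\<not> nonrep (schreier_graph G Q H') c'"
    obtain r where r: "\<forall>S' a' x' c''. letter_graph (length Q) S' a' \<longrightarrow> x' \<in> verts (S' :: 'a set lgraph) \<longrightarrow>
      agree (length Q) r (trace act c' H') (trace a' c'' x') \<longrightarrow> \<not> nonrep S' c''"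
      using schreier_repetition_is_local[where 'w = "'a set", OF sub rep] by blast
    have "agree (length Q) r (trace act c' H') (trace act c (g <# H))"
      using agree_change_root[OF H(2) g, of r c] y' by (simp add: yH)
    then show False using r[rule_format, OF letter_graph[OF H(2)], of "g <# H"] lcosetsI[OF g, of H] nr by simp
  qed
  ultimately show ?thesis
    using \<open>H' \<in> Z\<close> sub by (simp add: y' nonrepetitive_subshift_def B_space_def Sch_def)
qed

lemma change_root_fixed_iff:
  assumes y: "y \<in> nonrepetitive_subshift K Z" and g: "g \<in> carrier G"
  shows "change_root G g y = y \<longleftrightarrow> g \<in> fst y"
proof
  assume "g \<in> fst y"
  then show "change_root G g y = y"
    using change_root_fixes[of "fst y" "snd y" K g] y subshift_subset_Sch by auto
next
  assume fix_y: "change_root G g y = y"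
  obtain H c where yH: "y = (H, c)" by (cases y)
  have H: "subgroup H G" "H \<subseteq> carrier G" and nr: "nonrep (schreier_graph G Q H) c"
    using y subgroup.subset by (auto simp: yH nonrepetitive_subshift_def B_space_def Sch_def)
  have conj: "conj_sub G g H = H" and c: "c = (\<lambda>X\<in>lcosets H. c (X #> g))"
    using fix_y by (auto simp: yH change_root_def)
  interpret letter_graph "length Q" "schreier_graph G Q H" act by (rule letter_graph[OF H(1)])
  show "g \<in> fst y"
  proof (rule ccontr)
    assume "g \<notin> fst y"
    then have gH: "g \<notin> H" by (simp add: yH)
    have shift: "(a <# H) #> g = (a \<otimes> g) <# H" if "a \<in> carrier G" for a
      using lcos_conj_sub[OF H(2) that g] conj by simp
    have root: "H \<in> verts (schreier_graph G Q H)" by (rule root_in_schreier_graph[OF H(1)])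
    \<comment> \<open>Connectedness gives the root a finite displacement, so that a least
      displacement exists.\<close>
    have "H #> g = g <# H" using shift[of \<one>] g H by (simp add: lcos_mult_one)
    moreover obtain w where "set w \<subseteq> letters (length Q)" "foldr act w H = g <# H"
      using connected[OF H(1), of "g <# H"] lcosetsI[OF g] by auto
    ultimately have path: "(H, H #> g) \<in> adj (schreier_graph G Q H) ^^ length w"
      unfolding relpow_adj_iff[OF root] by metis
    have "\<not> nonrep (schreier_graph G Q H) c"
    proof (rule symmetry_imp_repetitive[where \<phi> = "\<lambda>X. X #> g", OF _ _ _ _ root path])
      fix X assume X: "X \<in> verts (schreier_graph G Q H)"
      then obtain a where a: "a \<in> carrier G" "X = a <# H" by (auto elim: lcosetsE)
      show "X #> g \<in> verts (schreier_graph G Q H)" using a g by (simp add: shift lcosetsI)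
      show "c (X #> g) = c X" using X fun_cong[OF c, of X] by simp
      have "inv a \<otimes> (a \<otimes> g) \<notin> H" using a g gH by (simp flip: m_assoc)
      then show "X #> g \<noteq> X" using lcos_eq_iff[OF H(1) a(1), of "a \<otimes> g"] a g by (simp add: shift)
      show "act l X #> g = act l (X #> g)" if "l \<in> letters (length Q)" for l
        using a g H lval_closed[OF that] by (simp add: act_eq coset_assoc l_coset_subset_G)
    qed
    then show False using nr by blast
  qed
qed

lemma openin_sub_iff:
  assumes "Y \<subseteq> Sch G K"
  shows "openin (subtopology (Sch_topology G Q K) Y) U \<longleftrightarrow>
    U \<subseteq> Y \<and> (\<forall>x\<in>U. \<exists>r. \<forall>y\<in>Y. agr r x y \<longrightarrow> y \<in> U)"
proof
  assume "openin (subtopology (Sch_topology G Q K) Y) U"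
  then obtain V where "openin (Sch_topology G Q K) V" "U = V \<inter> Y" by (auto simp: openin_subtopology)
  then show "U \<subseteq> Y \<and> (\<forall>x\<in>U. \<exists>r. \<forall>y\<in>Y. agr r x y \<longrightarrow> y \<in> U)"
    using assms unfolding openin_Sch_iff by blast
next
  assume U: "U \<subseteq> Y \<and> (\<forall>x\<in>U. \<exists>r. \<forall>y\<in>Y. agr r x y \<longrightarrow> y \<in> U)"
  then obtain r where r: "\<And>x y. x \<in> U \<Longrightarrow> y \<in> Y \<Longrightarrow> agr (r x) x y \<Longrightarrow> y \<in> U" by metis
  let ?V = "\<Union>x\<in>U. {y \<in> Sch G K. agr (r x) x y}"
  have "openin (Sch_topology G Q K) ?V" using U assms by (intro openin_Union) (auto intro!: openin_agr_class)
  moreover have "U = ?V \<inter> Y"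
  proof
    show "U \<subseteq> ?V \<inter> Y" using U assms agr_refl by blast
    show "?V \<inter> Y \<subseteq> U" using r by blast
  qed
  ultimately show "openin (subtopology (Sch_topology G Q K) Y) U" by (auto simp: openin_subtopology)
qed

text \<open>Re-rooting along a word moves the base point letter by letter and costs one unit of
  radius per letter; \<open>s\<close> is the length of a word for \<open>g\<close>. This gives
  continuity of the action.\<close>

lemma change_root_agr:
  assumes g: "g \<in> carrier G"
  obtains s where "\<And>r x y. x \<in> Sch G K \<Longrightarrow> y \<in> Sch G K \<Longrightarrow> agr (r + s) x y \<Longrightarrow>
    agr r (change_root G g x) (change_root G g y)"
proof -
  obtain w where w: "set w \<subseteq> letters (length Q)" "wval w = g" using ex_word[OF g] by blast
  have walk: "agree (length Q) r (trace act c (foldr act u X)) (trace act d (foldr act u X'))"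
    if "agree (length Q) (r + length u) (trace act c X) (trace act d X')" "set u \<subseteq> letters (length Q)"
    for r u c d X X'
    using that
  proof (induction u arbitrary: r)
    case (Cons l u)
    then have "agree (length Q) (Suc r) (trace act c (foldr act u X)) (trace act d (foldr act u X'))"
      by simp
    from agree_trace_step[OF this, of l] Cons.prems(2) show ?case by simp
  qed simp
  have "agr r (change_root G g x) (change_root G g y)"
    if x: "x \<in> Sch G K" and y: "y \<in> Sch G K" and a: "agr (r + length w) x y" for r x y
  proof -
    obtain H c H' c' where eqs: "x = (H, c)" "y = (H', c')" by (metis surj_pair)
    have H: "subgroup H G" "subgroup H' G" using x y by (auto simp: eqs Sch_def)
    have "agree (length Q) r (trace act c (g <# H)) (trace act c' (g <# H'))"
      using walk[OF a[unfolded agr_def eqs fst_conv snd_conv] w(1)] walk_eq[OF w(1)] w(2) H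
      by (simp add: subgroup.subset)
    then show ?thesis
      unfolding agr_def eqs
      using agree_change_root[OF H(1) g, of r c] agree_change_root[OF H(2) g, of r c']
      by (meson agree_sym agree_trans)
  qed
  then show thesis by (rule that)
qed

lemma continuous_change_root:
  assumes Y: "Y \<subseteq> Sch G K" and g: "g \<in> carrier G"
    and closed: "\<And>y. y \<in> Y \<Longrightarrow> change_root G g y \<in> Y"
  shows "continuous_map (subtopology (Sch_topology G Q K) Y) (subtopology (Sch_topology G Q K) Y)
    (act_on Y (change_root G) g)"
proof -
  obtain s where s: "\<And>r x y. x \<in> Sch G K \<Longrightarrow> y \<in> Sch G K \<Longrightarrow> agr (r + s) x y \<Longrightarrow>
    agr r (change_root G g x) (change_root G g y)"
    using change_root_agr[OF g] by blast
  have top: "topspace (subtopology (Sch_topology G Q K) Y) = Y" using Y by auto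
  have "openin (subtopology (Sch_topology G Q K) Y) {y \<in> Y. act_on Y (change_root G) g y \<in> U}"
    if U: "openin (subtopology (Sch_topology G Q K) Y) U" for U
    unfolding openin_sub_iff[OF Y]
  proof (intro conjI ballI)
    fix x assume "x \<in> {y \<in> Y. act_on Y (change_root G) g y \<in> U}"
    then have x: "x \<in> Y" "change_root G g x \<in> U" by (auto simp: act_on_def)
    then obtain r where r: "\<And>z. z \<in> Y \<Longrightarrow> agr r (change_root G g x) z \<Longrightarrow> z \<in> U"
      using U unfolding openin_sub_iff[OF Y] by blast
    have "change_root G g y \<in> U" if "y \<in> Y" "agr (r + s) x y" for y
      using r[OF closed[OF that(1)]] s that x(1) Y by blast
    then show "\<exists>r. \<forall>y\<in>Y. agr r x y \<longrightarrow> y \<in> {y \<in> Y. act_on Y (change_root G) g y \<in> U}"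
      by (intro exI[of _ "r + s"]) (simp add: act_on_def)
  qed auto
  then show ?thesis unfolding continuous_map_def top using closed by (auto simp: act_on_def)
qed

lemma Z_proper_nonrepetitive_subshift:
  assumes Z: "closedin (Sub_topology G) Z" "\<And>g H. g \<in> carrier G \<Longrightarrow> H \<in> Z \<Longrightarrow> conj_sub G g H \<in> Z"
    and K: "finite K"
  defines "Y \<equiv> nonrepetitive_subshift K Z"
  shows "Z_proper G Z (subtopology (Sch_topology G Q K) Y) (act_on Y (change_root G))"
proof -
  let ?X = "subtopology (Sch_topology G Q K) Y" and ?\<alpha> = "act_on Y (change_root G)"
  have Y: "Y \<subseteq> Sch G K" unfolding Y_def by (rule subshift_subset_Sch)
  have top: "topspace ?X = Y" using Y by auto
  have closed: "change_root G g y \<in> Y" if "g \<in> carrier G" "y \<in> Y" for g y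
    using that change_root_in_subshift[OF Z] unfolding Y_def by blast
  have "compact_space ?X"
    using closedin_compact_space[OF compact_Sch[OF K] closedin_nonrepetitive_subshift[OF Z(1)]]
    by (simp add: compact_space_subtopology Y_def)
  moreover have "metrizable_space ?X" by (rule metrizable_space_subtopology[OF metrizable_Sch])
  moreover have "group_action G Y ?\<alpha>"
  proof (rule group_action_act_on)
    fix y assume y: "y \<in> Y"
    then have yS: "(fst y, snd y) \<in> Sch G K" using Y by auto
    show "change_root G \<one> y = y"
      using change_root_fixes[OF yS] subgroup.one_closed[OF SchD(1)[OF yS]] by simp
    show "change_root G (g \<otimes> h) y = change_root G g (change_root G h y)"
      if "g \<in> carrier G" "h \<in> carrier G" for g h
      using change_root_mult[OF yS that] by simp
  qed (rule closed)
  then have "continuous_action G ?X ?\<alpha>"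
    unfolding continuous_action_def top using continuous_change_root[OF Y] closed by blast
  moreover have "stabilizer G ?\<alpha> y \<in> Z \<and> stabilizer G ?\<alpha> y = stabilizer0 G ?X ?\<alpha> y"
    if y: "y \<in> Y" for y
  proof -
    have sub: "subgroup (fst y) G" and yZ: "fst y \<in> Z"
      using y by (auto simp: Y_def nonrepetitive_subshift_def B_space_def Sch_def)
    have fixed: "?\<alpha> g z = z \<longleftrightarrow> g \<in> fst z" if "g \<in> carrier G" "z \<in> Y" for g z
      using change_root_fixed_iff[of z K Z g] that by (simp add: act_on_def Y_def)
    have stab: "stabilizer G ?\<alpha> y = fst y"
      unfolding stabilizer_def using fixed[OF _ y] subgroup.subset[OF sub] by blast
    \<comment> \<open>Stabilizers on all of \<open>Y\<close> are the underlying subgroups, and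
      whether \<open>g\<close> belongs to them is decided in a finite ball. So \<open>g\<close>
      fixes every point close to \<open>y\<close>.\<close>
    have "g \<in> stabilizer0 G ?X ?\<alpha> y" if g: "g \<in> fst y" for g
    proof -
      have gG: "g \<in> carrier G" using g subgroup.subset[OF sub] by blast
      obtain r where r: "\<And>x z. x \<in> Sch G K \<Longrightarrow> z \<in> Sch G K \<Longrightarrow> agr r x z \<Longrightarrow>
        (g \<in> fst x \<longleftrightarrow> g \<in> fst z) \<and> snd x (g <# fst x) = snd z (g <# fst z)"
        using agr_determines_coset[OF gG] by metis
      let ?U = "{z \<in> Y. agr r y z}"
      have "openin ?X ?U" unfolding openin_sub_iff[OF Y] using agr_trans by blast
      moreover have "?\<alpha> g z = z" if "z \<in> ?U" for z
        using that fixed[OF gG] r[of y z] g y Y by auto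
      ultimately show ?thesis using gG y by (auto simp: stabilizer0_def intro!: exI[of _ ?U])
    qed
    moreover have "stabilizer0 G ?X ?\<alpha> y \<subseteq> stabilizer G ?\<alpha> y"
      by (auto simp: stabilizer0_def stabilizer_def)
    ultimately show ?thesis using stab yZ by auto
  qed
  ultimately show ?thesis unfolding Z_proper_def top by blast
qed

end

section \<open>Sofic approximations and invariant measures\<close>

lemma continuous_map_measurable:
  assumes f: "continuous_map X X' f"
    and \<mu>: "space \<mu> = topspace X" "sets \<mu> = sigma_sets (topspace X) {U. openin X U}"
    and \<nu>: "space \<nu> = topspace X'" "sets \<nu> = sigma_sets (topspace X') {U. openin X' U}"
  shows "f \<in> \<mu> \<rightarrow>\<^sub>M \<nu>"
proof (rule measurable_sigma_sets[OF \<nu>(2)])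
  show "{U. openin X' U} \<subseteq> Pow (topspace X')" using openin_subset by fastforce
  show "f \<in> space \<mu> \<rightarrow> topspace X'" using f \<mu>(1) by (auto simp: continuous_map_def)
  fix U assume "U \<in> {U. openin X' U}"
  then have "openin X {x \<in> topspace X. f x \<in> U}"
    using openin_continuous_map_preimage[OF f] by simp
  moreover have "f -` U \<inter> space \<mu> = {x \<in> topspace X. f x \<in> U}" using \<mu>(1) by auto
  ultimately show "f -` U \<inter> space \<mu> \<in> sets \<mu>" unfolding \<mu>(2) by (intro sigma_sets.Basic) simp
qed

text \<open>Equivariance turns \<open>\<beta> g\<close> after \<open>h\<close> into \<open>h\<close>
  after \<open>\<alpha> g\<close>, and invariance absorbs \<open>\<alpha> g\<close>. Serves to carry
  the measure over from colored Schreier graphs to functions on the group.\<close>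

lemma invariant_measure_image:
  assumes \<mu>: "invariant_borel_probability G X \<alpha> \<mu>"
    and h: "continuous_map X X' h"
    and equiv: "\<And>g x. g \<in> carrier G \<Longrightarrow> x \<in> topspace X \<Longrightarrow> \<beta> g (h x) = h (\<alpha> g x)"
    and \<beta>: "\<And>g. g \<in> carrier G \<Longrightarrow> continuous_map X' X' (\<beta> g)"
  shows "\<exists>\<nu>. invariant_borel_probability G X' \<beta> \<nu>"
proof -
  let ?N = "sigma (topspace X') {U. openin X' U}"
  have "{U. openin X' U} \<subseteq> Pow (topspace X')" using openin_subset by fastforce
  then have N: "space ?N = topspace X'" "sets ?N = sigma_sets (topspace X') {U. openin X' U}" by auto
  have X: "space \<mu> = topspace X" "sets \<mu> = sigma_sets (topspace X) {U. openin X U}" "prob_space \<mu>"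
    and inv: "\<And>g. g \<in> carrier G \<Longrightarrow> \<alpha> g \<in> \<mu> \<rightarrow>\<^sub>M \<mu>" "\<And>g. g \<in> carrier G \<Longrightarrow> distr \<mu> \<mu> (\<alpha> g) = \<mu>"
    using \<mu> by (auto simp: invariant_borel_probability_def)
  have hm: "h \<in> \<mu> \<rightarrow>\<^sub>M ?N" by (rule continuous_map_measurable[OF h X(1,2) N])
  have bm: "\<beta> g \<in> ?N \<rightarrow>\<^sub>M ?N" if "g \<in> carrier G" for g
    by (rule continuous_map_measurable[OF \<beta>[OF that] N N])
  let ?\<nu> = "distr \<mu> ?N h"
  have "distr ?\<nu> ?\<nu> (\<beta> g) = ?\<nu>" if g: "g \<in> carrier G" for g
  proof -
    have "distr ?\<nu> ?\<nu> (\<beta> g) = distr ?\<nu> ?N (\<beta> g)" by (rule distr_cong) simp_all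
    also have "\<dots> = distr \<mu> ?N (\<beta> g \<circ> h)" using hm bm[OF g] by (rule distr_distr[rotated])
    also have "\<dots> = distr \<mu> ?N (h \<circ> \<alpha> g)" using equiv[OF g] X(1) by (intro distr_cong) simp_all
    also have "\<dots> = distr (distr \<mu> \<mu> (\<alpha> g)) ?N h" using hm inv(1)[OF g] by (simp add: distr_distr)
    also have "\<dots> = ?\<nu>" using inv(2)[OF g] by simp
    finally show ?thesis .
  qed
  then have "invariant_borel_probability G X' \<beta> ?\<nu>"
    unfolding invariant_borel_probability_def using N bm prob_space.prob_space_distr[OF X(3) hm] by simp
  then show ?thesis by blast
qed

context generated_group
begin

section \<open>From finite graphs to means on clopen sets\<close>

definition strace :: "'a colored_schreier \<Rightarrow> letter list \<Rightarrow> letter list \<Rightarrow> bool \<times> nat"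
  where "strace y = trace act (snd y) (fst y)"

lemma agr_strace: "agr r x y \<longleftrightarrow> agree (length Q) r (strace x) (strace y)"
  by (simp add: agr_def strace_def)

text \<open>The colors of the ball are carried over by \<open>\<phi>\<close>, and everything outside
  gets the default color \<open>k0\<close>. Repetitions may arise there, so the result is only a
  point of \<open>B_space G K Z\<close>.\<close>

lemma ex_coloring_of_Zr_vertex:
  assumes Z: "closedin (Sub_topology G) Z" and K: "K \<noteq> {}"
    and S: "letter_graph (length Q) S b" "p \<in> verts S" and c: "c \<in> verts S \<rightarrow> K"
    and good: "Zr_vertex G Q Z r S p"
  shows "\<exists>y\<in>B_space G K Z. agree (length Q) r (trace b c p) (strace y)"
proof -
  obtain H \<phi> where H: "H \<in> Z" and \<phi>: "is_rooted_iso \<phi> (gball S r p) p (gball (schreier_graph G Q H) r H) H"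
    using good by (auto simp: Zr_vertex_def rooted_isomorphic_def)
  have sub: "subgroup H G" by (rule subgroup_if_in_closed[OF Z H])
  obtain k0 where k0: "k0 \<in> K" using K by blast
  let ?B = "verts (gball S r p)" and ?B' = "verts (gball (schreier_graph G Q H) r H)"
  define d where "d = (\<lambda>X\<in>lcosets H. if X \<in> ?B' then c (inv_into ?B \<phi> X) else k0)"
  have bij: "bij_betw \<phi> ?B ?B'" using \<phi> by (simp add: is_rooted_iso_def)
  have "d X \<in> K" if "X \<in> lcosets H" for X
  proof (cases "X \<in> ?B'")
    case True
    then have "inv_into ?B \<phi> X \<in> ?B" using bij by (metis bij_betw_def inv_into_into)
    then have "inv_into ?B \<phi> X \<in> verts S" by (simp add: verts_gball)
    then show ?thesis using that c True by (simp add: d_def Pi_iff)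
  qed (use that k0 in \<open>simp add: d_def\<close>)
  then have "(H, d) \<in> B_space G K Z" using H sub by (auto simp: B_space_def Sch_def d_def)
  moreover have "agree (length Q) r (trace b c p) (trace act d H)"
  proof (rule agree_if_rooted_iso[OF S(1) letter_graph[OF sub] S(2) root_in_schreier_graph[OF sub] \<phi>])
    fix v assume v: "v \<in> ?B"
    then have "\<phi> v \<in> ?B'" "inv_into ?B \<phi> (\<phi> v) = v" using bij by (auto simp: bij_betw_def)
    then show "d (\<phi> v) = c v" by (simp add: d_def verts_gball)
  qed
  ultimately show ?thesis by (intro bexI[of _ "(H, d)"]) (simp_all add: strace_def)
qed

text \<open>If no radius sufficed, there would be bad vertices for every radius, and the colored
  Schreier graphs matching them up to growing radii would accumulate at some \<open>y\<close>. A
  repetition in \<open>y\<close> would already show in some \<open>S j\<close>, so \<open>y\<close>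
  lies in the subshift and matches a bad vertex.\<close>

lemma nonrepetitive_Zr_vertex_match:
  assumes Z: "closedin (Sub_topology G) Z" and K: "finite K" "K \<noteq> {}"
  shows "\<exists>s\<ge>1. \<forall>S b c p. letter_graph (length Q) S b \<longrightarrow> p \<in> verts (S :: 'w lgraph) \<longrightarrow>
    c \<in> verts S \<rightarrow> K \<longrightarrow> nonrep S c \<longrightarrow> Zr_vertex G Q Z s S p \<longrightarrow>
    (\<exists>y\<in>nonrepetitive_subshift K Z. agree (length Q) r (trace b c p) (strace y))"
proof (rule ccontr)
  assume contra: "\<not> ?thesis"
  let ?n = "length Q"
  let ?bad = "\<lambda>s (S :: 'w lgraph) b c p. letter_graph ?n S b \<and> p \<in> verts S \<and> c \<in> verts S \<rightarrow> K \<and>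
    nonrep S c \<and> Zr_vertex G Q Z s S p \<and>
    \<not> (\<exists>y\<in>nonrepetitive_subshift K Z. agree ?n r (trace b c p) (strace y))"
  \<comment> \<open>The radii start at 1, the range that a sofic approximation controls.\<close>
  have "\<exists>S b c p. ?bad (Suc j) S b c p" for j using contra le_add1[of 1 j] by (metis plus_1_eq_Suc)
  then obtain S b c p where bad: "\<And>j. ?bad (Suc j) (S j) (b j) (c j) (p j)" by metis
  have "\<exists>y\<in>B_space G K Z. agree ?n (Suc j) (trace (b j) (c j) (p j)) (strace y)" for j
    using bad[of j] by (intro ex_coloring_of_Zr_vertex[OF Z K(2), of "S j"]) auto
  then obtain \<sigma> where \<sigma>: "\<And>j. \<sigma> j \<in> B_space G K Z"
    "\<And>j. agree ?n (Suc j) (trace (b j) (c j) (p j)) (strace (\<sigma> j))" by metis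
  have \<sigma>S: "\<sigma> j \<in> Sch G K" for j using \<sigma>(1)[of j] by (auto simp: B_space_def)
  interpret M: Metric_space "Sch G K" "sch_dist G Q" by (rule Metric_space_Sch[OF Q])
  have "compactin M.mtopology (B_space G K Z)"
    using closedin_compact_space[OF compact_Sch[OF K(1)] closedin_B_space[OF Z]]
    by (simp add: Sch_topology_def)
  moreover have "range \<sigma> \<subseteq> B_space G K Z" using \<sigma>(1) by blast
  ultimately obtain y s where y: "y \<in> B_space G K Z" and s: "strict_mono (s :: nat \<Rightarrow> nat)"
    and lim: "limitin M.mtopology (\<sigma> \<circ> s) y sequentially"
    unfolding M.compactin_sequentially by metis
  have "limitin (Sch_topology G Q K) (\<sigma> \<circ> s) y sequentially" using lim by (simp add: Sch_topology_def)
  then have conv: "\<forall>\<^sub>F j in sequentially. agr t y (\<sigma> (s j))" for t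
    using limitin_Sch_iff[of "\<sigma> \<circ> s" K y] \<sigma>S by simp
  have match: "\<exists>j. agree ?n t (trace (b j) (c j) (p j)) (strace y)" for t
  proof -
    obtain N where N: "\<And>j. j \<ge> N \<Longrightarrow> agr t y (\<sigma> (s j))"
      using conv[of t] by (auto simp: eventually_sequentially)
    \<comment> \<open>\<open>max N t\<close> serves two ends: beyond \<open>N\<close> the
      subsequence is close to \<open>y\<close>, and a strictly increasing \<open>s\<close> has s i
      \<ge> i, so that the matching radius \<open>Suc j\<close> is at least
      \<open>t\<close>.\<close>
    define j where "j = s (max N t)"
    have "t \<le> Suc j" using seq_suble[OF s, of "max N t"] by (simp add: j_def)
    then have "agree ?n t (trace (b j) (c j) (p j)) (strace (\<sigma> j))" by (rule agree_mono[OF \<sigma>(2)])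
    moreover have "agree ?n t (strace (\<sigma> j)) (strace y)"
      using N[of "max N t"] agree_sym by (auto simp: j_def agr_strace)
    ultimately show ?thesis using agree_trans by blast
  qed
  have sub: "subgroup (fst y) G" using y by (auto simp: B_space_def Sch_def)
  have "nonrep (schreier_graph G Q (fst y)) (snd y)"
  proof (rule ccontr)
    assume rep: "\<not> nonrep (schreier_graph G Q (fst y)) (snd y)"
    obtain t where t: "\<forall>S' a' x' c'. letter_graph ?n S' a' \<longrightarrow> x' \<in> verts (S' :: 'w lgraph) \<longrightarrow>
      agree ?n t (trace act (snd y) (fst y)) (trace a' c' x') \<longrightarrow> \<not> nonrep S' c'"
      using schreier_repetition_is_local[where 'w = 'w, OF sub rep] by blast
    obtain j where "agree ?n t (trace (b j) (c j) (p j)) (strace y)" using match by blast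
    then have "agree ?n t (trace act (snd y) (fst y)) (trace (b j) (c j) (p j))"
      by (simp add: strace_def agree_sym)
    then show False using t[rule_format, of "S j" "b j" "p j" "c j"] bad[of j] by blast
  qed
  then have "y \<in> nonrepetitive_subshift K Z" using y by (simp add: nonrepetitive_subshift_def)
  then show False using match[of r] bad by blast
qed

text \<open>A clopen set is measured by the mean of the points whose trace matches one of its
  elements, up to a radius that determines the set. \<open>T\<close> moves points by letters only;
  \<open>tr_T\<close> keeps a match when \<open>l\<close> moves \<open>p\<close> and
  \<open>lval l\<close> moves the root of \<open>y\<close>, at the cost of one unit of
  radius.\<close>

lemma ex_invariant_measure:
  fixes m :: "'p set \<Rightarrow> real" and tr :: "'p \<Rightarrow> letter list \<Rightarrow> letter list \<Rightarrow> bool \<times> nat"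
    and T :: "letter \<Rightarrow> 'p \<Rightarrow> 'p"
  assumes Y: "Y \<subseteq> Sch G K" "compact_space (subtopology (Sch_topology G Q K) Y)"
    and closed: "\<And>g y. g \<in> carrier G \<Longrightarrow> y \<in> Y \<Longrightarrow> change_root G g y \<in> Y"
    and mean: "finitely_additive_mean m"
    and full: "\<And>r. m {p. \<exists>y\<in>Y. agree (length Q) r (tr p) (strace y)} = 1"
    and shift: "\<And>l C. l \<in> letters (length Q) \<Longrightarrow> m (T l -` C) = m C"
    and tr_T: "\<And>l r p y. l \<in> letters (length Q) \<Longrightarrow> y \<in> Y \<Longrightarrow>
      agree (length Q) (Suc r) (tr p) (strace y) \<Longrightarrow>
      agree (length Q) r (tr (T l p)) (strace (change_root G (lval l) y))"
  shows "\<exists>\<mu>. invariant_borel_probability G (subtopology (Sch_topology G Q K) Y)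
    (act_on Y (change_root G)) \<mu>"
proof -
  interpret finitely_additive_mean m by (rule mean)
  let ?n = "length Q" and ?X = "subtopology (Sch_topology G Q K) Y" and ?\<alpha> = "act_on Y (change_root G)"
  have top: "topspace ?X = Y" using Y by auto
  \<comment> \<open>\<open>U\<close> is a union of classes of \<open>agr r\<close> within
    \<open>Y\<close>; these are the clopen sets visible at radius \<open>r\<close>.\<close>
  define det where "det r U \<longleftrightarrow> U \<subseteq> Y \<and> (\<forall>x\<in>U. \<forall>y\<in>Y. agr r x y \<longrightarrow> y \<in> U)" for r U
  define M where "M = {U. \<exists>r. det r U}"
  define S where "S r U = {p. \<exists>y\<in>U. agree ?n r (tr p) (strace y)}" for r U
  have agr_if_match: "agr r y z" if "agree ?n r (tr p) (strace y)" "agree ?n r (tr p) (strace z)" for r p y z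
    using that unfolding agr_strace by (meson agree_sym agree_trans)
  have det_mono: "det s U" if "det r U" "r \<le> s" for r s U
    using that agr_mono unfolding det_def by blast
  have S_Y: "m (S r Y) = 1" for r using full by (simp add: S_def)
  have S_mono: "S s U \<subseteq> S r U" if "r \<le> s" for r s U
    using that agree_mono unfolding S_def by blast
  \<comment> \<open>Beyond a determining radius the matching set can only lose points whose ball of
    radius \<open>s\<close> matches nothing in \<open>Y\<close>, and these have mean zero. So the
    radius in the definition of \<open>\<nu>\<close> may be chosen freely.\<close>
  have S_eq: "m (S r U) = m (S s U)" if U: "det r U" and "r \<le> s" for r s U
  proof (rule eq_if_agree_on_full[OF S_Y[of s]])
    have "p \<in> S s U" if p: "p \<in> S r U" "p \<in> S s Y" for p
    proof -
      obtain y z where yz: "y \<in> U" "agree ?n r (tr p) (strace y)" "z \<in> Y" "agree ?n s (tr p) (strace z)"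
        using p by (auto simp: S_def)
      then have "agr r y z" using agr_if_match agree_mono \<open>r \<le> s\<close> by blast
      then have "z \<in> U" using U yz by (auto simp: det_def)
      then show ?thesis using yz by (auto simp: S_def)
    qed
    then show "S r U \<inter> S s Y = S s U \<inter> S s Y" using S_mono[OF \<open>r \<le> s\<close>] by blast
  qed
  define \<nu> where "\<nu> U = m (S (SOME r. det r U) U)" for U
  have \<nu>: "\<nu> U = m (S r U)" if "det r U" for r U
  proof -
    let ?s = "SOME r. det r U"
    have "det ?s U" using that by (rule someI)
    then show ?thesis
      unfolding \<nu>_def using S_eq[of ?s U "max r ?s"] S_eq[OF that, of "max r ?s"] by simp
  qed
  have det_Un: "det r (U \<union> U')" if "det r U" "det r U'" for r U U' using that by (auto simp: det_def)
  have det_Diff: "det r (Y - U)" if "det r U" for r U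
    using that agr_sym unfolding det_def by blast
  have common: "\<exists>r. det r U \<and> det r U'" if UU: "U \<in> M" "U' \<in> M" for U U'
  proof -
    obtain r r' where "det r U" "det r' U'" using UU by (auto simp: M_def)
    then have "det (max r r') U" "det (max r r') U'" using det_mono by auto
    then show ?thesis by blast
  qed
  have det_Y: "det 0 Y" by (simp add: det_def)
  have alg: "algebra Y M"
    unfolding algebra_iff_Un
  proof (intro conjI ballI)
    show "M \<subseteq> Pow Y" by (auto simp: M_def det_def)
    show "{} \<in> M" by (auto simp: M_def det_def)
    show "Y - U \<in> M" if "U \<in> M" for U using that det_Diff by (auto simp: M_def)
    show "U \<union> U' \<in> M" if "U \<in> M" "U' \<in> M" for U U'
      using common[OF that] det_Un by (auto simp: M_def)
  qed
  have open_M: "openin ?X U" if "U \<in> M" for U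
    using that unfolding openin_sub_iff[OF Y(1)] M_def det_def by blast
  have closed_M: "closedin ?X U" if "U \<in> M" for U
  proof -
    have "Y - U \<in> M" using that det_Diff by (auto simp: M_def)
    then show ?thesis using open_M that unfolding closedin_def top by (auto simp: M_def det_def)
  qed
  have \<nu>_add: "\<nu> (U \<union> U') = \<nu> U + \<nu> U'" if UU: "U \<in> M" "U' \<in> M" and disj: "U \<inter> U' = {}" for U U'
  proof -
    obtain r where r: "det r U" "det r U'" using common[OF UU] by blast
    have "S r (U \<union> U') = S r U \<union> S r U'" by (auto simp: S_def)
    moreover have "S r U \<inter> S r U' = {}"
    proof (rule equals0I)
      fix p assume "p \<in> S r U \<inter> S r U'"
      then obtain y z where "y \<in> U" "z \<in> U'" "agr r y z" using agr_if_match by (auto simp: S_def)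
      then have "z \<in> U" using r unfolding det_def by blast
      then show False using \<open>z \<in> U'\<close> disj by blast
    qed
    ultimately show ?thesis using \<nu>[OF r(1)] \<nu>[OF r(2)] \<nu>[OF det_Un[OF r]] additive by simp
  qed
  have \<nu>_nonneg: "\<nu> U \<ge> 0" for U by (simp add: \<nu>_def nonneg)
  obtain \<mu> where \<mu>: "space \<mu> = Y" "sets \<mu> = sigma_sets Y M"
    "\<forall>U\<in>M. emeasure \<mu> U = ennreal (\<nu> U)"
    using clopen_mean_extends_to_measure[OF Y(2), unfolded top, OF alg closed_M \<nu>_nonneg \<nu>_add] by blast
  have sets: "sets \<mu> = sigma_sets Y {U. openin ?X U}"
    unfolding \<mu>(2)
  proof (rule sigma_sets_eqI)
    show "U \<in> sigma_sets Y {U. openin ?X U}" if "U \<in> M" for U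
      using open_M[OF that] by (intro sigma_sets.Basic) simp
    fix U assume "U \<in> {U. openin ?X U}"
    then have U: "U \<subseteq> Y" "\<And>x. x \<in> U \<Longrightarrow> \<exists>r. \<forall>y\<in>Y. agr r x y \<longrightarrow> y \<in> U"
      unfolding openin_sub_iff[OF Y(1)] by auto
    \<comment> \<open>The points of \<open>Y\<close> whose whole class at radius \<open>r\<close>
      lies in \<open>U\<close>. An open set is the countable union of these, so the clopen sets
      generate the Borel sets.\<close>
    let ?V = "\<lambda>r. {y \<in> Y. \<forall>z\<in>Y. agr r y z \<longrightarrow> z \<in> U}"
    have "det r (?V r)" for r unfolding det_def using agr_trans by blast
    then have "(\<Union>r. ?V r) \<in> sigma_sets Y M"
      by (intro sigma_sets.Union sigma_sets.Basic) (auto simp: M_def)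
    moreover have "U = (\<Union>r. ?V r)"
    proof
      show "U \<subseteq> (\<Union>r. ?V r)" using U by blast
      show "(\<Union>r. ?V r) \<subseteq> U" using agr_refl by blast
    qed
    ultimately show "U \<in> sigma_sets Y M" by simp
  qed
  have prob: "prob_space \<mu>"
  proof
    have "Y \<in> M" using det_Y by (auto simp: M_def)
    then show "emeasure \<mu> (space \<mu>) = 1" using \<mu>(1,3) \<nu>[OF det_Y] S_Y by simp
  qed
  have meas: "?\<alpha> g \<in> \<mu> \<rightarrow>\<^sub>M \<mu>" if g: "g \<in> carrier G" for g
  proof -
    have "continuous_map ?X ?X (?\<alpha> g)"
      by (rule continuous_change_root[OF Y(1) g closed[OF g]])
    from continuous_map_measurable[OF this, unfolded top, OF \<mu>(1) sets \<mu>(1) sets]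
    show ?thesis .
  qed
  have letter_invariant: "distr \<mu> \<mu> (?\<alpha> (lval l)) = \<mu>" if l: "l \<in> letters ?n" for l
  proof (rule measure_eqI_generator_eq[where \<Omega> = Y and E = M and A = "\<lambda>_. Y"])
    have g: "lval l \<in> carrier G" by (rule lval_closed[OF l])
    show "Int_stable M" using alg by (simp add: Int_stable_def algebra_iff_Int)
    show "M \<subseteq> Pow Y" by (auto simp: M_def det_def)
    show "sets (distr \<mu> \<mu> (?\<alpha> (lval l))) = sigma_sets Y M" "sets \<mu> = sigma_sets Y M"
      by (simp_all add: \<mu>(2))
    show "range (\<lambda>_::nat. Y) \<subseteq> M" "(\<Union>i::nat. Y) = Y" using det_Y by (auto simp: M_def)
    show "emeasure (distr \<mu> \<mu> (?\<alpha> (lval l))) Y \<noteq> \<infinity>"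
      using prob meas[OF g] by (metis finite_measure.emeasure_finite prob_space.finite_measure prob_space.prob_space_distr infinity_ennreal_def)
    fix U assume U: "U \<in> M"
    then obtain r where r: "det r U" by (auto simp: M_def)
    obtain s where s: "\<And>r x y. x \<in> Sch G K \<Longrightarrow> y \<in> Sch G K \<Longrightarrow> agr (r + s) x y \<Longrightarrow>
      agr r (change_root G (lval l) x) (change_root G (lval l) y)"
      using change_root_agr[OF g] by blast
    \<comment> \<open>Radius \<open>r + s\<close> determines the preimage \<open>V\<close>, and
      \<open>tr_T\<close> consumes \<open>Suc r\<close>; \<open>t\<close> dominates both.\<close>
    define t where "t = Suc (r + s)"
    define V where "V = {y \<in> Y. change_root G (lval l) y \<in> U}"
    have "det (r + s) V"
      using r s Y(1) closed[OF g] unfolding det_def V_def by blast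
    then have dV: "det t V" by (rule det_mono) (simp add: t_def)
    have T: "agree ?n r (tr (T l p)) (strace (change_root G (lval l) y))"
      if "y \<in> Y" "agree ?n t (tr p) (strace y)" for p y
      using that tr_T[OF l] agree_mono[of ?n t "tr p" "strace y" "Suc r"] by (simp add: t_def)
    \<comment> \<open>For a point that matches \<open>z\<close> in \<open>Y\<close> at radius
      \<open>t\<close>, both sets ask whether the re-rooted \<open>z\<close> lies in
      \<open>U\<close>.\<close>
    have "m (T l -` S r U) = m (S t V)"
    proof (rule eq_if_agree_on_full[OF S_Y[of t]])
      show "T l -` S r U \<inter> S t Y = S t V \<inter> S t Y"
      proof (intro subset_antisym subsetI)
        fix p assume "p \<in> T l -` S r U \<inter> S t Y"
        then obtain u z where u: "u \<in> U" "agree ?n r (tr (T l p)) (strace u)"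
          and z: "z \<in> Y" "agree ?n t (tr p) (strace z)" by (auto simp: S_def)
        have "agr r u (change_root G (lval l) z)" using u z T agr_if_match by blast
        then have "z \<in> V" using r u z closed[OF g] by (auto simp: det_def V_def)
        then show "p \<in> S t V \<inter> S t Y" using z by (auto simp: S_def)
      next
        fix p assume p: "p \<in> S t V \<inter> S t Y"
        then obtain y where "y \<in> V" "agree ?n t (tr p) (strace y)" by (auto simp: S_def)
        then show "p \<in> T l -` S r U \<inter> S t Y" using p T by (auto simp: S_def V_def)
      qed
    qed
    then have "\<nu> V = \<nu> U" using shift[OF l] \<nu>[OF r] \<nu>[OF dV] by simp
    moreover have "V \<in> M" using dV by (auto simp: M_def)
    moreover have "?\<alpha> (lval l) -` U \<inter> space \<mu> = V" by (auto simp: \<mu>(1) V_def act_on_def)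
    moreover have "U \<in> sets \<mu>" using U by (simp add: \<mu>(2) sigma_sets.Basic)
    ultimately show "emeasure (distr \<mu> \<mu> (?\<alpha> (lval l))) U = emeasure \<mu> U"
      using \<mu>(3) U meas[OF g] by (simp add: emeasure_distr)
  qed
  have comp: "distr \<mu> \<mu> (?\<alpha> (g \<otimes> h)) = \<mu>"
    if "g \<in> carrier G" "h \<in> carrier G" "distr \<mu> \<mu> (?\<alpha> g) = \<mu>" "distr \<mu> \<mu> (?\<alpha> h) = \<mu>" for g h
  proof -
    have "?\<alpha> (g \<otimes> h) y = (?\<alpha> g \<circ> ?\<alpha> h) y" if "y \<in> space \<mu>" for y
    proof -
      have y: "y \<in> Y" using that \<mu>(1) by simp
      then have "(fst y, snd y) \<in> Sch G K" using Y(1) by auto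
      from change_root_mult[OF this \<open>g \<in> carrier G\<close> \<open>h \<in> carrier G\<close>]
      show ?thesis using y closed[OF \<open>h \<in> carrier G\<close> y] by (simp add: act_on_def)
    qed
    then have "distr \<mu> \<mu> (?\<alpha> (g \<otimes> h)) = distr \<mu> \<mu> (?\<alpha> g \<circ> ?\<alpha> h)"
      by (intro distr_cong) auto
    also have "\<dots> = distr (distr \<mu> \<mu> (?\<alpha> h)) \<mu> (?\<alpha> g)"
      by (rule distr_distr[symmetric]) (use meas that in auto)
    finally show ?thesis using that by simp
  qed
  have "distr \<mu> \<mu> (?\<alpha> g) = \<mu>" if "g \<in> carrier G" for g
    using Q that
  proof (induction g rule: generating_induct)
    case one
    have "?\<alpha> \<one> y = y" if "y \<in> space \<mu>" for y
    proof -
      have "y \<in> Y" using that \<mu>(1) by simp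
      then have yS: "(fst y, snd y) \<in> Sch G K" using Y(1) by auto
      show ?thesis
        using \<open>y \<in> Y\<close> change_root_fixes[OF yS] subgroup.one_closed[OF SchD(1)[OF yS]] by (simp add: act_on_def)
    qed
    then show ?case using distr_cong[of \<mu> \<mu> \<mu> \<mu> "?\<alpha> \<one>" "\<lambda>y. y"] by (simp add: distr_id)
  next
    case (gen i g)
    then show ?case
      using comp[of "lval (i, True)" g] letter_invariant[of "(i, True)"] lval_closed[of "(i, True)"]
      by (simp add: lval_def letters_def)
  next
    case (inv i g)
    then show ?case
      using comp[of "lval (i, False)" g] letter_invariant[of "(i, False)"] lval_closed[of "(i, False)"]
      by (simp add: lval_def letters_def)
  qed
  then have "invariant_borel_probability G ?X ?\<alpha> \<mu>"
    unfolding invariant_borel_probability_def top using \<mu>(1) sets prob meas by blast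
  then show ?thesis by blast
qed

text \<open>All graphs involved have degree at most twice the number of generators, so one alphabet
  serves the whole approximation. That \<open>Y\<close> is nonempty comes out through the
  probability measure on it.\<close>

theorem sofic_subshift:
  assumes "sofic_URS G Q Z"
  defines "D \<equiv> 2 * length Q + 1"
  defines "K \<equiv> {..<4 * D\<^sup>2 + 4 * D}"
  defines "Y \<equiv> nonrepetitive_subshift K Z"
  shows "bernoulli_subshift_of G Q K Z Y"
    and "Z_proper G Z (subtopology (Sch_topology G Q K) Y) (act_on Y (change_root G))"
    and "\<exists>\<mu>. invariant_borel_probability G
      (subtopology (Sch_topology G Q K) Y) (act_on Y (change_root G)) \<mu>"
proof -
  let ?n = "length Q" and ?X = "subtopology (Sch_topology G Q K) Y"
  have Z: "closedin (Sub_topology G) Z" "\<And>g H. g \<in> carrier G \<Longrightarrow> H \<in> Z \<Longrightarrow> conj_sub G g H \<in> Z"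
    using assms(1) by (auto simp: sofic_URS_def URS_def)
  have "0 \<in> K" by (simp add: K_def D_def)
  then have K: "finite K" "K \<noteq> {}" by (simp add: K_def, blast)
  have clY: "closedin (Sch_topology G Q K) Y"
    unfolding Y_def by (rule closedin_nonrepetitive_subshift[OF Z(1)])
  have closed: "change_root G g y \<in> Y" if "g \<in> carrier G" "y \<in> Y" for g y
    using that change_root_in_subshift[OF Z] unfolding Y_def by blast
  have "Y \<subseteq> B_space G K Z" by (auto simp: Y_def nonrepetitive_subshift_def)
  then show "bernoulli_subshift_of G Q K Z Y"
    unfolding bernoulli_subshift_of_def using K clY closed by (auto intro: closedin_subset_topspace)
  show proper: "Z_proper G Z ?X (act_on Y (change_root G))"
    unfolding Y_def by (rule Z_proper_nonrepetitive_subshift[OF Z K(1)])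
  obtain L where L: "sofic_approximation G Q Z L" using assms(1) by (auto simp: sofic_URS_def)
  let ?FG = "free_group ?n" and ?fg = "free_generators ?n"
  define S where "S k = schreier_graph ?FG ?fg (L k)" for k
  define b where "b = letter_act ?FG ?fg"
  interpret FG: group ?FG by (rule group_free_group)
  have sub: "subgroup (L k) ?FG" and fin: "finite (verts (S k))" for k
    using L by (auto simp: sofic_approximation_def Let_def S_def)
  have good: "\<exists>N. \<forall>k\<ge>N. real (card {p \<in> verts (S k). Zr_vertex G Q Z r (S k) p}) \<ge>
    (1 - \<epsilon>) * real (card (verts (S k)))" if "r \<ge> 1" "\<epsilon> > 0" for r \<epsilon>
    using L that by (auto simp: sofic_approximation_def Let_def S_def)
  have "set ?fg \<subseteq> carrier ?FG"
    by (auto simp: free_generators_def free_group_def reduced_Cons)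
  then have graph: "letter_graph ?n (S k) b" for k
    using FG.letter_graph_schreier_graph[OF _ sub[of k], of ?fg]
    by (simp add: S_def b_def free_generators_def)
  have "\<exists>c \<in> verts (S k) \<rightarrow>\<^sub>E K. nonrep (S k) c" for k
    unfolding K_def
    by (rule bounded_degree_graph.ex_nonrepetitive_coloring[OF letter_graph.bounded_degree[OF graph, folded D_def] fin order_refl])
  then obtain c where c: "\<And>k. c k \<in> verts (S k) \<rightarrow>\<^sub>E K" "\<And>k. nonrep (S k) (c k)" by metis
  let ?V = "\<lambda>k. verts (S k)"
  have ne: "?V k \<noteq> {}" for k using FG.root_in_schreier_graph[OF sub[of k]] by (auto simp: S_def)
  obtain m where m: "finitely_additive_mean m"
    and m1: "\<And>C. (\<lambda>k. frequency ?V k C) \<longlonglongrightarrow> 1 \<Longrightarrow> m C = 1"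
    and m2: "\<And>C C'. (\<And>k. frequency ?V k C = frequency ?V k C') \<Longrightarrow> m C = m C'"
    using ex_limit_mean[of ?V] fin ne by blast
  define tr where "tr = (\<lambda>(k, p). trace b (c k) p)"
  \<comment> \<open>Letters move a vertex within its own graph, by the free group. A relation of
    \<open>G\<close> need not hold at every vertex, which is why the measure is built from moves by
    single letters.\<close>
  define T where "T l = (\<lambda>(k :: nat, p). (k, b l p))" for l
  show "\<exists>\<mu>. invariant_borel_probability G ?X (act_on Y (change_root G)) \<mu>"
  proof (rule ex_invariant_measure[where tr = tr and T = T, OF _ _ closed m])
    show YS: "Y \<subseteq> Sch G K" unfolding Y_def by (rule subshift_subset_Sch)
    show "compact_space ?X" using proper by (simp add: Z_proper_def)
    show "m {p. \<exists>y\<in>Y. agree ?n r (tr p) (strace y)} = 1" for r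
    proof (rule m1, rule LIMSEQ_I)
      fix \<epsilon> :: real assume \<epsilon>: "\<epsilon> > 0"
      let ?C = "{p. \<exists>y\<in>Y. agree ?n r (tr p) (strace y)}"
      obtain s where s: "s \<ge> 1" "\<forall>S b c p. letter_graph ?n S b \<longrightarrow> p \<in> verts (S :: letter list set lgraph) \<longrightarrow>
          c \<in> verts S \<rightarrow> K \<longrightarrow> nonrep S c \<longrightarrow> Zr_vertex G Q Z s S p \<longrightarrow>
          (\<exists>y\<in>Y. agree ?n r (trace b c p) (strace y))"
        using nonrepetitive_Zr_vertex_match[where 'w = "letter list set", OF Z(1) K] unfolding Y_def by blast
      \<comment> \<open>Half of \<open>\<epsilon>\<close> leaves room for the strict inequality
        required of a limit.\<close>
      obtain N where N: "\<And>k. k \<ge> N \<Longrightarrow> real (card {p \<in> ?V k. Zr_vertex G Q Z s (S k) p}) \<ge>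
        (1 - \<epsilon> / 2) * real (card (?V k))"
        using good[OF s(1), of "\<epsilon> / 2"] \<epsilon> by auto
      have "norm (frequency ?V k ?C - 1) < \<epsilon>" if "k \<ge> N" for k
      proof -
        have pos: "real (card (?V k)) > 0" using fin ne by (simp add: card_gt_0_iff)
        have "{p \<in> ?V k. Zr_vertex G Q Z s (S k) p} \<subseteq> {p \<in> ?V k. (k, p) \<in> ?C}"
          using s(2)[rule_format, OF graph[of k] _ _ c(2)[of k]] c(1)[of k] by (auto simp: tr_def)
        then have "real (card {p \<in> ?V k. Zr_vertex G Q Z s (S k) p}) \<le> real (card {p \<in> ?V k. (k, p) \<in> ?C})"
          using fin by (intro of_nat_mono card_mono) auto
        then have "(1 - \<epsilon> / 2) * real (card (?V k)) \<le> real (card {p \<in> ?V k. (k, p) \<in> ?C})"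
          using N[OF that] by linarith
        then have "1 - \<epsilon> / 2 \<le> frequency ?V k ?C" using pos by (simp add: frequency_def pos_le_divide_eq)
        moreover have "frequency ?V k ?C \<le> 1"
          using pos fin by (auto simp: frequency_def divide_le_eq_1 intro!: card_mono)
        ultimately show ?thesis using \<epsilon> by (simp add: abs_if)
      qed
      then show "\<exists>N. \<forall>k\<ge>N. norm (frequency ?V k ?C - 1) < \<epsilon>" by blast
    qed
    show "m (T l -` C) = m C" if l: "l \<in> letters ?n" for l C
    proof (rule m2)
      fix k
      interpret letter_graph ?n "S k" b by (rule graph)
      have fl: "flip l \<in> letters ?n" using l by simp
      \<comment> \<open>A letter permutes the vertices of each finite graph and so preserves counts;
        this is the source of the invariance.\<close>
      have "bij_betw (b l) {p \<in> ?V k. (k, p) \<in> T l -` C} {p \<in> ?V k. (k, p) \<in> C}"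
        using act_closed l act_closed[OF _ fl] act_flip[OF _ l] act_flip[OF _ fl]
        by (intro bij_betwI[where g = "b (flip l)"]) (auto simp: T_def)
      then show "frequency ?V k (T l -` C) = frequency ?V k C"
        by (simp add: frequency_def bij_betw_same_card)
    qed
    fix l r and p :: "nat \<times> letter list set" and y
    assume l: "l \<in> letters ?n" and y: "y \<in> Y" and a: "agree ?n (Suc r) (tr p) (strace y)"
    obtain k q where p: "p = (k, q)" by (cases p)
    obtain H d where yH: "y = (H, d)" by (cases y)
    have H: "subgroup H G" using y YS by (auto simp: yH Sch_def)
    have "agree ?n r (trace b (c k) (b l q)) (trace act d (act l H))"
      using agree_trace_step[OF a[unfolded tr_def strace_def p yH prod.case fst_conv snd_conv] l] .
    then have "agree ?n r (trace b (c k) (b l q)) (trace act d (lval l <# H))" by (simp add: act_eq)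
    then show "agree ?n r (tr (T l p)) (strace (change_root G (lval l) y))"
      using agree_change_root[OF H lval_closed[OF l], of r d]
      unfolding tr_def T_def p yH strace_def prod.case by (meson agree_sym agree_trans)
  qed
qed

end

section \<open>Free subshifts of sofic groups\<close>

text \<open>For trivial \<open>H\<close> the vertices gH correspond to the elements g and re-rooting
  is the shift, so \<open>h\<close> embeds the subshift equivariantly into functions on the group.
  The image is compact, hence closed, and its stabilizers are the underlying subgroups, all
  trivial.\<close>

lemma (in generated_group) sofic_free_subshift:
  assumes "sofic_URS G Q {{\<one>}}"
  shows "\<exists>K Y. bernoulli_subshift G K Y \<and> free_action G Y (act_on Y (coord_shift G)) \<and>
    (\<exists>\<mu>. invariant_borel_probability G
      (subtopology (shift_topology G K) Y) (act_on Y (coord_shift G)) \<mu>)"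
proof -
  let ?D = "2 * length Q + 1"
  define K where "K = {..<4 * ?D\<^sup>2 + 4 * ?D}"
  define Y where "Y = nonrepetitive_subshift K {{\<one>}}"
  let ?X = "subtopology (Sch_topology G Q K) Y" and ?\<alpha> = "act_on Y (change_root G)"
  note sofic = sofic_subshift[OF assms, folded K_def, folded Y_def]
  have YS: "Y \<subseteq> Sch G K" unfolding Y_def by (rule subshift_subset_Sch)
  have top: "topspace ?X = Y" using YS by auto
  have closed: "change_root G g y \<in> Y" if "g \<in> carrier G" "y \<in> Y" for g y
    using sofic(1) that by (auto simp: bernoulli_subshift_of_def)
  have root: "fst y = {\<one>}" if "y \<in> Y" for y
    using that by (auto simp: Y_def nonrepetitive_subshift_def B_space_def)
  define h :: "'a colored_schreier \<Rightarrow> 'a \<Rightarrow> nat" where "h = (\<lambda>y. \<lambda>a\<in>carrier G. snd y (a <# fst y))"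
  let ?Y = "h ` Y" and ?T = "shift_topology G K"
  let ?\<beta> = "act_on ?Y (coord_shift G)"
  have h_cont: "continuous_map ?X ?T h"
    unfolding shift_topology_def continuous_map_componentwise
  proof (intro conjI ballI)
    show "h ` topspace ?X \<subseteq> extensional (carrier G)" by (auto simp: h_def)
    fix a assume a: "a \<in> carrier G"
    obtain r where r: "\<And>x y. x \<in> Sch G K \<Longrightarrow> y \<in> Sch G K \<Longrightarrow> agr r x y \<Longrightarrow>
      (a \<in> fst x \<longleftrightarrow> a \<in> fst y) \<and> snd x (a <# fst x) = snd y (a <# fst y)"
      using agr_determines_coset[OF a] by metis
    have "openin ?X {y \<in> Y. h y a \<in> U}" for U
      unfolding openin_sub_iff[OF YS]
    proof (intro conjI ballI exI[of _ r] impI)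
      fix x y assume "x \<in> {y \<in> Y. h y a \<in> U}" "y \<in> Y" "agr r x y"
      moreover from this have "h y a = h x a" using r[OF subsetD[OF YS] subsetD[OF YS], of x y] a
        by (simp add: h_def)
      ultimately show "y \<in> {y \<in> Y. h y a \<in> U}" by simp
    qed auto
    moreover have "h y a \<in> K" if "y \<in> Y" for y
      using that YS SchD(2)[of y K] lcosetsI[OF a, of "fst y"] a by (auto simp: h_def)
    ultimately show "continuous_map ?X (discrete_topology K) (\<lambda>y. h y a)"
      unfolding continuous_map_def top by auto
  qed
  have h_inj: "inj_on h Y"
  proof (rule inj_onI)
    fix x y assume x: "x \<in> Y" and y: "y \<in> Y" and eq: "h x = h y"
    have "snd x = snd y"
    proof (rule PiE_ext)
      show "snd x \<in> lcosets {\<one>} \<rightarrow>\<^sub>E K" "snd y \<in> lcosets {\<one>} \<rightarrow>\<^sub>E K"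
        using SchD(2)[of x K] SchD(2)[of y K] x y YS root by auto
      fix X assume "X \<in> lcosets {\<one>}"
      then obtain a where "a \<in> carrier G" "X = a <# {\<one>}" by (rule lcosetsE)
      then show "snd x X = snd y X" using fun_cong[OF eq, of a] root[OF x] root[OF y] by (simp add: h_def)
    qed
    then show "x = y" using root[OF x] root[OF y] by (simp add: prod_eq_iff)
  qed
  have equiv: "coord_shift G g (h y) = h (change_root G g y)" if g: "g \<in> carrier G" and y: "y \<in> Y" for g y
  proof -
    obtain H c where yH: "y = (H, c)" by (cases y)
    have H: "H \<subseteq> carrier G" using root[OF y] by (simp add: yH)
    show ?thesis
      using g H by (auto simp: coord_shift_def h_def yH change_root_def lcosetsI lcos_conj_sub fun_eq_iff)
  qed
  have h_closed: "coord_shift G g x \<in> ?Y" if "g \<in> carrier G" "x \<in> ?Y" for g x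
    using that equiv closed by auto
  have "compactin ?X Y" using sofic(2) top by (auto simp: Z_proper_def compact_space_def)
  then have "compactin ?T ?Y" using h_cont by (rule image_compactin)
  moreover have "Hausdorff_space ?T"
    by (simp add: shift_topology_def Hausdorff_space_product_topology)
  ultimately have "closedin ?T ?Y" by (simp add: compactin_imp_closedin)
  then have "bernoulli_subshift G K ?Y"
    using h_closed by (simp add: bernoulli_subshift_def K_def)
  moreover have "group_action G ?Y ?\<beta>"
  proof (rule group_action_act_on)
    fix x assume "x \<in> ?Y"
    then obtain y where y: "y \<in> Y" "x = h y" by blast
    then have yS: "(fst y, snd y) \<in> Sch G K" using YS by auto
    have "change_root G \<one> y = y"
      using change_root_fixes[OF yS] root[OF y(1)] by (metis prod.collapse singletonI)
    then show "coord_shift G \<one> x = x" using equiv[OF one_closed y(1)] y(2) by simp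
    fix g k assume gk: "g \<in> carrier G" "k \<in> carrier G"
    show "coord_shift G (g \<otimes> k) x = coord_shift G g (coord_shift G k x)"
      using equiv[OF m_closed[OF gk] y(1)] equiv[OF gk(2) y(1)] equiv[OF gk(1) closed[OF gk(2) y(1)]]
        change_root_mult[OF yS gk] y(2) by simp
  qed (rule h_closed)
  moreover have "stabilizer G ?\<beta> x = {\<one>}" if x: "x \<in> ?Y" for x
  proof -
    obtain y where y: "y \<in> Y" "x = h y" using x by blast
    have "?\<beta> g x = x \<longleftrightarrow> g = \<one>" if g: "g \<in> carrier G" for g
    proof -
      have "?\<beta> g x = x \<longleftrightarrow> h (change_root G g y) = h y"
        using y equiv[OF g y(1)] by (simp add: act_on_def)
      also have "\<dots> \<longleftrightarrow> change_root G g y = y"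
        using inj_on_eq_iff[OF h_inj closed[OF g y(1)] y(1)] .
      also have "\<dots> \<longleftrightarrow> g = \<one>"
        using change_root_fixed_iff[of y K _ g] y(1) g root[OF y(1)] by (simp add: Y_def)
      finally show ?thesis .
    qed
    then show ?thesis by (auto simp: stabilizer_def)
  qed
  moreover have "\<exists>\<mu>. invariant_borel_probability G (subtopology ?T ?Y) ?\<beta> \<mu>"
  proof -
    obtain \<mu> where \<mu>: "invariant_borel_probability G ?X ?\<alpha> \<mu>" using sofic(3) by blast
    show ?thesis
    proof (rule invariant_measure_image[OF \<mu>])
      show "continuous_map ?X (subtopology ?T ?Y) h"
        using h_cont top by (simp add: continuous_map_in_subtopology)
      show "?\<beta> g (h y) = h (?\<alpha> g y)" if "g \<in> carrier G" "y \<in> topspace ?X" for g y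
        using that equiv unfolding top by (simp add: act_on_def)
      fix g assume g: "g \<in> carrier G"
      have "continuous_map ?T ?T (coord_shift G g)"
        unfolding shift_topology_def continuous_map_componentwise
        using g by (auto simp: coord_shift_def intro!: continuous_map_product_projection)
      then have "continuous_map (subtopology ?T ?Y) ?T (coord_shift G g)"
        by (rule continuous_map_from_subtopology)
      then have "continuous_map (subtopology ?T ?Y) (subtopology ?T ?Y) (coord_shift G g)"
        using h_closed[OF g] by (auto simp: continuous_map_in_subtopology)
      then show "continuous_map (subtopology ?T ?Y) (subtopology ?T ?Y) (?\<beta> g)"
        by (rule continuous_map_eq) (simp add: act_on_def)
    qed
  qed
  ultimately show ?thesis unfolding free_action_def by blast
qed

theorem theorem2:
  fixes G :: "('a, 'b) monoid_scheme"
  assumes "group G"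
  shows "(\<forall>Q Z. generating_system G Q \<and> sofic_URS G Q Z \<longrightarrow>
            (\<exists>K Y. bernoulli_subshift_of G Q K Z Y \<and>
               Z_proper G Z (subtopology (Sch_topology G Q K) Y) (act_on Y (change_root G)) \<and>
               (\<exists>\<mu>. invariant_borel_probability G
                      (subtopology (Sch_topology G Q K) Y) (act_on Y (change_root G)) \<mu>))) \<and>
         (sofic_group G \<longrightarrow>
            (\<exists>K Y. bernoulli_subshift G K Y \<and>
               free_action G Y (act_on Y (coord_shift G)) \<and>
               (\<exists>\<mu>. invariant_borel_probability G
                      (subtopology (shift_topology G K) Y) (act_on Y (coord_shift G)) \<mu>)))"
proof (intro conjI allI impI)
  fix Q Z assume QZ: "generating_system G Q \<and> sofic_URS G Q Z"
  then interpret generated_group G Q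
    using assms by (intro generated_group.intro generated_group_axioms.intro) auto
  show "\<exists>K Y. bernoulli_subshift_of G Q K Z Y \<and>
      Z_proper G Z (subtopology (Sch_topology G Q K) Y) (act_on Y (change_root G)) \<and>
      (\<exists>\<mu>. invariant_borel_probability G
        (subtopology (Sch_topology G Q K) Y) (act_on Y (change_root G)) \<mu>)"
    using sofic_subshift[OF conjunct2[OF QZ]] by blast
next
  assume "sofic_group G"
  then obtain Q where sofic: "generating_system G Q" "sofic_URS G Q {{\<one>\<^bsub>G\<^esub>}}"
    by (auto simp: sofic_group_def)
  interpret generated_group G Q
    using assms sofic(1) by (intro generated_group.intro generated_group_axioms.intro)
  show "\<exists>K Y. bernoulli_subshift G K Y \<and> free_action G Y (act_on Y (coord_shift G)) \<and>
      (\<exists>\<mu>. invariant_borel_probability G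
        (subtopology (shift_topology G K) Y) (act_on Y (coord_shift G)) \<mu>)"
    by (rule sofic_free_subshift[OF sofic(2)])
qed

end
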